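(* Let $(X,G)$ be a dynamical system, i.e. $X$ is a uniform space and $G$ is a subgroup of $\mathrm{Aut}(X)$. If the asymptotic uniform complexity satisfies $\omega(X,G)=1$, then $(X,G)$ is amenable. Conversely, if $X$ is a perfect Hausdorff space and $(X,G)$ is amenable, then $\omega(X,G)=1$.
   Context: Set notation: $\mathcal{P}(X)$ is the power set of $X$ and $\mathcal{F}(X)$ the set of finite subsets of $X$. For $\mathcal{U},\mathcal{V}\subseteq\mathcal{P}(X)$, write $\mathcal{U}\preceq\mathcal{V}$ ("$\mathcal{V}$ refines $\mathcal{U}$") if every $V\in\mathcal{V}$ is contained in some $U\in\mathcal{U}$; put $\mathcal{U}\vee\mathcal{V}=\{U\cap V\mid U\in\mathcal{U},V\in\mathcal{V}\}$. For $S\subseteq X$ put $\mathrm{St}(S,\mathcal{U})=\bigcup\{U\in\mathcal{U}\mid U\cap S\neq\emptyset\}$, $\mathrm{St}(x,\mathcal{U})=\mathrm{St}(\{x\},\mathcal{U})$, and $\mathcal{U}^{\ast}=\{\mathrm{St}(U,\mathcal{U})\mid U\in\mathcal{U}\}$; write $\mathcal{U}\preceq^{\ast}\mathcal{V}$ if $\mathcal{U}\preceq\mathcal{V}^{\ast}$. A covering of $X$ is a $\mathcal{U}\subseteq\mathcal{P}(X)$ with $\bigcup\mathcal{U}=X$. Uniform spaces (via coverings): a uniformity on $X$ is a non-empty set $\mathcal{D}$ of coverings of $X$ such that (1) if $\mathcal{U}\in\mathcal{D}$ and $\mathcal{V}$ is a covering of $X$ with $\mathcal{V}\preceq\mathcal{U}$,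 then $\mathcal{V}\in\mathcal{D}$; (2) for all $\mathcal{U},\mathcal{V}\in\mathcal{D}$ there is $\mathcal{W}\in\mathcal{D}$ with $\mathcal{U}\preceq^{\ast}\mathcal{W}$ and $\mathcal{V}\preceq^{\ast}\mathcal{W}$. A uniform space is a non-empty set $X$ with a uniformity, whose elements are called uniform coverings. $\mathcal{N}(X)$ is the set of finite uniform coverings of $X$. The topology of $X$: $S\subseteq X$ is open iff for every $x\in S$ there is a uniform covering $\mathcal{U}$ with $\mathrm{St}(x,\mathcal{U})\subseteq S$. "Perfect" means that this topology has no isolated points, and "Hausdorff" refers to this topology. A map $f\colon X\to Y$ of uniform spaces is uniformly continuous if $f^{-1}(\mathcal{U})=\{f^{-1}(U)\mid U\in\mathcal{U}\}$ is a uniform covering of $X$ for each uniform covering $\mathcal{U}$ of $Y$. $\mathrm{Aut}(X)$ is the group of bijections $X\to X$ that are uniformly continuous with uniformly continuous inverse. For $g\in\mathrm{Aut}(X)$, $g(\mathcal{V})=\{g(V)\mid V\in\mathcal{V}\}$. Amenability: $UC_b(X)$ is the space of bounded uniformly continuous functions $X\to\mathbb{R}$ ($\mathbb{R}$ with its usual metric uniformity). A mean on $UC_b(X)$ is a linear map $m\colon UC_b(X)\to\mathbb{R}$ with $\inf_{x\in X} f(x)\leq m(f)\leq\sup_{x\in X} f(x)$ for all $f$. $(X,G)$ is amenable if there is a mean $m$ on $UC_b(X)$ with $m(f\circ g)=m(f)$ for all $f\in UC_b(X)$, $g\in G$. Uniform complexity: for $\mathcal{U}\in\mathcal{N}(X)$,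 $N(\mathcal{U})=\inf\{|\mathcal{V}|\mid\mathcal{V}\in\mathcal{N}(X),\ \mathcal{U}\preceq\mathcal{V}\}$. Asymptotic uniform complexity: $$\omega(X,G)=\sup_{E\in\mathcal{F}(G)}\ \sup_{\mathcal{U}\in\mathcal{N}(X)}\ \inf\left\{\sup_{g\in E}\frac{N(\mathcal{V}\vee g(\mathcal{V}))}{N(\mathcal{V})}\ \middle|\ \mathcal{V}\in\mathcal{N}(X),\ \mathcal{U}\preceq\mathcal{V}\right\}$$ (empty suprema are taken in the extended reals; $E=\emptyset$ does not affect the value). *)

theory Defs
  imports "HOL-Analysis.Analysis" "HOL-Algebra.Bij"
begin

section \<open>Coverings\<close>

text \<open>\<open>\<U> \<preceq> \<V>\<close> is read ``\<open>\<V>\<close> refines \<open>\<U>\<close>'': the finer family is on the right.\<close>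

definition refined_by :: "'a set set \<Rightarrow> 'a set set \<Rightarrow> bool"  (infix "\<preceq>" 50)
  where "\<U> \<preceq> \<V> \<longleftrightarrow> (\<forall>V\<in>\<V>. \<exists>U\<in>\<U>. V \<subseteq> U)"

definition cover_join :: "'a set set \<Rightarrow> 'a set set \<Rightarrow> 'a set set"  (infixl "\<squnion>\<^sub>c" 65)
  where "\<U> \<squnion>\<^sub>c \<V> = {U \<inter> V | U V. U \<in> \<U> \<and> V \<in> \<V>}"

definition St :: "'a set \<Rightarrow> 'a set set \<Rightarrow> 'a set"
  where "St S \<U> = \<Union> {U \<in> \<U>. U \<inter> S \<noteq> {}}"

definition star_cover :: "'a set set \<Rightarrow> 'a set set"
  where "star_cover \<U> = {St U \<U> | U. U \<in> \<U>}"

definition star_refined_by :: "'a set set \<Rightarrow> 'a set set \<Rightarrow> bool"  (infix "\<preceq>\<^sup>*" 50)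
  where "\<U> \<preceq>\<^sup>* \<V> \<longleftrightarrow> \<U> \<preceq> star_cover \<V>"

definition covering :: "'a set \<Rightarrow> 'a set set \<Rightarrow> bool"
  where "covering X \<U> \<longleftrightarrow> \<U> \<subseteq> Pow X \<and> \<Union>\<U> = X"

section \<open>Uniform spaces\<close>

definition cover_uniformity :: "'a set \<Rightarrow> 'a set set set \<Rightarrow> bool"
  where "cover_uniformity X \<D> \<longleftrightarrow>
    \<D> \<noteq> {} \<and>
    (\<forall>\<U>\<in>\<D>. covering X \<U>) \<and>
    (\<forall>\<U>\<in>\<D>. \<forall>\<V>. covering X \<V> \<and> \<V> \<preceq> \<U> \<longrightarrow> \<V> \<in> \<D>) \<and>
    (\<forall>\<U>\<in>\<D>. \<forall>\<V>\<in>\<D>. \<exists>\<W>\<in>\<D>. \<U> \<preceq>\<^sup>* \<W> \<and> \<V> \<preceq>\<^sup>* \<W>)"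

definition cover_uniform_space :: "'a set \<Rightarrow> 'a set set set \<Rightarrow> bool"
  where "cover_uniform_space X \<D> \<longleftrightarrow> X \<noteq> {} \<and> cover_uniformity X \<D>"

definition finite_uniform_coverings :: "'a set set set \<Rightarrow> 'a set set set"  ("\<N>")
  where "\<N> \<D> = {\<U> \<in> \<D>. finite \<U>}"

definition cover_topology :: "'a set \<Rightarrow> 'a set set set \<Rightarrow> 'a topology"
  where "cover_topology X \<D> =
    topology (\<lambda>S. S \<subseteq> X \<and> (\<forall>x\<in>S. \<exists>\<U>\<in>\<D>. St {x} \<U> \<subseteq> S))"

lemma istopology_cover_topology:
  assumes "cover_uniformity X \<D>"
  shows "istopology (\<lambda>S. S \<subseteq> X \<and> (\<forall>x\<in>S. \<exists>\<U>\<in>\<D>. St {x} \<U> \<subseteq> S))"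
  unfolding istopology_def
proof (intro conjI allI impI)
  fix S T
  assume S: "S \<subseteq> X \<and> (\<forall>x\<in>S. \<exists>\<U>\<in>\<D>. St {x} \<U> \<subseteq> S)"
    and T: "T \<subseteq> X \<and> (\<forall>x\<in>T. \<exists>\<U>\<in>\<D>. St {x} \<U> \<subseteq> T)"
  show "S \<inter> T \<subseteq> X" using S by blast
  show "\<forall>x\<in>S \<inter> T. \<exists>\<U>\<in>\<D>. St {x} \<U> \<subseteq> S \<inter> T"
  proof
    fix x assume "x \<in> S \<inter> T"
    then obtain \<U> \<V> where UV: "\<U> \<in> \<D>" "\<V> \<in> \<D>" "St {x} \<U> \<subseteq> S" "St {x} \<V> \<subseteq> T"
      using S T by blast
    then obtain \<W> where W: "\<W> \<in> \<D>" "\<U> \<preceq>\<^sup>* \<W>" "\<V> \<preceq>\<^sup>* \<W>"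
      using assms unfolding cover_uniformity_def by meson
    have "St {x} \<W> \<subseteq> St {x} \<A>" if A: "\<A> \<preceq>\<^sup>* \<W>" for \<A>
    proof
      fix y assume "y \<in> St {x} \<W>"
      then obtain W where W: "W \<in> \<W>" "x \<in> W" "y \<in> W" by (auto simp: St_def)
      then obtain A where "A \<in> \<A>" "St W \<W> \<subseteq> A"
        using A unfolding star_refined_by_def refined_by_def star_cover_def by blast
      moreover have "W \<subseteq> St W \<W>" using W by (auto simp: St_def)
      ultimately show "y \<in> St {x} \<A>" using W by (auto simp: St_def)
    qed
    then show "\<exists>\<U>\<in>\<D>. St {x} \<U> \<subseteq> S \<inter> T" using UV W by blast
  qed
next
  fix \<K>
  assume K: "\<forall>K\<in>\<K>. K \<subseteq> X \<and> (\<forall>x\<in>K. \<exists>\<U>\<in>\<D>. St {x} \<U> \<subseteq> K)"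
  then show "\<Union>\<K> \<subseteq> X" by blast
  show "\<forall>x\<in>\<Union>\<K>. \<exists>\<U>\<in>\<D>. St {x} \<U> \<subseteq> \<Union>\<K>"
  proof
    fix x assume "x \<in> \<Union>\<K>"
    then obtain K where "K \<in> \<K>" "x \<in> K" by blast
    then obtain \<U> where "\<U> \<in> \<D>" "St {x} \<U> \<subseteq> K" using K by blast
    then show "\<exists>\<U>\<in>\<D>. St {x} \<U> \<subseteq> \<Union>\<K>" using \<open>K \<in> \<K>\<close> by blast
  qed
qed

lemma openin_cover_topology:
  assumes "cover_uniformity X \<D>"
  shows "openin (cover_topology X \<D>) S \<longleftrightarrow> S \<subseteq> X \<and> (\<forall>x\<in>S. \<exists>\<U>\<in>\<D>. St {x} \<U> \<subseteq> S)"
  unfolding cover_topology_def topology_inverse'[OF istopology_cover_topology[OF assms]] ..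

lemma topspace_cover_topology:
  assumes "cover_uniformity X \<D>"
  shows "topspace (cover_topology X \<D>) = X"
proof (rule antisym)
  have "openin (cover_topology X \<D>) (topspace (cover_topology X \<D>))" by simp
  then show "topspace (cover_topology X \<D>) \<subseteq> X"
    by (simp only: openin_cover_topology[OF assms])
  obtain \<U> where "\<U> \<in> \<D>" using assms by (auto simp: cover_uniformity_def)
  moreover have "St {x} \<U> \<subseteq> X" for x
  proof -
    have "covering X \<U>" using assms \<open>\<U> \<in> \<D>\<close> by (simp add: cover_uniformity_def)
    then show ?thesis by (auto simp: covering_def St_def)
  qed
  ultimately have "openin (cover_topology X \<D>) X"
    unfolding openin_cover_topology[OF assms] by blast
  then show "X \<subseteq> topspace (cover_topology X \<D>)" by (rule openin_subset)
qed

definition no_isolated_points :: "'a topology \<Rightarrow> bool"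
  where "no_isolated_points T \<longleftrightarrow> (\<forall>x\<in>topspace T. \<not> openin T {x})"

definition cover_uniformly_continuous ::
    "'a set \<Rightarrow> 'a set set set \<Rightarrow> 'b set \<Rightarrow> 'b set set set \<Rightarrow> ('a \<Rightarrow> 'b) \<Rightarrow> bool"
  where "cover_uniformly_continuous X \<D> Y \<E> f \<longleftrightarrow>
    f \<in> X \<rightarrow> Y \<and> (\<forall>\<U>\<in>\<E>. (\<lambda>U. f -` U \<inter> X) ` \<U> \<in> \<D>)"

section \<open>Automorphisms and dynamical systems\<close>

definition uniform_automorphisms :: "'a set \<Rightarrow> 'a set set set \<Rightarrow> ('a \<Rightarrow> 'a) set"
  where "uniform_automorphisms X \<D> =
    {g \<in> Bij X. cover_uniformly_continuous X \<D> X \<D> g \<and>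
                cover_uniformly_continuous X \<D> X \<D> (inv_into X g)}"

definition Aut :: "'a set \<Rightarrow> 'a set set set \<Rightarrow> ('a \<Rightarrow> 'a) monoid"
  where "Aut X \<D> = (BijGroup X)\<lparr>carrier := uniform_automorphisms X \<D>\<rparr>"

definition dynamical_system :: "'a set \<Rightarrow> 'a set set set \<Rightarrow> ('a \<Rightarrow> 'a) set \<Rightarrow> bool"
  where "dynamical_system X \<D> G \<longleftrightarrow> cover_uniform_space X \<D> \<and> subgroup G (Aut X \<D>)"

lemma cover_uniformly_continuous_cong:
  assumes "\<And>x. x \<in> X \<Longrightarrow> f x = g x"
  shows "cover_uniformly_continuous X \<D> Y \<E> f \<longleftrightarrow> cover_uniformly_continuous X \<D> Y \<E> g"
proof -
  have "(\<lambda>U. f -` U \<inter> X) = (\<lambda>U. g -` U \<inter> X)" using assms by auto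
  moreover have "f \<in> X \<rightarrow> Y \<longleftrightarrow> g \<in> X \<rightarrow> Y" using assms by (simp add: Pi_iff)
  ultimately show ?thesis by (simp only: cover_uniformly_continuous_def)
qed

lemma cover_uniformly_continuous_compose:
  assumes "cover_uniformly_continuous X \<D> Y \<E> f" "cover_uniformly_continuous Y \<E> Z \<F> g"
  shows "cover_uniformly_continuous X \<D> Z \<F> (compose X g f)"
proof -
  have f: "f \<in> X \<rightarrow> Y" and g: "g \<in> Y \<rightarrow> Z"
    using assms by (auto simp: cover_uniformly_continuous_def)
  have "(\<lambda>U. compose X g f -` U \<inter> X) ` \<U> = (\<lambda>U. f -` U \<inter> X) ` (\<lambda>U. g -` U \<inter> Y) ` \<U>" for \<U>
    unfolding image_image using f by (intro image_cong) (auto simp: compose_def)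
  with assms f g show ?thesis
    unfolding cover_uniformly_continuous_def by (auto simp: compose_def)
qed

lemma group_Aut:
  assumes "cover_uniform_space X \<D>"
  shows "group (Aut X \<D>)"
proof -
  interpret B: group "BijGroup X" by (rule group_BijGroup)
  have inv: "inv\<^bsub>BijGroup X\<^esub> g = restrict (inv_into X g) X" if "g \<in> Bij X" for g
    using that by (rule inv_BijGroup)
  have D: "\<U> \<subseteq> Pow X" if "\<U> \<in> \<D>" for \<U>
    using that assms by (auto simp: cover_uniform_space_def cover_uniformity_def covering_def)
  have "subgroup (uniform_automorphisms X \<D>) (BijGroup X)"
  proof (rule B.subgroupI)
    show "uniform_automorphisms X \<D> \<subseteq> carrier (BijGroup X)"
      by (auto simp: uniform_automorphisms_def BijGroup_def)
    have id: "cover_uniformly_continuous X \<D> X \<D> (\<lambda>x\<in>X. x)"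
    proof -
      have "(\<lambda>U. (\<lambda>x\<in>X. x) -` U \<inter> X) ` \<U> = \<U>" if "\<U> \<in> \<D>" for \<U>
      proof -
        have "(\<lambda>x\<in>X. x) -` U \<inter> X = U" if "U \<in> \<U>" for U
        proof -
          have "U \<subseteq> X" using D[OF \<open>\<U> \<in> \<D>\<close>] that by blast
          then show ?thesis by (auto simp: subset_iff)
        qed
        then show ?thesis by simp
      qed
      then show ?thesis by (simp add: cover_uniformly_continuous_def)
    qed
    have "inv_into X (\<lambda>x\<in>X. x) x = (\<lambda>x\<in>X. x) x" if "x \<in> X" for x
      using that by (intro inv_into_f_eq) (auto simp: inj_on_def)
    then have "cover_uniformly_continuous X \<D> X \<D> (inv_into X (\<lambda>x\<in>X. x))"
      using id cover_uniformly_continuous_cong by blast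
    with id have "(\<lambda>x\<in>X. x) \<in> uniform_automorphisms X \<D>"
      by (simp add: uniform_automorphisms_def id_Bij)
    then show "uniform_automorphisms X \<D> \<noteq> {}" by blast
  next
    fix g assume g: "g \<in> uniform_automorphisms X \<D>"
    then have gB: "g \<in> Bij X" by (simp add: uniform_automorphisms_def)
    have bij: "bij_betw g X X" using gB by (simp add: Bij_def)
    let ?h = "restrict (inv_into X g) X"
    have "inv_into X ?h x = g x" if "x \<in> X" for x
    proof (rule inv_into_f_eq)
      show "inj_on ?h X"
        using bij_betw_inv_into[OF bij] by (simp add: bij_betw_def)
      show "g x \<in> X" using bij that by (auto simp: bij_betw_def)
      then show "?h (g x) = x" using bij that by (simp add: bij_betw_def)
    qed
    then have "cover_uniformly_continuous X \<D> X \<D> (inv_into X ?h)"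
      using g cover_uniformly_continuous_cong[of X "inv_into X ?h" g]
      by (simp add: uniform_automorphisms_def)
    moreover have "cover_uniformly_continuous X \<D> X \<D> ?h"
      using g cover_uniformly_continuous_cong[of X ?h "inv_into X g"]
      by (simp add: uniform_automorphisms_def)
    ultimately show "inv\<^bsub>BijGroup X\<^esub> g \<in> uniform_automorphisms X \<D>"
      using inv[OF gB] restrict_inv_into_Bij[OF gB] by (simp add: uniform_automorphisms_def)
  next
    fix g h assume g: "g \<in> uniform_automorphisms X \<D>" and h: "h \<in> uniform_automorphisms X \<D>"
    then have gB: "g \<in> Bij X" and hB: "h \<in> Bij X" by (auto simp: uniform_automorphisms_def)
    have bg: "bij_betw g X X" and bh: "bij_betw h X X" using gB hB by (auto simp: Bij_def)
    let ?k = "compose X (inv_into X h) (inv_into X g)"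
    have "inv_into X (compose X g h) x = ?k x" if "x \<in> X" for x
    proof (rule inv_into_f_eq)
      show "inj_on (compose X g h) X"
        using bij_betw_compose[OF bh bg] by (simp add: bij_betw_def)
      have gx: "inv_into X g x \<in> X" using Bij_inv_into_mem[OF gB that] .
      then show "?k x \<in> X" using Bij_inv_into_mem[OF hB] that by (simp add: compose_def)
      then show "compose X g h (?k x) = x"
        using gx that bg bh by (simp add: compose_def bij_betw_inv_into_right)
    qed
    moreover have "cover_uniformly_continuous X \<D> X \<D> ?k"
      using g h by (intro cover_uniformly_continuous_compose) (auto simp: uniform_automorphisms_def)
    ultimately have "cover_uniformly_continuous X \<D> X \<D> (inv_into X (compose X g h))"
      using cover_uniformly_continuous_cong[of X "inv_into X (compose X g h)" ?k] by blast
    moreover have "cover_uniformly_continuous X \<D> X \<D> (compose X g h)"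
      using g h by (intro cover_uniformly_continuous_compose) (auto simp: uniform_automorphisms_def)
    ultimately show "g \<otimes>\<^bsub>BijGroup X\<^esub> h \<in> uniform_automorphisms X \<D>"
      using gB hB compose_Bij[OF gB hB] by (simp add: uniform_automorphisms_def BijGroup_def)
  qed
  then show ?thesis
    unfolding Aut_def by (rule B.subgroup_imp_group)
qed

section \<open>Amenability\<close>

text \<open>The metric uniformity of \<open>\<real>\<close>: the coverings with a Lebesgue number.\<close>

definition real_uniformity :: "real set set set"
  where "real_uniformity =
    {\<U>. covering UNIV \<U> \<and> (\<exists>e>0. \<forall>x. \<exists>U\<in>\<U>. ball x e \<subseteq> U)}"

lemma cover_uniformity_real: "cover_uniformity UNIV real_uniformity"
  unfolding cover_uniformity_def
proof (intro conjI ballI allI impI)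
  have "{UNIV} \<in> real_uniformity"
    by (auto simp: real_uniformity_def covering_def intro: exI[of _ 1])
  then show "real_uniformity \<noteq> {}" by blast
  show "covering UNIV \<U>" if "\<U> \<in> real_uniformity" for \<U>
    using that by (simp add: real_uniformity_def)
  show "\<V> \<in> real_uniformity" if U: "\<U> \<in> real_uniformity" and V: "covering UNIV \<V> \<and> \<V> \<preceq> \<U>" for \<U> \<V>
  proof -
    obtain e where "e > 0" and e: "\<And>x. \<exists>U\<in>\<U>. ball x e \<subseteq> U"
      using U by (auto simp: real_uniformity_def)
    have "\<exists>V\<in>\<V>. ball x e \<subseteq> V" for x
      using e[of x] V unfolding refined_by_def by (meson subset_trans)
    then show ?thesis using V \<open>e > 0\<close> by (auto simp: real_uniformity_def)
  qed
  fix \<U> \<V> assume "\<U> \<in> real_uniformity" "\<V> \<in> real_uniformity"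
  then obtain d e where d: "d > 0" "\<And>x. \<exists>U\<in>\<U>. ball x d \<subseteq> U"
    and e: "e > 0" "\<And>x. \<exists>U\<in>\<V>. ball x e \<subseteq> U"
    by (auto simp: real_uniformity_def)
  define r where "r = min d e / 3"
  define \<W> where "\<W> = range (\<lambda>x::real. ball x r)"
  have r: "r > 0" "3 * r \<le> d" "3 * r \<le> e" using d e by (auto simp: r_def)
  have St: "St (ball x r) \<W> \<subseteq> ball x (3 * r)" for x
    by (auto simp: St_def \<W>_def dist_real_def)
  have "covering UNIV \<W>"
  proof -
    have "x \<in> \<Union>\<W>" for x
      using r(1) unfolding \<W>_def by (intro UN_I[of x]) simp_all
    then show ?thesis by (auto simp: covering_def)
  qed
  then have "\<W> \<in> real_uniformity"
    using r unfolding real_uniformity_def \<W>_def by blast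
  moreover have star: "\<A> \<preceq>\<^sup>* \<W>" if "\<And>x. \<exists>U\<in>\<A>. ball x c \<subseteq> U" "3 * r \<le> c" for \<A> c
  proof -
    have "\<exists>U\<in>\<A>. St (ball x r) \<W> \<subseteq> U" for x
      using that(1)[of x] St[of x] subset_ball[OF that(2), of x] by (meson subset_trans)
    then show ?thesis
      by (auto simp: star_refined_by_def refined_by_def star_cover_def \<W>_def)
  qed
  ultimately show "\<exists>\<W>\<in>real_uniformity. \<U> \<preceq>\<^sup>* \<W> \<and> \<V> \<preceq>\<^sup>* \<W>"
    using star[OF d(2) r(2)] star[OF e(2) r(3)] by blast
qed

text \<open>As in \<^const>\<open>Bij\<close>, extensionality makes the elements correspond exactly to maps
  \<open>X \<rightarrow> \<real>\<close>; accordingly the vector space operations and composition with \<open>g\<close> are taken on \<open>X\<close>.\<close>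

definition UC\<^sub>b :: "'a set \<Rightarrow> 'a set set set \<Rightarrow> ('a \<Rightarrow> real) set"
  where "UC\<^sub>b X \<D> =
    {f \<in> extensional X. bounded (f ` X) \<and>
                        cover_uniformly_continuous X \<D> UNIV real_uniformity f}"

definition mean :: "'a set \<Rightarrow> 'a set set set \<Rightarrow> (('a \<Rightarrow> real) \<Rightarrow> real) \<Rightarrow> bool"
  where "mean X \<D> m \<longleftrightarrow>
    (\<forall>f\<in>UC\<^sub>b X \<D>. \<forall>g\<in>UC\<^sub>b X \<D>. m (\<lambda>x\<in>X. f x + g x) = m f + m g) \<and>
    (\<forall>c. \<forall>f\<in>UC\<^sub>b X \<D>. m (\<lambda>x\<in>X. c * f x) = c * m f) \<and>
    (\<forall>f\<in>UC\<^sub>b X \<D>. (INF x\<in>X. f x) \<le> m f \<and> m f \<le> (SUP x\<in>X. f x))"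

definition amenable :: "'a set \<Rightarrow> 'a set set set \<Rightarrow> ('a \<Rightarrow> 'a) set \<Rightarrow> bool"
  where "amenable X \<D> G \<longleftrightarrow>
    (\<exists>m. mean X \<D> m \<and> (\<forall>f\<in>UC\<^sub>b X \<D>. \<forall>g\<in>G. m (compose X f g) = m f))"

section \<open>Asymptotic uniform complexity\<close>

definition uniform_complexity :: "'a set set set \<Rightarrow> 'a set set \<Rightarrow> nat"
  where "uniform_complexity \<D> \<U> = (INF \<V>\<in>{\<V> \<in> \<N> \<D>. \<U> \<preceq> \<V>}. card \<V>)"

text \<open>Suprema and infima are those of the extended reals; in particular the supremum over
  the empty \<open>E\<close> is \<open>-\<infinity>\<close>.\<close>

definition asymptotic_uniform_complexity :: "'a set set set \<Rightarrow> ('a \<Rightarrow> 'a) set \<Rightarrow> ereal"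
  where "asymptotic_uniform_complexity \<D> G =
    (SUP E\<in>Fpow G. SUP \<U>\<in>\<N> \<D>. INF \<V>\<in>{\<V> \<in> \<N> \<D>. \<U> \<preceq> \<V>}. SUP g\<in>E.
       ereal (real (uniform_complexity \<D> (\<V> \<squnion>\<^sub>c (`) g ` \<V>)) / real (uniform_complexity \<D> \<V>)))"

end

theory Submission
  imports Defs
begin

text \<open>
  Write \<open>N\<close> for the uniform complexity and \<open>\<omega>\<close> for the asymptotic uniform complexity. The point
  of the proof is that finite coverings with \<open>N(\<V> \<or> g \<V>) \<le> (1 + \<epsilon>) N(\<V>)\<close> and finite sets \<open>F\<close>
  of points that are almost matched with \<open>g F\<close> can be turned into each other; Hall's marriage theorem
  serves in both directions.

  \<^emph>\<open>If \<open>\<omega> \<le> 1\<close>, then the system is amenable.\<close> Let \<open>\<W>\<close> be a smallest refinement of \<open>\<V>\<close>, and average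
  a function over one point of each member of \<open>\<W>\<close>. By Hall's theorem, \<open>\<W>\<close> injects
  into every other refinement \<open>\<P>\<close> of \<open>\<V>\<close> in such a way that each member meets its partner: a set of
  members with too few neighbours could be traded for these neighbours, which would make \<open>\<W>\<close>
  smaller (\<open>minimal_refinement_injects\<close>). So if the function oscillates little on \<open>\<V>\<close> and \<open>\<P>\<close> is
  not much larger than \<open>\<W>\<close>, then averaging over \<open>\<W>\<close> and over \<open>\<P>\<close> is almost the same. A smallest
  refinement \<open>\<P>\<close> of \<open>\<V> \<or> g \<V>\<close> is such a refinement of \<open>\<V>\<close>, and so is \<open>g\<^sup>-\<^sup>1 \<P>\<close>. Comparing \<open>\<W>\<close> with both
  shows that the average over \<open>\<W>\<close> is almost \<open>g\<close>-invariant (\<open>sums_almost_invariant\<close>). Means form a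
  compact set, so that an invariant mean exists (\<open>amenable_if_approximately\<close>).

  \<^emph>\<open>If the system is amenable and the space is perfect and Hausdorff, then \<open>\<omega> \<le> 1\<close>.\<close> For an invariant
  mean \<open>m\<close>, the functions \<open>q - q \<circ> g\<close> have mean \<open>0\<close>. Points \<open>x\<^sub>1, x\<^sub>2, \<dots>\<close> can then be picked one
  after another such that each new point has almost nonpositive inner product with the sum so far
  in the space spanned by finitely many such functions; then the squared norm of the sum of \<open>n\<close> vectors
  grows only linearly in \<open>n\<close>, and the norm itself is negligible against \<open>n\<close> (\<open>greedy_points\<close>). As nonempty
  open sets are infinite, the points can be chosen distinct. This gives finite sets \<open>F\<close> of arbitrarily
  large size with \<open>\<Sum>\<^sub>F q \<approx> \<Sum>\<^bsub>g F\<^esub> q\<close> for finitely many \<open>q\<close>. With suitable test functions \<open>q\<close>, Hall's theorem turns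
  this into a matching of nearly all of \<open>F\<close> with points of \<open>g F\<close> close to them, and points common
  to \<open>F\<close> and \<open>g F\<close> are matched with themselves (\<open>ex_matching\<close>). Given a finite uniform covering \<open>\<U>\<close>,
  let \<open>\<V>\<close> consist of the sets \<open>A - F\<close> with \<open>A \<in> \<U>\<close> and, for each \<open>x \<in> F\<close>, of a small set \<open>V x\<close>
  which contains neighbourhoods of \<open>x\<close> and of the points that \<open>x\<close> is matched with. Every point of \<open>F\<close>
  needs its own member in a refinement of \<open>\<V>\<close>, so that \<open>N(\<V>) \<ge> |F|\<close>; and \<open>\<V> \<or> g \<V>\<close> is
  covered uniformly by one set for each matched pair and a negligible number of others
  (\<open>ex_almost_invariant_covering\<close>). Finally \<open>\<omega> \<ge> 1\<close> always holds, by monotonicity of \<open>N\<close>.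
\<close>

section \<open>Hall's marriage theorem\<close>

text \<open>The induction of Halmos and Vaughan: if every nonempty proper part of \<open>A\<close> has a neighbour to
  spare, then any edge may be used first; otherwise a part without spare neighbours and its complement
  can be matched separately.\<close>

theorem Hall_marriage:
  fixes R :: "'a \<Rightarrow> 'b \<Rightarrow> bool"
  assumes "finite A" "finite B"
    and "\<And>S. S \<subseteq> A \<Longrightarrow> card S \<le> card {b\<in>B. \<exists>s\<in>S. R s b}"
  shows "\<exists>h. inj_on h A \<and> h ` A \<subseteq> B \<and> (\<forall>a\<in>A. R a (h a))"
  using assms
proof (induction A arbitrary: B rule: finite_psubset_induct)
  case (psubset A)
  define N where "N C S = {b\<in>C. \<exists>s\<in>S. R s b}" for C S
  have hall: "card S \<le> card (N B S)" if "S \<subseteq> A" for S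
    using psubset.prems(2)[OF that] by (simp add: N_def)
  consider "A = {}" | "A \<noteq> {}" "\<And>S. S \<noteq> {} \<Longrightarrow> S \<subset> A \<Longrightarrow> card S < card (N B S)"
    | S where "S \<noteq> {}" "S \<subset> A" "card (N B S) \<le> card S"
    by (meson not_le)
  then show ?case
  proof cases
    case 1
    then show ?thesis by simp
  next
    case 2
    then obtain a where a: "a \<in> A" by blast
    have "card {a} \<le> card (N B {a})" using hall[of "{a}"] a by simp
    then have "N B {a} \<noteq> {}" by auto
    then obtain b where b: "b \<in> B" "R a b" by (auto simp: N_def)
    have "card S \<le> card (N (B - {b}) S)" if S: "S \<subseteq> A - {a}" for S
    proof (cases "S = {}")
      case False
      have "card S < card (N B S)" using 2(2)[OF False] S a by blast
      moreover have "N (B - {b}) S = N B S - {b}" by (auto simp: N_def)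
      ultimately show ?thesis
        by (simp add: card_Diff_singleton_if) linarith
    qed simp
    then obtain h where h: "inj_on h (A - {a})" "h ` (A - {a}) \<subseteq> B - {b}"
        "\<forall>x\<in>A - {a}. R x (h x)"
      using psubset.IH[of "A - {a}" "B - {b}"] a psubset.prems(1) by (auto simp: N_def)
    let ?h = "h(a := b)"
    have "inj_on ?h A"
      using h(1,2) by (auto simp: inj_on_def image_subset_iff)
    moreover have "?h ` A \<subseteq> B" using h(2) b by auto
    moreover have "\<forall>x\<in>A. R x (?h x)" using h(3) b by simp
    ultimately show ?thesis by blast
  next
    case 3
    have finS: "finite S" using 3 psubset.hyps finite_subset by blast
    have "\<exists>h. inj_on h S \<and> h ` S \<subseteq> B \<and> (\<forall>x\<in>S. R x (h x))"
      using psubset.IH[of S B] 3 psubset.prems by blast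
    then obtain h where h: "inj_on h S" "h ` S \<subseteq> B" "\<forall>x\<in>S. R x (h x)" by blast
    \<comment> \<open>As \<open>S\<close> uses up all its neighbours, the rest of \<open>A\<close> has to be matched outside of them.\<close>
    define B' where "B' = B - N B S"
    have "card T \<le> card (N B' T)" if T: "T \<subseteq> A - S" for T
    proof -
      have finT: "finite T" using T psubset.hyps finite_subset by blast
      have "card S + card T = card (S \<union> T)"
        using T finS finT by (subst card_Un_disjoint) auto
      also have "\<dots> \<le> card (N B (S \<union> T))" using T 3 by (intro hall) blast
      also have "N B (S \<union> T) = N B S \<union> N B' T" by (auto simp: N_def B'_def)
      also have "card \<dots> \<le> card (N B S) + card (N B' T)" by (rule card_Un_le)
      finally show ?thesis using 3 by linarith
    qed
    moreover have "A - S \<subset> A" "finite B'" using 3 psubset.prems(1) by (auto simp: B'_def)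
    ultimately obtain k where k: "inj_on k (A - S)" "k ` (A - S) \<subseteq> B'" "\<forall>x\<in>A - S. R x (k x)"
      using psubset.IH[of "A - S" B'] by (auto simp: N_def)
    let ?h = "\<lambda>x. if x \<in> S then h x else k x"
    have sep: "h x \<noteq> k y" if "x \<in> S" "y \<in> A - S" for x y
    proof -
      have "h x \<in> N B S" using h that by (auto simp: N_def)
      then show ?thesis using k(2) that by (auto simp: B'_def)
    qed
    have "inj_on ?h A"
    proof (rule inj_onI)
      fix x y assume "x \<in> A" "y \<in> A" "?h x = ?h y"
      then show "x = y"
        using sep[of x y] sep[of y x] h(1) k(1) by (auto simp: inj_on_def split: if_splits)
    qed
    moreover have "?h ` A \<subseteq> B" using h(2) k(2) by (auto simp: B'_def)
    moreover have "\<forall>x\<in>A. R x (?h x)" using h(3) k(3) by simp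
    ultimately show ?thesis by blast
  qed
qed

text \<open>Add \<open>d\<close> dummy elements to \<open>B\<close> that are related to everything, and drop the elements that
  get matched with a dummy.\<close>

corollary Hall_marriage_deficiency:
  fixes R :: "'a \<Rightarrow> 'b \<Rightarrow> bool"
  assumes fin: "finite A" "finite B"
    and hall: "\<And>S. S \<subseteq> A \<Longrightarrow> card S \<le> card {b\<in>B. \<exists>s\<in>S. R s b} + d"
  shows "\<exists>A' h. A' \<subseteq> A \<and> inj_on h A' \<and> h ` A' \<subseteq> B \<and> (\<forall>a\<in>A'. R a (h a)) \<and> card (A - A') \<le> d"
proof -
  let ?B = "Inl ` B \<union> Inr ` {..<d} :: ('b + nat) set"
  define R' where "R' a x = (case x of Inl b \<Rightarrow> R a b | Inr _ \<Rightarrow> True)" for a and x :: "'b + nat"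
  have "card S \<le> card {x\<in>?B. \<exists>s\<in>S. R' s x}" if S: "S \<subseteq> A" for S
  proof (cases "S = {}")
    case False
    have eq: "{x\<in>?B. \<exists>s\<in>S. R' s x} = Inl ` {b\<in>B. \<exists>s\<in>S. R s b} \<union> Inr ` {..<d}"
      using False by (auto simp: R'_def image_iff)
    have "card {x\<in>?B. \<exists>s\<in>S. R' s x} = card {b\<in>B. \<exists>s\<in>S. R s b} + d"
      unfolding eq using fin by (subst card_Un_disjoint) (auto simp: card_image)
    then show ?thesis using hall[OF S] by simp
  qed simp
  moreover have "finite ?B" using fin by simp
  ultimately obtain h where h: "inj_on h A" "h ` A \<subseteq> ?B" "\<forall>a\<in>A. R' a (h a)"
    using Hall_marriage[of A ?B R'] fin(1) by blast
  define A' where "A' = {a\<in>A. h a \<in> Inl ` B}"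
  define k where "k a = projl (h a)" for a
  have hk: "h a = Inl (k a) \<and> k a \<in> B" if "a \<in> A'" for a
    using that by (auto simp: A'_def k_def)
  have "inj_on k A'"
  proof (rule inj_onI)
    fix x y assume xy: "x \<in> A'" "y \<in> A'" "k x = k y"
    then have "h x = h y" using hk by metis
    moreover have "x \<in> A" "y \<in> A" using xy by (simp_all add: A'_def)
    ultimately show "x = y" using h(1) by (simp add: inj_on_def)
  qed
  moreover have "R a (k a)" if "a \<in> A'" for a
  proof -
    have "a \<in> A" using that by (simp add: A'_def)
    then have "R' a (h a)" using h(3) by blast
    then show ?thesis using hk[OF that] by (simp add: R'_def)
  qed
  moreover have "card (A - A') \<le> d"
  proof -
    have "h ` (A - A') \<subseteq> Inr ` {..<d}" using h(2) by (auto simp: A'_def)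
    moreover have "inj_on h (A - A')" using h(1) by (rule inj_on_subset) blast
    ultimately have "card (A - A') \<le> card (Inr ` {..<d} :: ('b + nat) set)"
      by (intro card_inj_on_le) auto
    also have "\<dots> = d" by (simp add: card_image)
    finally show ?thesis .
  qed
  moreover have "A' \<subseteq> A" by (auto simp: A'_def)
  moreover have "k ` A' \<subseteq> B" using hk by blast
  ultimately show ?thesis by blast
qed

section \<open>Coverings and uniform complexity\<close>

lemma refined_by_trans: "\<U> \<preceq> \<V> \<Longrightarrow> \<V> \<preceq> \<W> \<Longrightarrow> \<U> \<preceq> \<W>"
  unfolding refined_by_def by (meson subset_trans)

lemma refined_byD: "\<U> \<preceq> \<V> \<Longrightarrow> V \<in> \<V> \<Longrightarrow> \<exists>U\<in>\<U>. V \<subseteq> U"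
  by (simp add: refined_by_def)

lemma refined_by_joinI:
  assumes "\<U> \<preceq> \<W>" "\<V> \<preceq> \<W>"
  shows "\<U> \<squnion>\<^sub>c \<V> \<preceq> \<W>"
  unfolding refined_by_def
proof
  fix W assume "W \<in> \<W>"
  then obtain U V where UV: "U \<in> \<U>" "W \<subseteq> U" "V \<in> \<V>" "W \<subseteq> V"
    using refined_byD[OF assms(1)] refined_byD[OF assms(2)] by blast
  then have "U \<inter> V \<in> \<U> \<squnion>\<^sub>c \<V>" by (auto simp: cover_join_def)
  then show "\<exists>A\<in>\<U> \<squnion>\<^sub>c \<V>. W \<subseteq> A" using UV by blast
qed

lemma refined_by_join: "\<U> \<preceq> \<U> \<squnion>\<^sub>c \<V>" "\<V> \<preceq> \<U> \<squnion>\<^sub>c \<V>"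
  by (auto simp: refined_by_def cover_join_def)

lemma star_refinedD: "\<U> \<preceq>\<^sup>* \<W> \<Longrightarrow> W \<in> \<W> \<Longrightarrow> \<exists>U\<in>\<U>. St W \<W> \<subseteq> U"
  unfolding star_refined_by_def refined_by_def star_cover_def by blast

lemma subset_St: "W \<in> \<W> \<Longrightarrow> W \<subseteq> St W \<W>"
  by (auto simp: St_def)

lemma star_refined_imp_refined: "\<U> \<preceq>\<^sup>* \<W> \<Longrightarrow> \<U> \<preceq> \<W>"
  unfolding refined_by_def by (meson star_refinedD subset_St subset_trans)

lemma mem_St_point: "y \<in> St {x} \<W> \<longleftrightarrow> (\<exists>W\<in>\<W>. x \<in> W \<and> y \<in> W)"
  by (auto simp: St_def)

lemma finite_join:
  assumes "finite \<U>" "finite \<V>"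
  shows "finite (\<U> \<squnion>\<^sub>c \<V>)"
proof -
  have "\<U> \<squnion>\<^sub>c \<V> = (\<lambda>(U, V). U \<inter> V) ` (\<U> \<times> \<V>)" by (auto simp: cover_join_def)
  then show ?thesis using assms by simp
qed

locale uniform_covers =
  fixes X :: "'a set" and \<D> :: "'a set set set"
  assumes cover_uniform_space: "cover_uniform_space X \<D>"
begin

lemma uniformity: "cover_uniformity X \<D>" and X_nonempty: "X \<noteq> {}"
  using cover_uniform_space by (auto simp: cover_uniform_space_def)

lemma uniform_covering: "\<U> \<in> \<D> \<Longrightarrow> covering X \<U>"
  using uniformity by (simp add: cover_uniformity_def)

lemma member_subset: "\<U> \<in> \<D> \<Longrightarrow> A \<in> \<U> \<Longrightarrow> A \<subseteq> X"
  using uniform_covering by (auto simp: covering_def)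

lemma ex_member:
  assumes "\<U> \<in> \<D>" "x \<in> X"
  shows "\<exists>A\<in>\<U>. x \<in> A"
proof -
  have "\<Union>\<U> = X" using uniform_covering[OF assms(1)] by (simp add: covering_def)
  then show ?thesis using assms(2) by (metis UnionE)
qed

lemma coarser: "\<U> \<in> \<D> \<Longrightarrow> covering X \<V> \<Longrightarrow> \<V> \<preceq> \<U> \<Longrightarrow> \<V> \<in> \<D>"
  using uniformity unfolding cover_uniformity_def by blast

lemma coarserI:
  assumes "\<U> \<in> \<D>" "\<And>V. V \<in> \<V> \<Longrightarrow> V \<subseteq> X" "\<V> \<preceq> \<U>"
  shows "\<V> \<in> \<D>"
proof (rule coarser)
  have "x \<in> \<Union>\<V>" if "x \<in> X" for x
    using ex_member[OF assms(1) that] assms(3) unfolding refined_by_def by (meson UnionI subsetD)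
  then show "covering X \<V>" using assms(2) by (auto simp: covering_def)
qed (use assms in auto)

lemma ex_star_refinement2:
  assumes "\<U> \<in> \<D>" "\<V> \<in> \<D>"
  shows "\<exists>\<W>\<in>\<D>. \<U> \<preceq>\<^sup>* \<W> \<and> \<V> \<preceq>\<^sup>* \<W>"
proof -
  have "\<forall>\<U>\<in>\<D>. \<forall>\<V>\<in>\<D>. \<exists>\<W>\<in>\<D>. \<U> \<preceq>\<^sup>* \<W> \<and> \<V> \<preceq>\<^sup>* \<W>"
    using uniformity unfolding cover_uniformity_def by (elim conjE)
  with assms show ?thesis by blast
qed

lemma ex_star_refinement: "\<U> \<in> \<D> \<Longrightarrow> \<exists>\<W>\<in>\<D>. \<U> \<preceq>\<^sup>* \<W>"
  using ex_star_refinement2 by blast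

lemma ex_refinement2: "\<U> \<in> \<D> \<Longrightarrow> \<V> \<in> \<D> \<Longrightarrow> \<exists>\<W>\<in>\<D>. \<U> \<preceq> \<W> \<and> \<V> \<preceq> \<W>"
  using ex_star_refinement2 star_refined_imp_refined by meson

lemma trivial_uniform_covering: "{X} \<in> \<D>"
proof -
  have "\<D> \<noteq> {}" using uniformity unfolding cover_uniformity_def by (rule conjunct1)
  then obtain \<U> where U: "\<U> \<in> \<D>" by blast
  show ?thesis
    by (rule coarserI[OF U]) (simp_all add: refined_by_def member_subset[OF U])
qed

lemma ex_common_refinement:
  assumes "finite \<C>" "\<C> \<subseteq> \<D>"
  shows "\<exists>\<W>\<in>\<D>. \<forall>\<U>\<in>\<C>. \<U> \<preceq> \<W>"
  using assms
proof (induction \<C>)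
  case empty
  then show ?case using trivial_uniform_covering by blast
next
  case (insert \<U> \<C>)
  then obtain \<W> where W: "\<W> \<in> \<D>" "\<forall>\<U>\<in>\<C>. \<U> \<preceq> \<W>" by auto
  obtain \<W>' where "\<W>' \<in> \<D>" "\<U> \<preceq> \<W>'" "\<W> \<preceq> \<W>'"
    using ex_refinement2[of \<U> \<W>] W(1) insert.prems by auto
  then show ?case using W(2) refined_by_trans by (metis insert_iff)
qed

lemma join_uniform:
  assumes "\<U> \<in> \<D>" "\<V> \<in> \<D>"
  shows "\<U> \<squnion>\<^sub>c \<V> \<in> \<D>"
proof -
  obtain \<W> where W: "\<W> \<in> \<D>" "\<U> \<preceq> \<W>" "\<V> \<preceq> \<W>" using ex_refinement2[OF assms] by blast
  show ?thesis
  proof (rule coarserI[OF W(1)])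
    show "A \<subseteq> X" if "A \<in> \<U> \<squnion>\<^sub>c \<V>" for A
      using that member_subset[OF assms(1)] by (auto simp: cover_join_def)
    show "\<U> \<squnion>\<^sub>c \<V> \<preceq> \<W>" using W by (simp add: refined_by_joinI)
  qed
qed

lemma join_finite_uniform: "\<U> \<in> \<N> \<D> \<Longrightarrow> \<V> \<in> \<N> \<D> \<Longrightarrow> \<U> \<squnion>\<^sub>c \<V> \<in> \<N> \<D>"
  by (simp add: finite_uniform_coverings_def join_uniform finite_join)

lemma uniform_complexity_le:
  assumes "\<W> \<in> \<N> \<D>" "\<V> \<preceq> \<W>"
  shows "uniform_complexity \<D> \<V> \<le> card \<W>"
  unfolding uniform_complexity_def using assms by (intro cINF_lower) auto

lemma ex_minimal_refinement:
  assumes "\<V> \<in> \<N> \<D>"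
  shows "\<exists>\<W>\<in>\<N> \<D>. \<V> \<preceq> \<W> \<and> card \<W> = uniform_complexity \<D> \<V>"
proof -
  have "\<V> \<preceq> \<V>" by (auto simp: refined_by_def)
  then have "card ` {\<W> \<in> \<N> \<D>. \<V> \<preceq> \<W>} \<noteq> {}" using assms by blast
  from Inf_nat_def1[OF this] show ?thesis unfolding uniform_complexity_def by force
qed

lemma uniform_complexity_pos:
  assumes "\<V> \<in> \<N> \<D>"
  shows "uniform_complexity \<D> \<V> > 0"
proof -
  obtain \<W> where W: "\<W> \<in> \<N> \<D>" "card \<W> = uniform_complexity \<D> \<V>"
    using ex_minimal_refinement[OF assms] by blast
  then have "\<W> \<noteq> {}" "finite \<W>"
    using X_nonempty ex_member by (auto simp: finite_uniform_coverings_def)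
  then show ?thesis using W(2) card_gt_0_iff by metis
qed

text \<open>A refinement of least cardinality is determined by \<open>\<V>\<close> up to perturbation: it can be moved
  injectively into any other refinement. Hall's condition is an exchange argument.\<close>

lemma minimal_refinement_injects:
  assumes V: "\<W> \<in> \<N> \<D>" "\<V> \<preceq> \<W>" "card \<W> = uniform_complexity \<D> \<V>"
    and P: "\<P> \<in> \<N> \<D>" "\<V> \<preceq> \<P>"
  shows "\<exists>h. inj_on h \<W> \<and> h ` \<W> \<subseteq> \<P> \<and> (\<forall>W\<in>\<W>. W \<inter> h W \<noteq> {})"
proof (rule Hall_marriage)
  show fin: "finite \<W>" "finite \<P>" using V P by (auto simp: finite_uniform_coverings_def)
  fix \<S> assume S: "\<S> \<subseteq> \<W>"
  define \<T> where "\<T> = {P\<in>\<P>. \<exists>W\<in>\<S>. W \<inter> P \<noteq> {}}"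
  \<comment> \<open>Replacing \<open>\<S>\<close> in \<open>\<W>\<close> by the members of \<open>\<P>\<close> that meet it gives a competitor of \<open>\<W>\<close>.\<close>
  let ?\<R> = "(\<W> - \<S>) \<union> \<T>"
  have WP: "\<W> \<in> \<D>" "\<P> \<in> \<D>" using V P by (auto simp: finite_uniform_coverings_def)
  have "?\<R> \<in> \<D>"
  proof (rule coarserI[OF join_uniform[OF WP]])
    show "A \<subseteq> X" if "A \<in> ?\<R>" for A
      using that member_subset[OF WP(1)] member_subset[OF WP(2)] by (auto simp: \<T>_def)
    show "?\<R> \<preceq> \<W> \<squnion>\<^sub>c \<P>"
      unfolding refined_by_def
    proof
      fix A assume "A \<in> \<W> \<squnion>\<^sub>c \<P>"
      then obtain W P where A: "A = W \<inter> P" "W \<in> \<W>" "P \<in> \<P>" by (auto simp: cover_join_def)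
      consider "W \<notin> \<S>" | "W \<in> \<S>" "A \<noteq> {}" | "A = {}" by blast
      then show "\<exists>U\<in>?\<R>. A \<subseteq> U"
      proof cases
        case 3
        obtain x where "x \<in> X" using X_nonempty by blast
        then obtain W' P' where "W' \<in> \<W>" "x \<in> W'" "P' \<in> \<P>" "x \<in> P'"
          using ex_member[OF WP(1)] ex_member[OF WP(2)] by meson
        then have "W' \<in> ?\<R> \<or> P' \<in> ?\<R>" by (auto simp: \<T>_def)
        then show ?thesis using 3 by blast
      qed (use A in \<open>auto simp: \<T>_def\<close>)
    qed
  qed
  moreover have finR: "finite ?\<R>" using fin by (simp add: \<T>_def)
  moreover have "\<V> \<preceq> ?\<R>" using V(2) P(2) by (auto simp: refined_by_def \<T>_def)
  ultimately have "uniform_complexity \<D> \<V> \<le> card ?\<R>"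
    by (intro uniform_complexity_le) (auto simp: finite_uniform_coverings_def)
  also have "\<dots> \<le> card (\<W> - \<S>) + card \<T>" by (rule card_Un_le)
  finally have "card \<W> \<le> card \<W> - card \<S> + card \<T>"
    using S fin V(3) by (simp add: card_Diff_subset finite_subset)
  moreover have "card \<S> \<le> card \<W>" using S fin by (simp add: card_mono)
  ultimately show "card \<S> \<le> card {P\<in>\<P>. \<exists>W\<in>\<S>. W \<inter> P \<noteq> {}}" by (simp add: \<T>_def)
qed

text \<open>Here \<open>a\<close> and \<open>b\<close> stand for sample values of \<open>h\<close> on the members of the two refinements. The first
  error comes from moving \<open>\<W>\<close> into \<open>\<P>\<close>, the second one from the members of \<open>\<P>\<close> that are left
  over.\<close>

lemma sums_over_refinements_close:
  fixes h :: "'a \<Rightarrow> real" and a b :: "'a set \<Rightarrow> real"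
  assumes V: "\<W> \<in> \<N> \<D>" "\<V> \<preceq> \<W>" "card \<W> = uniform_complexity \<D> \<V>"
    and P: "\<P> \<in> \<N> \<D>" "\<V> \<preceq> \<P>"
    and a: "\<And>W y. W \<in> \<W> \<Longrightarrow> y \<in> W \<Longrightarrow> \<bar>h y - a W\<bar> \<le> \<delta>"
    and b: "\<And>P y. P \<in> \<P> \<Longrightarrow> y \<in> P \<Longrightarrow> \<bar>h y - b P\<bar> \<le> \<delta>"
    and K: "\<And>P. P \<in> \<P> \<Longrightarrow> \<bar>b P\<bar> \<le> K"
  shows "\<bar>sum a \<W> - sum b \<P>\<bar> \<le> 2 * \<delta> * card \<W> + K * (real (card \<P>) - real (card \<W>))"
proof -
  obtain k where k: "inj_on k \<W>" "k ` \<W> \<subseteq> \<P>" "\<forall>W\<in>\<W>. W \<inter> k W \<noteq> {}"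
    using minimal_refinement_injects[OF V P] by (elim exE conjE)
  have finP: "finite \<P>" using P by (simp add: finite_uniform_coverings_def)
  have "\<bar>a W - b (k W)\<bar> \<le> 2 * \<delta>" if W: "W \<in> \<W>" for W
  proof -
    have "W \<inter> k W \<noteq> {}" using k(3) W by simp
    then obtain y where "y \<in> W" "y \<in> k W" by auto
    moreover have "k W \<in> \<P>" using k(2) W by blast
    ultimately have "\<bar>h y - a W\<bar> \<le> \<delta>" "\<bar>h y - b (k W)\<bar> \<le> \<delta>" using a[OF W] b by simp_all
    then show ?thesis by linarith
  qed
  then have "\<bar>\<Sum>W\<in>\<W>. a W - b (k W)\<bar> \<le> (\<Sum>W\<in>\<W>. 2 * \<delta>)"
    by (intro order_trans[OF sum_abs] sum_mono)
  then have 1: "\<bar>sum a \<W> - sum b (k ` \<W>)\<bar> \<le> 2 * \<delta> * card \<W>"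
    by (simp add: sum_subtractf sum.reindex[OF k(1)] mult.commute)
  have "\<bar>sum b (\<P> - k ` \<W>)\<bar> \<le> (\<Sum>P\<in>\<P> - k ` \<W>. K)"
    using K by (intro order_trans[OF sum_abs] sum_mono) auto
  also have "\<dots> = K * (real (card \<P>) - real (card \<W>))"
    using k(1,2) finP card_mono[OF finP k(2)]
    by (simp add: card_Diff_subset finite_subset card_image of_nat_diff mult.commute)
  finally have 2: "\<bar>sum b (\<P> - k ` \<W>)\<bar> \<le> K * (real (card \<P>) - real (card \<W>))" .
  have "sum b \<P> = sum b (\<P> - k ` \<W>) + sum b (k ` \<W>)"
    by (rule sum.subset_diff[OF k(2) finP])
  with 1 2 show ?thesis by linarith
qed

end

section \<open>Bounded uniformly continuous functions\<close>

definition osc_less :: "('a \<Rightarrow> real) \<Rightarrow> 'a set set \<Rightarrow> real \<Rightarrow> bool"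
  where "osc_less f \<W> e \<longleftrightarrow> (\<forall>A\<in>\<W>. \<forall>x\<in>A. \<forall>y\<in>A. \<bar>f x - f y\<bar> < e)"

lemma osc_lessD: "osc_less f \<W> e \<Longrightarrow> A \<in> \<W> \<Longrightarrow> x \<in> A \<Longrightarrow> y \<in> A \<Longrightarrow> \<bar>f x - f y\<bar> < e"
  by (simp add: osc_less_def)

lemma osc_less_refined:
  assumes "osc_less f \<V> e" "\<V> \<preceq> \<W>"
  shows "osc_less f \<W> e"
  unfolding osc_less_def
proof (intro ballI)
  fix A x y assume A: "A \<in> \<W>" "x \<in> A" "y \<in> A"
  then obtain B where "B \<in> \<V>" "A \<subseteq> B" using refined_byD[OF assms(2)] by blast
  then show "\<bar>f x - f y\<bar> < e" using A osc_lessD[OF assms(1)] by blast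
qed

context uniform_covers
begin

text \<open>Uniform continuity of real functions is used only in this form, with oscillations instead of preimages of
  coverings of the real line.\<close>

lemma UC\<^sub>b_iff:
  "f \<in> UC\<^sub>b X \<D> \<longleftrightarrow>
    f \<in> extensional X \<and> bounded (f ` X) \<and> (\<forall>e>0. \<exists>\<W>\<in>\<D>. osc_less f \<W> e)"
proof -
  have "cover_uniformly_continuous X \<D> UNIV real_uniformity f \<longleftrightarrow> (\<forall>e>0. \<exists>\<W>\<in>\<D>. osc_less f \<W> e)"
  proof (intro iffI allI impI)
    fix e :: real
    assume f: "cover_uniformly_continuous X \<D> UNIV real_uniformity f" and e: "e > 0"
    define \<B> where "\<B> = range (\<lambda>x::real. ball x (e / 2))"
    have "x \<in> \<Union>\<B>" for x using e unfolding \<B>_def by (intro UN_I[of x]) simp_all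
    then have "covering UNIV \<B>" by (auto simp: covering_def)
    moreover have "\<exists>U\<in>\<B>. ball x (e / 2) \<subseteq> U" for x by (auto simp: \<B>_def)
    ultimately have "\<B> \<in> real_uniformity"
      using e by (auto simp: real_uniformity_def intro!: exI[of _ "e / 2"])
    then have "(\<lambda>U. f -` U \<inter> X) ` \<B> \<in> \<D>"
      using f by (simp add: cover_uniformly_continuous_def)
    moreover have "osc_less f ((\<lambda>U. f -` U \<inter> X) ` \<B>) e"
      unfolding osc_less_def
    proof (intro ballI)
      fix A x y assume "A \<in> (\<lambda>U. f -` U \<inter> X) ` \<B>" "x \<in> A" "y \<in> A"
      then obtain z where "dist z (f x) < e / 2" "dist z (f y) < e / 2" by (auto simp: \<B>_def)
      then show "\<bar>f x - f y\<bar> < e" unfolding dist_real_def by linarith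
    qed
    ultimately show "\<exists>\<W>\<in>\<D>. osc_less f \<W> e" by blast
  next
    assume osc: "\<forall>e>0. \<exists>\<W>\<in>\<D>. osc_less f \<W> e"
    show "cover_uniformly_continuous X \<D> UNIV real_uniformity f"
      unfolding cover_uniformly_continuous_def
    proof (intro conjI ballI)
      fix \<U> :: "real set set" assume "\<U> \<in> real_uniformity"
      then obtain e where e: "e > 0" "\<And>x. \<exists>U\<in>\<U>. ball x e \<subseteq> U"
        by (auto simp: real_uniformity_def)
      obtain \<W> where W: "\<W> \<in> \<D>" "osc_less f \<W> e" using osc e(1) by blast
      show "(\<lambda>U. f -` U \<inter> X) ` \<U> \<in> \<D>"
      proof (rule coarserI[OF W(1)])
        show "(\<lambda>U. f -` U \<inter> X) ` \<U> \<preceq> \<W>"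
          unfolding refined_by_def
        proof
          fix A assume A: "A \<in> \<W>"
          define c where "c = f (SOME a. a \<in> A)"
          obtain U where U: "U \<in> \<U>" "ball c e \<subseteq> U" using e(2) by blast
          have "f x \<in> U" if "x \<in> A" for x
          proof -
            have "(SOME a. a \<in> A) \<in> A" using that by (rule someI)
            then have "\<bar>c - f x\<bar> < e" unfolding c_def using osc_lessD[OF W(2) A] that by simp
            then show ?thesis using U(2) by (auto simp: dist_real_def)
          qed
          then have "A \<subseteq> f -` U \<inter> X" using member_subset[OF W(1) A] by blast
          then show "\<exists>B\<in>(\<lambda>U. f -` U \<inter> X) ` \<U>. A \<subseteq> B" using U(1) by blast
        qed
      qed auto
    qed auto
  qed
  then show ?thesis by (simp add: UC\<^sub>b_def)
qed

lemma UC\<^sub>b_osc: "f \<in> UC\<^sub>b X \<D> \<Longrightarrow> e > 0 \<Longrightarrow> \<exists>\<W>\<in>\<D>. osc_less f \<W> e"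
  by (simp add: UC\<^sub>b_iff)

lemma UC\<^sub>b_bounded: "f \<in> UC\<^sub>b X \<D> \<Longrightarrow> \<exists>K. \<forall>x\<in>X. \<bar>f x\<bar> \<le> K"
  by (auto simp: UC\<^sub>b_iff bounded_iff)

lemma UC\<^sub>b_common_bound:
  assumes "finite \<Phi>" "\<Phi> \<subseteq> UC\<^sub>b X \<D>"
  shows "\<exists>K\<ge>0. \<forall>f\<in>\<Phi>. \<forall>x\<in>X. \<bar>f x\<bar> \<le> K"
  using assms
proof (induction \<Phi>)
  case (insert f \<Phi>)
  then obtain K where K: "K \<ge> 0" "\<forall>f\<in>\<Phi>. \<forall>x\<in>X. \<bar>f x\<bar> \<le> K" by auto
  obtain K' where "\<forall>x\<in>X. \<bar>f x\<bar> \<le> K'" using UC\<^sub>b_bounded[of f] insert.prems by auto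
  then have "\<forall>h\<in>insert f \<Phi>. \<forall>x\<in>X. \<bar>h x\<bar> \<le> max K K'"
    using K(2) by (auto simp: max.coboundedI1 max.coboundedI2)
  then show ?case using K(1) by (intro exI[of _ "max K K'"]) auto
qed auto

lemma UC\<^sub>b_common_osc:
  assumes "finite \<Phi>" "\<Phi> \<subseteq> UC\<^sub>b X \<D>" "e > 0"
  shows "\<exists>\<W>\<in>\<D>. \<forall>f\<in>\<Phi>. osc_less f \<W> e"
proof -
  have "\<forall>f\<in>\<Phi>. \<exists>\<W>. \<W> \<in> \<D> \<and> osc_less f \<W> e" using assms UC\<^sub>b_osc by blast
  then obtain w where w: "\<forall>f\<in>\<Phi>. w f \<in> \<D> \<and> osc_less f (w f) e" by metis
  then obtain \<W> where "\<W> \<in> \<D>" "\<forall>\<U>\<in>w ` \<Phi>. \<U> \<preceq> \<W>"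
    using ex_common_refinement[of "w ` \<Phi>"] assms(1) by blast
  then show ?thesis using w osc_less_refined by blast
qed

text \<open>The pointwise closure properties of \<open>UC\<^sub>b X \<D>\<close> that are needed (sums, multiples, maxima, minima,
  Lipschitz functions of its members) are instances of this criterion.\<close>

lemma UC\<^sub>b_dominated:
  assumes f: "f1 \<in> UC\<^sub>b X \<D>" "f2 \<in> UC\<^sub>b X \<D>" and h: "h \<in> extensional X"
    and le: "\<And>x y. x \<in> X \<Longrightarrow> y \<in> X \<Longrightarrow> \<bar>h x - h y\<bar> \<le> C * (\<bar>f1 x - f1 y\<bar> + \<bar>f2 x - f2 y\<bar>)"
  shows "h \<in> UC\<^sub>b X \<D>"
proof -
  have le': "\<bar>h x - h y\<bar> \<le> (\<bar>C\<bar> + 1) * (\<bar>f1 x - f1 y\<bar> + \<bar>f2 x - f2 y\<bar>)" if "x \<in> X" "y \<in> X" for x y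
    by (rule order_trans[OF le[OF that]]) (intro mult_right_mono, auto)
  obtain K where K: "K \<ge> 0" "\<forall>f\<in>{f1, f2}. \<forall>x\<in>X. \<bar>f x\<bar> \<le> K"
    using UC\<^sub>b_common_bound[of "{f1, f2}"] f by auto
  obtain x0 where x0: "x0 \<in> X" using X_nonempty by blast
  have "\<bar>h x\<bar> \<le> \<bar>h x0\<bar> + (\<bar>C\<bar> + 1) * (4 * K)" if x: "x \<in> X" for x
  proof -
    have "\<bar>f1 x\<bar> \<le> K" "\<bar>f1 x0\<bar> \<le> K" "\<bar>f2 x\<bar> \<le> K" "\<bar>f2 x0\<bar> \<le> K" using K(2) x x0 by auto
    then have "\<bar>f1 x - f1 x0\<bar> + \<bar>f2 x - f2 x0\<bar> \<le> 4 * K" by linarith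
    then have "(\<bar>C\<bar> + 1) * (\<bar>f1 x - f1 x0\<bar> + \<bar>f2 x - f2 x0\<bar>) \<le> (\<bar>C\<bar> + 1) * (4 * K)"
      by (intro mult_left_mono) auto
    then show ?thesis using le'[OF x x0] by linarith
  qed
  then have "bounded (h ` X)" by (auto simp: bounded_iff)
  moreover have "\<exists>\<W>\<in>\<D>. osc_less h \<W> e" if e: "e > 0" for e
  proof -
    define d where "d = e / (2 * (\<bar>C\<bar> + 1))"
    have d: "d > 0" "(\<bar>C\<bar> + 1) * (2 * d) = e" using e by (auto simp: d_def field_simps)
    obtain \<W> where W: "\<W> \<in> \<D>" "\<forall>f\<in>{f1, f2}. osc_less f \<W> d"
      using UC\<^sub>b_common_osc[of "{f1, f2}" d] f d by auto
    have "osc_less h \<W> e"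
      unfolding osc_less_def
    proof (intro ballI)
      fix A x y assume A: "A \<in> \<W>" "x \<in> A" "y \<in> A"
      then have X: "x \<in> X" "y \<in> X" using member_subset[OF W(1)] by auto
      have "\<bar>f1 x - f1 y\<bar> < d" "\<bar>f2 x - f2 y\<bar> < d"
        using osc_lessD[of f1 \<W> d A x y] osc_lessD[of f2 \<W> d A x y] W(2) A by auto
      then have "(\<bar>C\<bar> + 1) * (\<bar>f1 x - f1 y\<bar> + \<bar>f2 x - f2 y\<bar>) < (\<bar>C\<bar> + 1) * (2 * d)"
        by (intro mult_strict_left_mono) linarith+
      then show "\<bar>h x - h y\<bar> < e" using le'[OF X] d(2) by linarith
    qed
    then show ?thesis using W(1) by blast
  qed
  ultimately show ?thesis using h by (simp add: UC\<^sub>b_iff)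
qed

lemma UC\<^sub>b_add:
  assumes "f \<in> UC\<^sub>b X \<D>" "g \<in> UC\<^sub>b X \<D>"
  shows "(\<lambda>x\<in>X. f x + g x) \<in> UC\<^sub>b X \<D>"
  by (rule UC\<^sub>b_dominated[OF assms, where C = 1]) auto

lemma UC\<^sub>b_cmult:
  assumes "f \<in> UC\<^sub>b X \<D>"
  shows "(\<lambda>x\<in>X. c * f x) \<in> UC\<^sub>b X \<D>"
proof (rule UC\<^sub>b_dominated[OF assms assms, where C = "\<bar>c\<bar>"])
  fix x y assume "x \<in> X" "y \<in> X"
  have "\<bar>c * f x - c * f y\<bar> = \<bar>c\<bar> * \<bar>f x - f y\<bar>"
    by (simp add: abs_mult right_diff_distrib flip: abs_mult)
  also have "\<dots> \<le> \<bar>c\<bar> * (\<bar>f x - f y\<bar> + \<bar>f x - f y\<bar>)" by (intro mult_left_mono) auto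
  finally show "\<bar>(\<lambda>x\<in>X. c * f x) x - (\<lambda>x\<in>X. c * f x) y\<bar> \<le> \<bar>c\<bar> * (\<bar>f x - f y\<bar> + \<bar>f x - f y\<bar>)"
    using \<open>x \<in> X\<close> \<open>y \<in> X\<close> by simp
qed auto

lemma UC\<^sub>b_const: "(\<lambda>x\<in>X. c) \<in> UC\<^sub>b X \<D>"
proof -
  have "osc_less (\<lambda>x\<in>X. c) {X} e" if "e > 0" for e using that by (auto simp: osc_less_def)
  then show ?thesis
    using trivial_uniform_covering by (auto simp: UC\<^sub>b_iff bounded_iff)
qed

text \<open>Finitely many bounded functions map \<open>X\<close> into a bounded, hence totally bounded, part of a
  finite-dimensional space.\<close>

lemma finite_net:
  assumes "finite \<Phi>" "\<Phi> \<subseteq> UC\<^sub>b X \<D>" "e > 0"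
  shows "\<exists>R\<subseteq>X. finite R \<and> (\<forall>x\<in>X. \<exists>r\<in>R. \<forall>f\<in>\<Phi>. \<bar>f x - f r\<bar> < e)"
proof -
  obtain K where K: "K \<ge> 0" "\<forall>f\<in>\<Phi>. \<forall>x\<in>X. \<bar>f x\<bar> \<le> K" using UC\<^sub>b_common_bound assms by blast
  \<comment> \<open>One point is picked from each nonempty cell of the grid of mesh \<open>e\<close>.\<close>
  define cell where "cell x = (\<lambda>f\<in>\<Phi>. \<lfloor>f x / e\<rfloor>)" for x
  have "cell ` X \<subseteq> PiE \<Phi> (\<lambda>_. {\<lfloor>- K / e\<rfloor>..\<lfloor>K / e\<rfloor>})"
  proof
    fix c assume "c \<in> cell ` X"
    then obtain x where x: "x \<in> X" "c = cell x" by blast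
    have "\<lfloor>f x / e\<rfloor> \<in> {\<lfloor>- K / e\<rfloor>..\<lfloor>K / e\<rfloor>}" if "f \<in> \<Phi>" for f
    proof -
      have "\<bar>f x\<bar> \<le> K" using K(2) that x by blast
      then have "- K \<le> f x" "f x \<le> K" by linarith+
      then have "- K / e \<le> f x / e" "f x / e \<le> K / e" 
        using assms(3) divide_right_mono[of "- K" "f x" e] divide_right_mono[of "f x" K e] by simp_all
      then show ?thesis by (simp only: atLeastAtMost_iff floor_mono)
    qed
    then show "c \<in> PiE \<Phi> (\<lambda>_. {\<lfloor>- K / e\<rfloor>..\<lfloor>K / e\<rfloor>})" by (auto simp: x cell_def)
  qed
  moreover have "finite (PiE \<Phi> (\<lambda>_. {\<lfloor>- K / e\<rfloor>..\<lfloor>K / e\<rfloor>}))"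
    using assms(1) by (intro finite_PiE) auto
  ultimately have "finite (cell ` X)" by (rule finite_subset)
  then obtain R where R: "R \<subseteq> X" "finite R" "cell ` X = cell ` R"
    using finite_subset_image[of "cell ` X" cell X] by auto
  have "\<exists>r\<in>R. \<forall>f\<in>\<Phi>. \<bar>f x - f r\<bar> < e" if "x \<in> X" for x
  proof -
    have "cell x \<in> cell ` R" unfolding R(3)[symmetric] using that by (rule imageI)
    then obtain r where r: "r \<in> R" "cell x = cell r" by (elim imageE)
    have "\<bar>f x - f r\<bar> < e" if "f \<in> \<Phi>" for f
    proof -
      have "\<lfloor>f x / e\<rfloor> = \<lfloor>f r / e\<rfloor>" using fun_cong[OF r(2), of f] that by (simp add: cell_def)
      then have "\<bar>f x / e - f r / e\<bar> < 1" by linarith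
      then have "\<bar>f x - f r\<bar> / e < 1" using assms(3) by (simp add: abs_divide flip: diff_divide_distrib)
      then show ?thesis using assms(3) by (simp add: field_simps)
    qed
    then show ?thesis using r(1) by blast
  qed
  then show ?thesis using R by blast
qed

text \<open>The coverings provided by uniform continuity may be infinite, whereas uniform complexity deals with
  finite ones only. The balls around a finite net give a finite one.\<close>

lemma ex_finite_osc_covering:
  assumes \<Phi>: "finite \<Phi>" "\<Phi> \<subseteq> UC\<^sub>b X \<D>" and e: "e > 0"
  shows "\<exists>\<U>\<in>\<N> \<D>. \<forall>f\<in>\<Phi>. osc_less f \<U> e"
proof -
  obtain R where R: "R \<subseteq> X" "finite R" "\<forall>x\<in>X. \<exists>r\<in>R. \<forall>f\<in>\<Phi>. \<bar>f x - f r\<bar> < e / 4"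
    using finite_net[OF \<Phi>, of "e / 4"] e by auto
  obtain \<W> where W: "\<W> \<in> \<D>" "\<forall>f\<in>\<Phi>. osc_less f \<W> (e / 4)"
    using UC\<^sub>b_common_osc[OF \<Phi>, of "e / 4"] e by auto
  define B where "B r = {x\<in>X. \<forall>f\<in>\<Phi>. \<bar>f x - f r\<bar> < e / 2}" for r
  have "B ` R \<in> \<D>"
  proof (rule coarserI[OF W(1)])
    show "B ` R \<preceq> \<W>"
      unfolding refined_by_def
    proof
      fix A assume A: "A \<in> \<W>"
      \<comment> \<open>Any point of \<open>X\<close> will do if \<open>A\<close> is empty.\<close>
      define a where "a = (SOME a. a \<in> X \<and> (A \<noteq> {} \<longrightarrow> a \<in> A))"
      have "\<exists>a. a \<in> X \<and> (A \<noteq> {} \<longrightarrow> a \<in> A)" using X_nonempty member_subset[OF W(1) A] by blast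
      from someI_ex[OF this] have a: "a \<in> X" "A \<noteq> {} \<longrightarrow> a \<in> A" by (auto simp: a_def)
      obtain r where r: "r \<in> R" "\<forall>f\<in>\<Phi>. \<bar>f a - f r\<bar> < e / 4" using R(3) a(1) by blast
      have "x \<in> B r" if x: "x \<in> A" for x
      proof -
        have "\<bar>f x - f r\<bar> < e / 2" if f: "f \<in> \<Phi>" for f
        proof -
          have "\<bar>f x - f a\<bar> < e / 4" using W(2) f A x a(2) osc_lessD[of f \<W> "e / 4" A x a] by auto
          moreover have "\<bar>f a - f r\<bar> < e / 4" using r(2) f by blast
          ultimately show ?thesis by linarith
        qed
        then show ?thesis using member_subset[OF W(1) A] x by (auto simp: B_def)
      qed
      then show "\<exists>U\<in>B ` R. A \<subseteq> U" using r(1) by blast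
    qed
  qed (auto simp: B_def)
  moreover have "osc_less f (B ` R) e" if f: "f \<in> \<Phi>" for f
    unfolding osc_less_def
  proof (intro ballI)
    fix A x y assume "A \<in> B ` R" "x \<in> A" "y \<in> A"
    then obtain r where "\<bar>f x - f r\<bar> < e / 2" "\<bar>f y - f r\<bar> < e / 2" using f by (auto simp: B_def)
    then show "\<bar>f x - f y\<bar> < e" by linarith
  qed
  ultimately show ?thesis using R(2) by (auto simp: finite_uniform_coverings_def)
qed

lemma UC\<^sub>b_bdd:
  assumes "f \<in> UC\<^sub>b X \<D>"
  shows "bdd_below (f ` X)" "bdd_above (f ` X)"
  using assms bounded_imp_bdd_below bounded_imp_bdd_above by (auto simp: UC\<^sub>b_iff)

lemma average_is_mean:
  fixes x :: "'b \<Rightarrow> 'a"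
  assumes W: "finite W" "W \<noteq> {}" "\<And>w. w \<in> W \<Longrightarrow> x w \<in> X"
  shows "mean X \<D> (\<lambda>f. if f \<in> UC\<^sub>b X \<D> then (\<Sum>w\<in>W. f (x w)) / card W else 0)"
  unfolding mean_def
proof (intro conjI ballI allI)
  fix f g assume f: "f \<in> UC\<^sub>b X \<D>" and g: "g \<in> UC\<^sub>b X \<D>"
  have "(\<Sum>w\<in>W. (\<lambda>x\<in>X. f x + g x) (x w)) = (\<Sum>w\<in>W. f (x w) + g (x w))"
    using W(3) by (intro sum.cong) auto
  then show "(if (\<lambda>x\<in>X. f x + g x) \<in> UC\<^sub>b X \<D> then (\<Sum>w\<in>W. (\<lambda>x\<in>X. f x + g x) (x w)) / real (card W) else 0) =
     (if f \<in> UC\<^sub>b X \<D> then (\<Sum>w\<in>W. f (x w)) / real (card W) else 0) +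
     (if g \<in> UC\<^sub>b X \<D> then (\<Sum>w\<in>W. g (x w)) / real (card W) else 0)"
    using f g UC\<^sub>b_add[OF f g] by (simp add: sum.distrib add_divide_distrib)
next
  fix c f assume f: "f \<in> UC\<^sub>b X \<D>"
  have "(\<Sum>w\<in>W. (\<lambda>x\<in>X. c * f x) (x w)) = (\<Sum>w\<in>W. c * f (x w))"
    using W(3) by (intro sum.cong) auto
  then show "(if (\<lambda>x\<in>X. c * f x) \<in> UC\<^sub>b X \<D> then (\<Sum>w\<in>W. (\<lambda>x\<in>X. c * f x) (x w)) / real (card W) else 0) =
     c * (if f \<in> UC\<^sub>b X \<D> then (\<Sum>w\<in>W. f (x w)) / real (card W) else 0)"
    using f UC\<^sub>b_cmult[OF f, of c] by (simp add: sum_distrib_left)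
next
  fix f assume f: "f \<in> UC\<^sub>b X \<D>"
  have n: "real (card W) > 0" using W by (simp add: card_gt_0_iff)
  have "(INF x\<in>X. f x) \<le> f (x w)" if "w \<in> W" for w
    by (rule cINF_lower[OF UC\<^sub>b_bdd(1)[OF f] W(3)[OF that]])
  from sum_bounded_below[of W, OF this]
  have "(INF x\<in>X. f x) * card W \<le> (\<Sum>w\<in>W. f (x w))" by (simp add: mult.commute)
  then show "(INF x\<in>X. f x) \<le> (if f \<in> UC\<^sub>b X \<D> then (\<Sum>w\<in>W. f (x w)) / real (card W) else 0)"
    using f n by (simp add: pos_le_divide_eq)
  have "f (x w) \<le> (SUP x\<in>X. f x)" if "w \<in> W" for w
    by (rule cSUP_upper[OF W(3)[OF that] UC\<^sub>b_bdd(2)[OF f]])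
  from sum_bounded_above[of W, OF this]
  have "(\<Sum>w\<in>W. f (x w)) \<le> (SUP x\<in>X. f x) * card W" by (simp add: mult.commute)
  then show "(if f \<in> UC\<^sub>b X \<D> then (\<Sum>w\<in>W. f (x w)) / real (card W) else 0) \<le> (SUP x\<in>X. f x)"
    using f n by (simp add: pos_divide_le_eq)
qed

lemma closed_means: "closed {m. mean X \<D> m}"
proof -
  have eq: "{m. mean X \<D> m} =
    (\<Inter>f\<in>UC\<^sub>b X \<D>. \<Inter>g\<in>UC\<^sub>b X \<D>. {m. m (\<lambda>x\<in>X. f x + g x) = m f + m g}) \<inter>
    (\<Inter>c. \<Inter>f\<in>UC\<^sub>b X \<D>. {m. m (\<lambda>x\<in>X. c * f x) = c * m f}) \<inter>
    (\<Inter>f\<in>UC\<^sub>b X \<D>. {m. (INF x\<in>X. f x) \<le> m f} \<inter> {m. m f \<le> (SUP x\<in>X. f x)})"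
    by (auto simp: mean_def)
  show ?thesis
    unfolding eq
    by (intro closed_Int closed_INT ballI closed_Collect_eq closed_Collect_le continuous_intros
        continuous_on_product_coordinates)
qed

text \<open>A mean takes its value at \<open>f\<close> in the compact interval between the infimum and the supremum of
  \<open>f\<close>, and vanishing outside \<open>UC\<^sub>b X \<D>\<close> confines the other coordinates to a compact set as well. So the means
  in question form a compact set in the topology of pointwise convergence (Tychonoff).\<close>

lemma amenable_if_approximately:
  assumes approx: "\<And>L e. finite L \<Longrightarrow> L \<subseteq> UC\<^sub>b X \<D> \<times> G \<Longrightarrow> e > 0 \<Longrightarrow>
    \<exists>m. mean X \<D> m \<and> (\<forall>f. f \<notin> UC\<^sub>b X \<D> \<longrightarrow> m f = 0) \<and>
        (\<forall>(f, g)\<in>L. \<bar>m (compose X f g) - m f\<bar> \<le> e)"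
  shows "amenable X \<D> G"
proof -
  define M where "M = (\<lambda>(L, e). {m. mean X \<D> m} \<inter> (\<Inter>f\<in>- UC\<^sub>b X \<D>. {m. m f = 0}) \<inter>
    (\<Inter>p\<in>L. {m. \<bar>m (compose X (fst p) (snd p)) - m (fst p)\<bar> \<le> e}))"
  define I where "I = {L. finite L \<and> L \<subseteq> UC\<^sub>b X \<D> \<times> G} \<times> {0::real<..}"
  define S :: "(('a \<Rightarrow> real) \<Rightarrow> real) set" where
    "S = PiE UNIV (\<lambda>f. if f \<in> UC\<^sub>b X \<D> then {(INF x\<in>X. f x)..(SUP x\<in>X. f x)} else {0})"
  have "compactin (product_topology (\<lambda>f. euclidean) UNIV) S"
    unfolding S_def compactin_PiE by auto
  then have "compact S" by (simp add: euclidean_product_topology)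
  moreover have "closed (M i)" for i
    unfolding M_def
    by (cases i) (auto intro!: closed_Int closed_INT closed_means closed_Collect_eq closed_Collect_le
        continuous_intros continuous_on_product_coordinates)
  moreover have "S \<inter> (\<Inter>i\<in>I'. M i) \<noteq> {}" if I': "finite I'" "I' \<subseteq> I" for I'
  proof -
    \<comment> \<open>The closed sets \<open>M (L, e)\<close> are directed: the intersection of finitely many of them contains
      another one.\<close>
    define L where "L = \<Union>(fst ` I')"
    define e where "e = Min (insert 1 (snd ` I'))"
    have I'D: "finite (fst i) \<and> fst i \<subseteq> UC\<^sub>b X \<D> \<times> G \<and> snd i > 0" if "i \<in> I'" for i
      using subsetD[OF I'(2) that] by (simp add: I_def mem_Times_iff)
    have L: "finite L" unfolding L_def using I'(1) I'D by blast
    have LX: "L \<subseteq> UC\<^sub>b X \<D> \<times> G" unfolding L_def using I'D by blast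
    have e: "e > 0" unfolding e_def using I'(1) I'D by (subst Min_gr_iff) auto
    obtain m where m: "mean X \<D> m" "\<forall>f. f \<notin> UC\<^sub>b X \<D> \<longrightarrow> m f = 0"
        "\<forall>(f, g)\<in>L. \<bar>m (compose X f g) - m f\<bar> \<le> e"
      using approx[OF L LX e] by (elim exE conjE)
    have "m \<in> M i" if "i \<in> I'" for i
    proof -
      have "e \<le> snd i" using I'(1) that by (simp add: e_def)
      moreover have "\<bar>m (compose X (fst p) (snd p)) - m (fst p)\<bar> \<le> e" if "p \<in> fst i" for p
      proof -
        have "p \<in> L" using that \<open>i \<in> I'\<close> by (auto simp: L_def)
        then show ?thesis using bspec[OF m(3)] by (simp add: case_prod_beta)
      qed
      ultimately have "\<forall>p\<in>fst i. \<bar>m (compose X (fst p) (snd p)) - m (fst p)\<bar> \<le> snd i"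
        by (meson order_trans)
      then show ?thesis using m(1,2) by (simp add: M_def case_prod_beta)
    qed
    moreover have "m \<in> S"
      using m(1,2) by (auto simp: S_def mean_def)
    ultimately show ?thesis by blast
  qed
  ultimately have "S \<inter> (\<Inter>i\<in>I. M i) \<noteq> {}" by (rule compact_imp_fip_image)
  then obtain m where m: "\<And>i. i \<in> I \<Longrightarrow> m \<in> M i" by auto
  have "m \<in> M ({}, 1)" by (rule m) (simp add: I_def)
  then have "mean X \<D> m" by (simp add: M_def)
  moreover have "m (compose X f g) = m f" if "f \<in> UC\<^sub>b X \<D>" "g \<in> G" for f g
  proof -
    have "\<bar>m (compose X f g) - m f\<bar> \<le> e" if "e > 0" for e
    proof -
      have "m \<in> M ({(f, g)}, e)" by (rule m) (use \<open>f \<in> _\<close> \<open>g \<in> G\<close> that in \<open>simp add: I_def\<close>)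
      then show ?thesis by (simp add: M_def)
    qed
    then have "\<bar>m (compose X f g) - m f\<bar> \<le> 0" by (rule dense_ge)
    then show ?thesis by simp
  qed
  ultimately show ?thesis unfolding amenable_def by blast
qed

end

section \<open>Complexity at most one implies amenability\<close>

locale dynamics =
  fixes X :: "'a set" and \<D> :: "'a set set set" and G :: "('a \<Rightarrow> 'a) set"
  assumes dynamical_system: "dynamical_system X \<D> G"

sublocale dynamics \<subseteq> uniform_covers X \<D>
  using dynamical_system by unfold_locales (simp add: dynamical_system_def)

context dynamics
begin

lemma subgroup_G: "subgroup G (Aut X \<D>)"
  using dynamical_system by (simp add: dynamical_system_def)

lemma G_automorphism: "g \<in> G \<Longrightarrow> g \<in> uniform_automorphisms X \<D>"
  using subgroup.subset[OF subgroup_G] by (auto simp: Aut_def)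

lemma identity_in_G: "(\<lambda>x\<in>X. x) \<in> G"
  using subgroup.one_closed[OF subgroup_G] by (simp add: Aut_def BijGroup_def)

lemma bij: "g \<in> G \<Longrightarrow> bij_betw g X X"
  using G_automorphism by (auto simp: uniform_automorphisms_def Bij_def)

lemma image_X: "g \<in> G \<Longrightarrow> g ` X = X"
  using bij by (simp add: bij_betw_def)

lemma inj: "g \<in> G \<Longrightarrow> inj_on g X"
  using bij by (simp add: bij_betw_def)

lemma maps_to: "g \<in> G \<Longrightarrow> x \<in> X \<Longrightarrow> g x \<in> X"
  using image_X by blast

lemma vimage_uniform: "g \<in> G \<Longrightarrow> \<U> \<in> \<D> \<Longrightarrow> (\<lambda>A. g -` A \<inter> X) ` \<U> \<in> \<D>"
  using G_automorphism by (auto simp: uniform_automorphisms_def cover_uniformly_continuous_def)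

lemma image_uniform:
  assumes g: "g \<in> G" and U: "\<U> \<in> \<D>"
  shows "(`) g ` \<U> \<in> \<D>"
proof -
  have "inv_into X g -` A \<inter> X = g ` A" if "A \<in> \<U>" for A
  proof -
    have A: "A \<subseteq> X" using member_subset[OF U that] .
    show ?thesis
    proof (intro subset_antisym subsetI)
      fix y assume "y \<in> inv_into X g -` A \<inter> X"
      then show "y \<in> g ` A" using bij_betw_inv_into_right[OF bij[OF g], of y] by (metis IntE image_eqI vimageE)
    next
      fix y assume "y \<in> g ` A"
      then obtain x where x: "x \<in> A" "y = g x" by blast
      then have "x \<in> X" using A by blast
      then show "y \<in> inv_into X g -` A \<inter> X"
        using x bij_betw_inv_into_left[OF bij[OF g]] maps_to[OF g] by simp
    qed
  qed
  then have "(\<lambda>A. inv_into X g -` A \<inter> X) ` \<U> = (`) g ` \<U>" by (intro image_cong) auto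
  moreover have "(\<lambda>A. inv_into X g -` A \<inter> X) ` \<U> \<in> \<D>"
    using G_automorphism[OF g] U by (auto simp: uniform_automorphisms_def cover_uniformly_continuous_def)
  ultimately show ?thesis by simp
qed

lemma image_finite_uniform: "g \<in> G \<Longrightarrow> \<U> \<in> \<N> \<D> \<Longrightarrow> (`) g ` \<U> \<in> \<N> \<D>"
  by (simp add: finite_uniform_coverings_def image_uniform)

lemma compose_UC\<^sub>b:
  assumes g: "g \<in> G" and f: "f \<in> UC\<^sub>b X \<D>"
  shows "compose X f g \<in> UC\<^sub>b X \<D>"
  unfolding UC\<^sub>b_iff
proof (intro conjI allI impI)
  show "compose X f g \<in> extensional X" by (simp add: compose_def)
  have "compose X f g ` X \<subseteq> f ` X" using maps_to[OF g] by (auto simp: compose_def)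
  then show "bounded (compose X f g ` X)" using f bounded_subset by (auto simp: UC\<^sub>b_iff)
  fix e :: real assume "e > 0"
  then obtain \<W> where W: "\<W> \<in> \<D>" "osc_less f \<W> e" using UC\<^sub>b_osc[OF f] by blast
  have "osc_less (compose X f g) ((\<lambda>A. g -` A \<inter> X) ` \<W>) e"
    using osc_lessD[OF W(2)] by (auto simp: osc_less_def compose_def)
  then show "\<exists>\<W>\<in>\<D>. osc_less (compose X f g) \<W> e" using vimage_uniform[OF g W(1)] by blast
qed

text \<open>This unwinds the suprema and infima in the definition of the asymptotic uniform complexity.\<close>

lemma almost_invariant_covering:
  assumes \<omega>: "asymptotic_uniform_complexity \<D> G \<le> 1"
    and E: "finite E" "E \<subseteq> G" and U: "\<U> \<in> \<N> \<D>" and e: "e > 0"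
  shows "\<exists>\<V>\<in>\<N> \<D>. \<U> \<preceq> \<V> \<and> (\<forall>g\<in>E. real (uniform_complexity \<D> (\<V> \<squnion>\<^sub>c (`) g ` \<V>))
    \<le> (1 + e) * real (uniform_complexity \<D> \<V>))"
proof -
  let ?r = "\<lambda>\<V> g. ereal (real (uniform_complexity \<D> (\<V> \<squnion>\<^sub>c (`) g ` \<V>)) / real (uniform_complexity \<D> \<V>))"
  have "E \<in> Fpow G" using E by (simp add: Fpow_def)
  have "(INF \<V>\<in>{\<V> \<in> \<N> \<D>. \<U> \<preceq> \<V>}. SUP g\<in>E. ?r \<V> g)
    \<le> (SUP \<U>\<in>\<N> \<D>. INF \<V>\<in>{\<V> \<in> \<N> \<D>. \<U> \<preceq> \<V>}. SUP g\<in>E. ?r \<V> g)"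
    using U by (rule SUP_upper)
  also have "\<dots> \<le> asymptotic_uniform_complexity \<D> G"
    unfolding asymptotic_uniform_complexity_def using \<open>E \<in> Fpow G\<close> by (rule SUP_upper)
  also have "\<dots> < ereal (1 + e)" using \<omega> e by (simp add: order_le_less_trans one_ereal_def)
  finally obtain \<V> where V: "\<V> \<in> \<N> \<D>" "\<U> \<preceq> \<V>" and less: "(SUP g\<in>E. ?r \<V> g) < ereal (1 + e)"
    by (auto simp: INF_less_iff)
  have "real (uniform_complexity \<D> (\<V> \<squnion>\<^sub>c (`) g ` \<V>)) \<le> (1 + e) * real (uniform_complexity \<D> \<V>)"
    if "g \<in> E" for g
  proof -
    have "?r \<V> g \<le> (SUP g\<in>E. ?r \<V> g)" using that by (rule SUP_upper)
    then have "?r \<V> g < ereal (1 + e)" using less by (rule order_le_less_trans)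
    then show ?thesis using uniform_complexity_pos[OF V(1)] by (simp add: pos_divide_less_eq)
  qed
  then show ?thesis using V by blast
qed

text \<open>A smallest refinement \<open>\<P>\<close> of \<open>\<V> \<or> g \<V>\<close> refines both \<open>\<V>\<close> and \<open>g \<V>\<close>, so both \<open>\<P>\<close> and \<open>g\<^sup>-\<^sup>1 \<P>\<close>
  can be compared with \<open>\<W>\<close>. The sum of \<open>f\<close> over \<open>\<P>\<close> and the sum of \<open>f \<circ> g\<close> over \<open>g\<^sup>-\<^sup>1 \<P>\<close> are
  the same when sample points correspond to each other under \<open>g\<close>.\<close>

lemma sums_almost_invariant:
  fixes x :: "'a set \<Rightarrow> 'a"
  assumes g: "g \<in> G" and V: "\<V> \<in> \<N> \<D>"
    and W: "\<W> \<in> \<N> \<D>" "\<V> \<preceq> \<W>" "card \<W> = uniform_complexity \<D> \<V>"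
    and x: "\<And>W. W \<in> \<W> \<Longrightarrow> x W \<in> X \<and> (W \<noteq> {} \<longrightarrow> x W \<in> W)"
    and K: "\<And>y. y \<in> X \<Longrightarrow> \<bar>f y\<bar> \<le> K"
    and osc: "osc_less f \<V> \<delta>" "osc_less (compose X f g) \<V> \<delta>" and \<delta>: "\<delta> > 0"
  shows "\<bar>(\<Sum>W\<in>\<W>. compose X f g (x W)) - (\<Sum>W\<in>\<W>. f (x W))\<bar> \<le> 4 * \<delta> * card \<W> +
    2 * K * (real (uniform_complexity \<D> (\<V> \<squnion>\<^sub>c (`) g ` \<V>)) - real (uniform_complexity \<D> \<V>))"
proof -
  obtain \<P> where P: "\<P> \<in> \<N> \<D>" "\<V> \<squnion>\<^sub>c (`) g ` \<V> \<preceq> \<P>"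
      "card \<P> = uniform_complexity \<D> (\<V> \<squnion>\<^sub>c (`) g ` \<V>)"
    using ex_minimal_refinement[OF join_finite_uniform[OF V image_finite_uniform[OF g V]]] by blast
  have P1: "\<V> \<preceq> \<P>" and P2: "(`) g ` \<V> \<preceq> \<P>"
    using refined_by_trans[OF refined_by_join(1) P(2)] refined_by_trans[OF refined_by_join(2) P(2)] .
  have PX: "A \<subseteq> X" if "A \<in> \<P>" for A
    using P(1) that member_subset by (auto simp: finite_uniform_coverings_def)
  \<comment> \<open>Pulling \<open>\<P>\<close> back along \<open>g\<close> gives a refinement of \<open>\<V>\<close> as well, of the same size.\<close>
  define pull where "pull A = g -` A \<inter> X" for A
  have push_pull: "g ` pull A = A" if "A \<in> \<P>" for A
  proof -
    have "A \<subseteq> g ` X" using PX[OF that] image_X[OF g] by simp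
    then show ?thesis by (auto simp: pull_def)
  qed
  have inj_pull: "inj_on pull \<P>" by (rule inj_on_inverseI[of _ "(`) g"]) (rule push_pull)
  have Q: "pull ` \<P> \<in> \<N> \<D>"
    using P(1) vimage_uniform[OF g] by (simp add: finite_uniform_coverings_def pull_def[abs_def])
  have VQ: "\<V> \<preceq> pull ` \<P>"
    unfolding refined_by_def
  proof
    fix B assume "B \<in> pull ` \<P>"
    then obtain A where A: "A \<in> \<P>" "B = pull A" by blast
    obtain C where C: "C \<in> \<V>" "A \<subseteq> g ` C" using refined_byD[OF P2 A(1)] by blast
    have "C \<subseteq> X" using C(1) V member_subset by (auto simp: finite_uniform_coverings_def)
    have "y \<in> C" if "y \<in> B" for y
    proof -
      have "y \<in> X" "g y \<in> g ` C" using that A(2) C(2) by (auto simp: pull_def)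
      then show ?thesis using inj_on_image_mem_iff[OF inj[OF g] _ \<open>C \<subseteq> X\<close>] by blast
    qed
    then show "\<exists>C\<in>\<V>. B \<subseteq> C" using C(1) by blast
  qed
  \<comment> \<open>Sample values of \<open>f\<close>; an empty member of \<open>\<P>\<close> gets a harmless value.\<close>
  define b where "b A = (if A = {} then 0 else f (SOME y. y \<in> A))" for A
  have some: "(SOME y. y \<in> A) \<in> A" if "A \<noteq> {}" for A :: "'a set" using that by (simp add: some_in_eq)
  have Kpos: "K \<ge> 0" using K X_nonempty by (meson abs_ge_zero all_not_in_conv order_trans)
  have bK: "\<bar>b A\<bar> \<le> K" if "A \<in> \<P>" for A
    using K PX[OF that] some[of A] Kpos by (auto simp: b_def)
  have bP: "\<bar>f y - b A\<bar> \<le> \<delta>" if A: "A \<in> \<P>" "y \<in> A" for A y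
  proof -
    have "\<bar>f y - f (SOME y. y \<in> A)\<bar> < \<delta>"
      by (rule osc_lessD[OF osc_less_refined[OF osc(1) P1] A(1) A(2)]) (use some A in blast)
    then show ?thesis using A by (auto simp: b_def)
  qed
  have xW: "\<bar>h y - h (x W)\<bar> \<le> \<delta>" if "osc_less h \<V> \<delta>" "W \<in> \<W>" "y \<in> W" for h y W
  proof -
    have "\<bar>h y - h (x W)\<bar> < \<delta>"
      by (rule osc_lessD[OF osc_less_refined[OF that(1) W(2)] that(2,3)]) (use x that in blast)
    then show ?thesis by simp
  qed
  have 1: "\<bar>(\<Sum>W\<in>\<W>. f (x W)) - sum b \<P>\<bar>
      \<le> 2 * \<delta> * card \<W> + K * (real (card \<P>) - real (card \<W>))"
    by (rule sums_over_refinements_close[OF W P(1) P1, where h = f])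
      (auto intro: xW[OF osc(1)] bP bK)
  have "\<bar>(\<Sum>W\<in>\<W>. compose X f g (x W)) - sum (\<lambda>B. b (g ` B)) (pull ` \<P>)\<bar>
      \<le> 2 * \<delta> * card \<W> + K * (real (card (pull ` \<P>)) - real (card \<W>))"
  proof (rule sums_over_refinements_close[OF W Q VQ, where h = "compose X f g"])
    fix B y assume B: "B \<in> pull ` \<P>" "y \<in> B"
    then obtain A where A: "A \<in> \<P>" "B = pull A" by blast
    then have "y \<in> X" "g y \<in> A" using B by (auto simp: pull_def)
    then show "\<bar>compose X f g y - b (g ` B)\<bar> \<le> \<delta>"
      using bP[OF A(1)] push_pull[OF A(1)] A(2) by (simp add: compose_def)
  next
    fix B assume "B \<in> pull ` \<P>"
    then obtain A where A: "A \<in> \<P>" "B = pull A" by blast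
    then show "\<bar>b (g ` B)\<bar> \<le> K" using push_pull bK by simp
  qed (rule xW[OF osc(2)])
  moreover have "sum (\<lambda>B. b (g ` B)) (pull ` \<P>) = sum b \<P>"
    by (simp add: sum.reindex[OF inj_pull] push_pull)
  ultimately have 2: "\<bar>(\<Sum>W\<in>\<W>. compose X f g (x W)) - sum b \<P>\<bar>
      \<le> 2 * \<delta> * card \<W> + K * (real (card \<P>) - real (card \<W>))"
    by (simp add: card_image[OF inj_pull])
  have "\<bar>(\<Sum>W\<in>\<W>. compose X f g (x W)) - (\<Sum>W\<in>\<W>. f (x W))\<bar>
      \<le> 2 * (2 * \<delta> * card \<W> + K * (real (card \<P>) - real (card \<W>)))"
  proof -
    have tri: "\<bar>r - s\<bar> \<le> 2 * c" if "\<bar>r - t\<bar> \<le> c" "\<bar>s - t\<bar> \<le> c" for r s t c :: real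
      using that by linarith
    show ?thesis by (rule tri[OF 2 1])
  qed
  also have "\<dots> = 4 * \<delta> * card \<W> + 2 * K * (real (card \<P>) - real (card \<W>))"
    by (simp add: algebra_simps)
  finally show ?thesis by (simp only: P(3) W(3))
qed

theorem amenable_if_complexity_le_1:
  assumes \<omega>: "asymptotic_uniform_complexity \<D> G \<le> 1"
  shows "amenable X \<D> G"
proof (rule amenable_if_approximately)
  fix L :: "(('a \<Rightarrow> real) \<times> ('a \<Rightarrow> 'a)) set" and e :: real
  assume L: "finite L" "L \<subseteq> UC\<^sub>b X \<D> \<times> G" and e: "e > 0"
  define \<Phi> where "\<Phi> = fst ` L \<union> (\<lambda>(f, g). compose X f g) ` L"
  have \<Phi>: "finite \<Phi>" "\<Phi> \<subseteq> UC\<^sub>b X \<D>"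
    using L compose_UC\<^sub>b by (auto simp: \<Phi>_def)
  obtain K where K: "K \<ge> 0" "\<forall>f\<in>\<Phi>. \<forall>x\<in>X. \<bar>f x\<bar> \<le> K" using UC\<^sub>b_common_bound[OF \<Phi>] by blast
  \<comment> \<open>These make \<open>4 \<delta> + 2 K \<eta>\<close>, the error in \<open>sums_almost_invariant\<close> per member of \<open>\<W>\<close>, at most
    \<open>e\<close>.\<close>
  define \<delta> where "\<delta> = e / 8"
  define \<eta> where "\<eta> = e / (4 * (K + 1))"
  have pos: "\<delta> > 0" "\<eta> > 0" using e K(1) by (auto simp: \<delta>_def \<eta>_def)
  obtain \<U> where U: "\<U> \<in> \<N> \<D>" "\<forall>f\<in>\<Phi>. osc_less f \<U> \<delta>"
    using ex_finite_osc_covering[OF \<Phi> pos(1)] by blast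
  have "finite (snd ` L)" "snd ` L \<subseteq> G" using L by auto
  then obtain \<V> where V: "\<V> \<in> \<N> \<D>" "\<U> \<preceq> \<V>"
    and inv: "\<forall>g\<in>snd ` L. real (uniform_complexity \<D> (\<V> \<squnion>\<^sub>c (`) g ` \<V>))
      \<le> (1 + \<eta>) * real (uniform_complexity \<D> \<V>)"
    using almost_invariant_covering[OF \<omega> _ _ U(1) pos(2), of "snd ` L"] by blast
  obtain \<W> where W: "\<W> \<in> \<N> \<D>" "\<V> \<preceq> \<W>" "card \<W> = uniform_complexity \<D> \<V>"
    using ex_minimal_refinement[OF V(1)] by blast
  define x where "x W = (SOME y. y \<in> X \<and> (W \<noteq> {} \<longrightarrow> y \<in> W))" for W
  have x: "x W \<in> X \<and> (W \<noteq> {} \<longrightarrow> x W \<in> W)" if "W \<in> \<W>" for W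
    unfolding x_def
  proof (rule someI_ex)
    have "W \<subseteq> X" using W(1) that member_subset by (auto simp: finite_uniform_coverings_def)
    then show "\<exists>y. y \<in> X \<and> (W \<noteq> {} \<longrightarrow> y \<in> W)" using X_nonempty by blast
  qed
  define n where "n = real (card \<W>)"
  have n: "n > 0" using uniform_complexity_pos[OF V(1)] by (simp add: n_def W(3))
  then have fin: "finite \<W>" "\<W> \<noteq> {}" by (auto simp: n_def card_gt_0_iff)
  define m where "m f = (if f \<in> UC\<^sub>b X \<D> then (\<Sum>W\<in>\<W>. f (x W)) / card \<W> else 0)" for f
  have "\<bar>m (compose X f g) - m f\<bar> \<le> e" if "(f, g) \<in> L" for f g
  proof -
    have f: "f \<in> UC\<^sub>b X \<D>" "f \<in> \<Phi>" and g: "g \<in> G" "g \<in> snd ` L" and fg: "compose X f g \<in> \<Phi>"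
      using that L by (auto simp: \<Phi>_def image_iff intro: bexI[of _ "(f, g)"])
    have osc: "osc_less f \<V> \<delta>" "osc_less (compose X f g) \<V> \<delta>"
      using U(2) f(2) fg osc_less_refined[OF _ V(2)] by blast+
    let ?c = "real (uniform_complexity \<D> (\<V> \<squnion>\<^sub>c (`) g ` \<V>))"
    let ?D = "(\<Sum>W\<in>\<W>. compose X f g (x W)) - (\<Sum>W\<in>\<W>. f (x W))"
    have "?c - n \<le> \<eta> * n" using bspec[OF inv g(2)] by (simp add: n_def W(3) algebra_simps)
    then have "2 * K * (?c - n) \<le> 2 * K * (\<eta> * n)" using K(1) by (intro mult_left_mono) auto
    moreover have "\<bar>?D\<bar> \<le> 4 * \<delta> * n + 2 * K * (?c - n)"
      using sums_almost_invariant[OF g(1) V(1) W x _ osc pos(1), of K] K(2) f(2)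
      by (simp add: n_def W(3))
    ultimately have "\<bar>?D\<bar> \<le> (4 * \<delta> + 2 * K * \<eta>) * n" by (simp add: algebra_simps)
    also have "\<dots> \<le> e * n"
    proof (rule mult_right_mono)
      have "2 * K * \<eta> \<le> e / 2" using K(1) e by (simp add: \<eta>_def field_simps)
      then show "4 * \<delta> + 2 * K * \<eta> \<le> e" unfolding \<delta>_def by linarith
    qed (use n in simp)
    finally have "\<bar>?D\<bar> \<le> e * n" .
    moreover have "m (compose X f g) - m f = ?D / n"
      using f(1) compose_UC\<^sub>b[OF g(1) f(1)] by (simp add: m_def n_def diff_divide_distrib)
    ultimately show ?thesis using n by (simp add: abs_divide pos_divide_le_eq)
  qed
  moreover have "mean X \<D> m"
    unfolding m_def[abs_def] using average_is_mean[of \<W> x] fin x by blast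
  moreover have "\<forall>f. f \<notin> UC\<^sub>b X \<D> \<longrightarrow> m f = 0" by (simp add: m_def)
  ultimately show "\<exists>m. mean X \<D> m \<and> (\<forall>f. f \<notin> UC\<^sub>b X \<D> \<longrightarrow> m f = 0) \<and>
      (\<forall>(f, g)\<in>L. \<bar>m (compose X f g) - m f\<bar> \<le> e)"
    by blast
qed

end

section \<open>Uniformly continuous functions from star refinements\<close>

text \<open>In a sequence of coverings, each a star refinement of the one before, a step inside a member of the
  \<open>k\<close>-th covering is given length \<open>2\<^sup>-\<^sup>k\<close>; the infimum of the lengths of chains is the
  pseudometric of the classical metrization theorem. The number of steps is recorded for use in an
  induction.\<close>

inductive chain :: "(nat \<Rightarrow> 'a set set) \<Rightarrow> nat \<Rightarrow> 'a \<Rightarrow> 'a \<Rightarrow> real \<Rightarrow> bool"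
  for \<U> :: "nat \<Rightarrow> 'a set set"
  where
    chain_refl: "chain \<U> 0 x x 0"
  | chain_step: "chain \<U> n x y s \<Longrightarrow> A \<in> \<U> k \<Longrightarrow> y \<in> A \<Longrightarrow> z \<in> A \<Longrightarrow> chain \<U> (Suc n) x z (s + (1/2) ^ k)"

lemma chain_nonneg: "chain \<U> n x y s \<Longrightarrow> s \<ge> 0"
  by (induction rule: chain.induct) auto

text \<open>Some step of the chain passes position \<open>t\<close>.\<close>

lemma chain_split:
  assumes "chain \<U> n x z s" "0 \<le> t" "t < s"
  shows "\<exists>n1 n2 y y' k A s1 s2. chain \<U> n1 x y s1 \<and> A \<in> \<U> k \<and> y \<in> A \<and> y' \<in> A \<and> chain \<U> n2 y' z s2 \<and>
    n1 < n \<and> n2 < n \<and> s1 \<le> t \<and> t < s1 + (1/2) ^ k \<and> s = s1 + (1/2) ^ k + s2"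
  using assms
proof (induction rule: chain.induct)
  case (chain_refl x)
  then show ?case by simp
next
  case (chain_step n x w s B j z)
  show ?case
  proof (cases "t < s")
    case True
    then obtain n1 n2 y y' k A s1 s2 where IH: "chain \<U> n1 x y s1" "A \<in> \<U> k" "y \<in> A" "y' \<in> A"
        "chain \<U> n2 y' w s2" "n1 < n" "n2 < n" "s1 \<le> t" "t < s1 + (1/2) ^ k" "s = s1 + (1/2) ^ k + s2"
      using chain_step.IH[OF chain_step.prems(1)] by blast
    have "chain \<U> (Suc n2) y' z (s2 + (1/2) ^ j)"
      using IH(5) chain_step.hyps by (intro chain.chain_step)
    then show ?thesis
      using IH
      by (intro exI[of _ n1] exI[of _ "Suc n2"] exI[of _ y] exI[of _ y'] exI[of _ k] exI[of _ A]
          exI[of _ s1] exI[of _ "s2 + (1/2) ^ j"]) simp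
  next
    case False
    then show ?thesis
      using chain_step.hyps chain_step.prems chain.chain_refl[of \<U> z]
      by (intro exI[of _ n] exI[of _ 0] exI[of _ w] exI[of _ z] exI[of _ j] exI[of _ B]
          exI[of _ s] exI[of _ 0]) simp
  qed
qed

lemma star_sequence_mono:
  assumes "\<And>k. \<U> k \<preceq>\<^sup>* \<U> (Suc k)" "k \<le> j"
  shows "\<U> k \<preceq> \<U> j"
  using assms(2)
proof (induction j rule: dec_induct)
  case base
  then show ?case by (auto simp: refined_by_def)
next
  case (step j)
  then show ?case using refined_by_trans star_refined_imp_refined[OF assms(1)] by blast
qed

context uniform_covers
begin

lemma ex_star_sequence:
  assumes "\<W> \<in> \<D>"
  shows "\<exists>\<U>. \<U> 0 = \<W> \<and> (\<forall>k. \<U> k \<in> \<D>) \<and> (\<forall>k. \<U> k \<preceq>\<^sup>* \<U> (Suc k))"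
proof -
  have "\<forall>\<V>. \<exists>\<V>'. \<V> \<in> \<D> \<longrightarrow> \<V>' \<in> \<D> \<and> \<V> \<preceq>\<^sup>* \<V>'" using ex_star_refinement by blast
  then obtain r where r: "\<And>\<V>. \<V> \<in> \<D> \<Longrightarrow> r \<V> \<in> \<D> \<and> \<V> \<preceq>\<^sup>* r \<V>" by metis
  define \<U> where "\<U> k = (r ^^ k) \<W>" for k
  have mem: "\<U> k \<in> \<D>" for k by (induction k) (simp_all add: \<U>_def assms r)
  then have "\<U> k \<preceq>\<^sup>* \<U> (Suc k)" for k using r[OF mem[of k]] by (simp add: \<U>_def)
  then show ?thesis using mem by (intro exI[of _ \<U>]) (simp add: \<U>_def)
qed

text \<open>Frink's lemma. Split the chain at half of its length. The two halves are shorter than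
  \<open>2\<^sup>-\<^sup>k\<^sup>-\<^sup>1\<close>, so by induction each of them stays inside a member of the covering \<open>k + 1\<close>, as does
  the step between them. The union of three such members, each meeting the next, lies in a star of
  the covering \<open>k + 1\<close> and thus in a member of the covering \<open>k\<close>.\<close>

lemma chain_short:
  assumes U: "\<And>k. \<U> k \<in> \<D>" "\<And>k. \<U> k \<preceq>\<^sup>* \<U> (Suc k)"
    and "chain \<U> n x z s" "s < (1/2) ^ k" "x \<in> X"
  shows "\<exists>A\<in>\<U> k. x \<in> A \<and> z \<in> A"
  using assms(3-)
proof (induction n arbitrary: x z s k rule: less_induct)
  case (less n)
  show ?case
  proof (cases "s = 0")
    case True
    have "x = z"
      using less.prems(1)
    proof cases
      case (chain_step n' y s' A k')
      have "s' \<ge> 0" using chain_step(3) by (rule chain_nonneg)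
      moreover have "(1/2 :: real) ^ k' > 0" by simp
      ultimately show ?thesis using chain_step(2) True by linarith
    qed simp
    then show ?thesis using ex_member[OF U(1) less.prems(3)] by blast
  next
    case False
    then have s: "s > 0" using chain_nonneg[OF less.prems(1)] by simp
    then obtain n1 n2 y y' j A s1 s2 where split: "chain \<U> n1 x y s1" "A \<in> \<U> j" "y \<in> A" "y' \<in> A"
        "chain \<U> n2 y' z s2" "n1 < n" "n2 < n" "s1 \<le> s / 2" "s / 2 < s1 + (1/2) ^ j"
        "s = s1 + (1/2) ^ j + s2"
      using chain_split[OF less.prems(1), of "s / 2"] by auto
    have "s1 \<ge> 0" "s2 \<ge> 0" using chain_nonneg[OF split(1)] chain_nonneg[OF split(5)] .
    have "s1 < (1/2) ^ Suc k" "s2 < (1/2) ^ Suc k" using split less.prems(2) by simp_all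
    moreover have "(1/2 :: real) ^ j < (1/2) ^ k"
      using split(10) less.prems(2) \<open>s1 \<ge> 0\<close> \<open>s2 \<ge> 0\<close> by linarith
    then have "Suc k \<le> j" by (simp add: power_strict_decreasing_iff)
    moreover have "y' \<in> X" using split(2,4) member_subset[OF U(1)] by blast
    ultimately obtain A1 A2 where A1: "A1 \<in> \<U> (Suc k)" "x \<in> A1" "y \<in> A1"
      and A2: "A2 \<in> \<U> (Suc k)" "y' \<in> A2" "z \<in> A2"
      using less.IH[OF split(6) split(1), of "Suc k"] less.IH[OF split(7) split(5), of "Suc k"]
        less.prems(3) by blast
    obtain A' where A': "A' \<in> \<U> (Suc k)" "A \<subseteq> A'"
      using refined_byD[OF star_sequence_mono[of \<U>, OF U(2) \<open>Suc k \<le> j\<close>] split(2)] by blast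
    obtain B where B: "B \<in> \<U> k" "St A' (\<U> (Suc k)) \<subseteq> B"
      using star_refinedD[OF U(2)[of k] A'(1)] by blast
    have "x \<in> St A' (\<U> (Suc k))" "z \<in> St A' (\<U> (Suc k))"
      using A1 A2 A' split(3,4) by (auto simp: St_def)
    then show ?thesis using B by blast
  qed
qed

text \<open>Take the distance from \<open>A\<close>, cut off at \<open>1\<close>, with respect to the lengths of chains in a sequence of
  coverings that begins with \<open>\<W>\<close>.\<close>

lemma uniform_Urysohn:
  assumes W: "\<W> \<in> \<D>" and A: "A \<subseteq> X"
  shows "\<exists>f\<in>UC\<^sub>b X \<D>. (\<forall>x\<in>X. 0 \<le> f x) \<and> (\<forall>x\<in>A. f x = 0) \<and> (\<forall>x\<in>X. f x < 1 \<longrightarrow> x \<in> St A \<W>)"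
proof -
  obtain \<U> where U0: "\<U> 0 = \<W>" and U: "\<And>k. \<U> k \<in> \<D>" "\<And>k. \<U> k \<preceq>\<^sup>* \<U> (Suc k)"
    using ex_star_sequence[OF W] by blast
  define L where "L x = insert 1 {s. \<exists>n. \<exists>a\<in>A. chain \<U> n a x s}" for x
  define f where "f = (\<lambda>x\<in>X. Inf (L x))"
  have L0: "0 \<le> s" if "s \<in> L x" for s x using that chain_nonneg by (auto simp: L_def)
  have bdd: "bdd_below (L x)" for x using L0 by (rule bdd_belowI)
  have ne: "L x \<noteq> {}" for x by (simp add: L_def)
  have f0: "0 \<le> f x" if "x \<in> X" for x
    unfolding f_def using that cInf_greatest[OF ne L0] by simp
  have f1: "f x \<le> 1" if "x \<in> X" for x
    unfolding f_def using that cInf_lower[OF _ bdd, of 1] by (simp add: L_def)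
  have step: "f y \<le> f x + (1/2) ^ k" if xy: "B \<in> \<U> k" "x \<in> B" "y \<in> B" for x y B k
  proof -
    have X: "x \<in> X" "y \<in> X" using xy member_subset[OF U(1)] by blast+
    have "f y - (1/2) ^ k \<le> s" if sL: "s \<in> L x" for s
    proof (cases "s = 1")
      case True
      then show ?thesis using f1[OF X(2)] by (simp add: add_increasing2 diff_le_eq)
    next
      case False
      then obtain n a where a: "a \<in> A" "chain \<U> n a x s" using sL by (auto simp: L_def)
      then have "chain \<U> (Suc n) a y (s + (1/2) ^ k)" using xy by (intro chain_step)
      then have "s + (1/2) ^ k \<in> L y" using a(1) by (auto simp: L_def)
      then have "f y \<le> s + (1/2) ^ k" using X(2) cInf_lower[OF _ bdd] by (simp add: f_def)
      then show ?thesis by linarith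
    qed
    then have "f y - (1/2) ^ k \<le> Inf (L x)" by (rule cInf_greatest[OF ne])
    then show ?thesis using X(1) by (simp add: f_def)
  qed
  have "f \<in> UC\<^sub>b X \<D>"
    unfolding UC\<^sub>b_iff
  proof (intro conjI allI impI)
    show "f \<in> extensional X" by (simp add: f_def)
    show "bounded (f ` X)" using f0 f1 by (auto simp: bounded_iff intro!: exI[of _ 1])
    fix e :: real assume "e > 0"
    then obtain k where k: "(1/2 :: real) ^ k < e" using real_arch_pow_inv[of e "1/2"] by auto
    have "osc_less f (\<U> k) e"
      unfolding osc_less_def
    proof (intro ballI)
      fix B x y assume "B \<in> \<U> k" "x \<in> B" "y \<in> B"
      then have "f y \<le> f x + (1/2) ^ k" "f x \<le> f y + (1/2) ^ k" using step by blast+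
      then show "\<bar>f x - f y\<bar> < e" using k by linarith
    qed
    then show "\<exists>\<W>\<in>\<D>. osc_less f \<W> e" using U(1) by blast
  qed
  moreover have "f x = 0" if x: "x \<in> A" for x
  proof -
    have "0 \<in> L x" using x chain_refl[of \<U> x] by (auto simp: L_def)
    then have "f x \<le> 0" using cInf_lower[OF _ bdd] x A by (auto simp: f_def)
    then show ?thesis using f0[of x] x A by auto
  qed
  moreover have "x \<in> St A \<W>" if x: "x \<in> X" "f x < 1" for x
  proof -
    obtain s where s: "s \<in> L x" "s < 1"
      using x cInf_lessD[OF ne, of x 1] by (auto simp: f_def)
    then obtain n a where a: "a \<in> A" "chain \<U> n a x s" by (auto simp: L_def)
    have "\<exists>B\<in>\<U> 0. a \<in> B \<and> x \<in> B"
      by (rule chain_short[OF U a(2)]) (use s a A in auto)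
    then show ?thesis using a(1) by (auto simp: U0 St_def)
  qed
  ultimately show ?thesis using f0 by blast
qed

text \<open>Apply uniform Urysohn functions to the points of each \<open>A\<close> that lie deep inside \<open>A\<close>. These cores
  still cover \<open>X\<close>.\<close>

lemma subordinate_functions:
  assumes U: "\<U> \<in> \<D>"
  shows "\<exists>f. (\<forall>A\<in>\<U>. f A \<in> UC\<^sub>b X \<D> \<and> (\<forall>x\<in>X. f A x < 1 \<longrightarrow> x \<in> A)) \<and>
    (\<forall>x\<in>X. \<exists>A\<in>\<U>. f A x = 0)"
proof -
  obtain \<W> where W: "\<W> \<in> \<D>" "\<U> \<preceq>\<^sup>* \<W>" using ex_star_refinement[OF U] by blast
  define core where "core A = {x\<in>X. St {x} \<W> \<subseteq> A}" for A
  have "\<exists>f. f \<in> UC\<^sub>b X \<D> \<and> (\<forall>x\<in>core A. f x = 0) \<and> (\<forall>x\<in>X. f x < 1 \<longrightarrow> x \<in> A)" for A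
  proof -
    obtain f where f: "f \<in> UC\<^sub>b X \<D>" "\<forall>x\<in>core A. f x = 0" "\<forall>x\<in>X. f x < 1 \<longrightarrow> x \<in> St (core A) \<W>"
      using uniform_Urysohn[OF W(1), of "core A"] by (auto simp: core_def)
    have "St (core A) \<W> \<subseteq> A" by (auto simp: core_def St_def)
    then show ?thesis using f by blast
  qed
  then obtain f where f: "\<And>A. f A \<in> UC\<^sub>b X \<D>" "\<And>A. \<forall>x\<in>core A. f A x = 0"
      "\<And>A. \<forall>x\<in>X. f A x < 1 \<longrightarrow> x \<in> A"
    by metis
  have "\<exists>A\<in>\<U>. x \<in> core A" if x: "x \<in> X" for x
  proof -
    obtain B where B: "B \<in> \<W>" "x \<in> B" using ex_member[OF W(1) x] by blast
    obtain A where "A \<in> \<U>" "St B \<W> \<subseteq> A" using star_refinedD[OF W(2) B(1)] by blast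
    moreover have "St {x} \<W> \<subseteq> St B \<W>" using B(2) by (auto simp: St_def)
    ultimately show ?thesis using x by (auto simp: core_def)
  qed
  then show ?thesis using f by blast
qed

end

section \<open>Test functions and matchings\<close>

definition near :: "('a \<Rightarrow> real) set \<Rightarrow> real \<Rightarrow> 'a \<Rightarrow> 'a \<Rightarrow> bool"
  where "near \<Phi> d x y \<longleftrightarrow> (\<forall>f\<in>\<Phi>. \<bar>f x - f y\<bar> < d)"

context uniform_covers
begin

text \<open>For a single \<open>f\<close>, cut off \<open>2 - |f x - f r| / d\<close> to \<open>[0, 1]\<close>; in general take the minimum of
  these functions.\<close>

lemma ex_bump:
  assumes "finite \<Phi>" "\<Phi> \<subseteq> UC\<^sub>b X \<D>" "d > 0" "r \<in> X"
  shows "\<exists>h\<in>UC\<^sub>b X \<D>. (\<forall>x\<in>X. 0 \<le> h x \<and> h x \<le> 1) \<and>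
    (\<forall>x\<in>X. (\<forall>f\<in>\<Phi>. \<bar>f x - f r\<bar> < d) \<longrightarrow> h x = 1) \<and>
    (\<forall>x\<in>X. h x > 0 \<longrightarrow> (\<forall>f\<in>\<Phi>. \<bar>f x - f r\<bar> < 2 * d))"
  using assms(1,2)
proof (induction \<Phi>)
  case empty
  show ?case using UC\<^sub>b_const[of 1] by (intro bexI[of _ "\<lambda>x\<in>X. 1"]) auto
next
  case (insert f \<Phi>)
  then obtain h where h: "h \<in> UC\<^sub>b X \<D>" "\<forall>x\<in>X. 0 \<le> h x \<and> h x \<le> 1"
      "\<forall>x\<in>X. (\<forall>f\<in>\<Phi>. \<bar>f x - f r\<bar> < d) \<longrightarrow> h x = 1"
      "\<forall>x\<in>X. h x > 0 \<longrightarrow> (\<forall>f\<in>\<Phi>. \<bar>f x - f r\<bar> < 2 * d)"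
    by auto
  define b where "b x = max 0 (min 1 (2 - \<bar>f x - f r\<bar> / d))" for x
  define h' where "h' = (\<lambda>x\<in>X. min (h x) (b x))"
  have "h' \<in> UC\<^sub>b X \<D>"
  proof (rule UC\<^sub>b_dominated[of h f h' "1 + 1 / d"])
    fix x y assume X: "x \<in> X" "y \<in> X"
    have "\<bar>\<bar>f x - f r\<bar> - \<bar>f y - f r\<bar>\<bar> / d \<le> \<bar>f x - f y\<bar> / d"
      using assms(3) by (intro divide_right_mono) auto
    then have "\<bar>\<bar>f x - f r\<bar> / d - \<bar>f y - f r\<bar> / d\<bar> \<le> \<bar>f x - f y\<bar> / d"
      using assms(3) by (simp add: diff_divide_distrib[symmetric] abs_divide)
    moreover have "\<bar>max 0 (min 1 (2 - u)) - max 0 (min 1 (2 - v))\<bar> \<le> \<bar>u - v\<bar>" for u v :: real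
      by (auto simp: max_def min_def)
    ultimately have "\<bar>b x - b y\<bar> \<le> \<bar>f x - f y\<bar> / d" unfolding b_def by (rule order_trans[rotated])
    then have 1: "\<bar>h' x - h' y\<bar> \<le> \<bar>h x - h y\<bar> + \<bar>f x - f y\<bar> / d"
    proof -
      have "\<bar>min u v - min u' v'\<bar> \<le> \<bar>u - u'\<bar> + c" if "\<bar>v - v'\<bar> \<le> c" for u v u' v' c :: real
        using that by (auto simp: min_def)
      then show ?thesis using X \<open>\<bar>b x - b y\<bar> \<le> \<bar>f x - f y\<bar> / d\<close> by (simp add: h'_def)
    qed
    have "0 \<le> \<bar>h x - h y\<bar> / d" using assms(3) by simp
    then have "\<bar>h x - h y\<bar> + \<bar>f x - f y\<bar> / d \<le> (1 + 1 / d) * (\<bar>h x - h y\<bar> + \<bar>f x - f y\<bar>)"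
      by (simp add: algebra_simps add_divide_distrib)
    with 1 show "\<bar>h' x - h' y\<bar> \<le> (1 + 1 / d) * (\<bar>h x - h y\<bar> + \<bar>f x - f y\<bar>)" by linarith
  qed (use h(1) insert.prems in \<open>auto simp: h'_def\<close>)
  moreover have "b x = 1" if "\<bar>f x - f r\<bar> < d" for x
  proof -
    have "\<bar>f x - f r\<bar> / d < 1" using that assms(3) by simp
    then show ?thesis by (simp add: b_def)
  qed
  moreover have "\<bar>f x - f r\<bar> < 2 * d" if "b x > 0" for x
  proof -
    have "\<bar>f x - f r\<bar> / d < 2" using that by (auto simp: b_def split: if_splits)
    then show ?thesis using assms(3) by (simp add: pos_divide_less_eq)
  qed
  moreover have "0 \<le> b x" for x by (simp add: b_def)
  ultimately show ?case
    using h(2-4) by (intro bexI[of _ h']) (auto simp: h'_def min_def split: if_splits)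
qed

text \<open>The maximum of the bumps around the points of \<open>R\<close>.\<close>

lemma ex_bump_around_set:
  assumes \<Phi>: "finite \<Phi>" "\<Phi> \<subseteq> UC\<^sub>b X \<D>" and d: "d > 0" and R: "finite R" "R \<subseteq> X"
  shows "\<exists>q\<in>UC\<^sub>b X \<D>. (\<forall>x\<in>X. 0 \<le> q x \<and> q x \<le> 1) \<and>
    (\<forall>x\<in>X. (\<exists>r\<in>R. \<forall>f\<in>\<Phi>. \<bar>f x - f r\<bar> < d) \<longrightarrow> q x = 1) \<and>
    (\<forall>x\<in>X. q x > 0 \<longrightarrow> (\<exists>r\<in>R. \<forall>f\<in>\<Phi>. \<bar>f x - f r\<bar> < 2 * d))"
  using R
proof (induction R)
  case empty
  show ?case using UC\<^sub>b_const[of 0] by (intro bexI[of _ "\<lambda>x\<in>X. 0"]) auto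
next
  case (insert r R)
  then obtain q where q: "q \<in> UC\<^sub>b X \<D>" "\<forall>x\<in>X. 0 \<le> q x \<and> q x \<le> 1"
      "\<forall>x\<in>X. (\<exists>r\<in>R. \<forall>f\<in>\<Phi>. \<bar>f x - f r\<bar> < d) \<longrightarrow> q x = 1"
      "\<forall>x\<in>X. q x > 0 \<longrightarrow> (\<exists>r\<in>R. \<forall>f\<in>\<Phi>. \<bar>f x - f r\<bar> < 2 * d)"
    by auto
  obtain h where h: "h \<in> UC\<^sub>b X \<D>" "\<forall>x\<in>X. 0 \<le> h x \<and> h x \<le> 1"
      "\<forall>x\<in>X. (\<forall>f\<in>\<Phi>. \<bar>f x - f r\<bar> < d) \<longrightarrow> h x = 1"
      "\<forall>x\<in>X. h x > 0 \<longrightarrow> (\<forall>f\<in>\<Phi>. \<bar>f x - f r\<bar> < 2 * d)"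
    using ex_bump[OF \<Phi> d, of r] insert.prems by auto
  define q' where "q' = (\<lambda>x\<in>X. max (q x) (h x))"
  have "q' \<in> UC\<^sub>b X \<D>"
    by (rule UC\<^sub>b_dominated[OF q(1) h(1), where C = 1]) (auto simp: q'_def)
  moreover have "\<forall>x\<in>X. 0 \<le> q' x \<and> q' x \<le> 1" using q(2) h(2) by (auto simp: q'_def max_def)
  moreover have "q' x = 1" if "x \<in> X" "\<exists>s\<in>insert r R. \<forall>f\<in>\<Phi>. \<bar>f x - f s\<bar> < d" for x
  proof -
    have "q x = 1 \<or> h x = 1" using that q(3) h(3) by blast
    moreover have "q x \<le> 1" "h x \<le> 1" using q(2) h(2) that(1) by auto
    ultimately show ?thesis using that(1) by (auto simp: q'_def)
  qed
  moreover have "\<exists>s\<in>insert r R. \<forall>f\<in>\<Phi>. \<bar>f x - f s\<bar> < 2 * d" if "x \<in> X" "q' x > 0" for x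
  proof -
    have "q x > 0 \<or> h x > 0" using that by (simp add: q'_def less_max_iff_disj)
    then show ?thesis using that(1) q(4) h(4) by blast
  qed
  ultimately show ?case by blast
qed

text \<open>Summing the function \<open>q\<close> that belongs to \<open>S\<close> over a finite set bounds from above the number of
  points in \<open>S\<close>, and from below the number of points related to \<open>S\<close>. This is how sums over a
  separating family give Hall's condition.\<close>

definition separating :: "('a \<Rightarrow> 'a \<Rightarrow> bool) \<Rightarrow> ('a \<Rightarrow> real) set \<Rightarrow> bool"
  where "separating R Q \<longleftrightarrow> (\<forall>q\<in>Q. \<forall>x\<in>X. 0 \<le> q x \<and> q x \<le> 1) \<and>
    (\<forall>S\<subseteq>X. \<exists>q\<in>Q. (\<forall>x\<in>S. q x = 1) \<and> (\<forall>y\<in>X. q y > 0 \<longrightarrow> (\<exists>s\<in>S. R s y)))"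

text \<open>A finite family serves all sets \<open>S\<close> at once because \<open>S\<close> may be replaced by the set of those
  points of a finite net that are close to \<open>S\<close>. The tolerance \<open>d\<close> is spent in three equal parts: one
  between \<open>S\<close> and the net, and two for the decay of the bump.\<close>

lemma ex_finite_separating:
  assumes \<Phi>: "finite \<Phi>" "\<Phi> \<subseteq> UC\<^sub>b X \<D>" and d: "d > 0"
  shows "\<exists>Q. finite Q \<and> Q \<subseteq> UC\<^sub>b X \<D> \<and> separating (near \<Phi> d) Q"
proof -
  obtain R where R: "R \<subseteq> X" "finite R" "\<forall>x\<in>X. \<exists>r\<in>R. \<forall>f\<in>\<Phi>. \<bar>f x - f r\<bar> < d / 3"
    using finite_net[OF \<Phi>, of "d / 3"] d by auto
  define good where "good T q \<longleftrightarrow> q \<in> UC\<^sub>b X \<D> \<and> (\<forall>x\<in>X. 0 \<le> q x \<and> q x \<le> 1) \<and>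
    (\<forall>x\<in>X. (\<exists>r\<in>T. \<forall>f\<in>\<Phi>. \<bar>f x - f r\<bar> < d / 3) \<longrightarrow> q x = 1) \<and>
    (\<forall>x\<in>X. q x > 0 \<longrightarrow> (\<exists>r\<in>T. \<forall>f\<in>\<Phi>. \<bar>f x - f r\<bar> < 2 * (d / 3)))" for T q
  have "\<forall>T. \<exists>q. T \<subseteq> R \<longrightarrow> good T q"
  proof
    fix T
    show "\<exists>q. T \<subseteq> R \<longrightarrow> good T q"
    proof (cases "T \<subseteq> R")
      case True
      then have "finite T" "T \<subseteq> X" using R finite_subset by auto
      then show ?thesis
        using ex_bump_around_set[OF \<Phi>, of "d / 3" T] d unfolding good_def by auto
    qed simp
  qed
  then obtain q where q: "\<And>T. T \<subseteq> R \<Longrightarrow> good T (q T)" by metis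
  define Q where "Q = q ` Pow R"
  have "\<exists>p\<in>Q. (\<forall>x\<in>S. p x = 1) \<and> (\<forall>y\<in>X. p y > 0 \<longrightarrow> (\<exists>s\<in>S. near \<Phi> d s y))" if S: "S \<subseteq> X" for S
  proof -
    define T where "T = {r\<in>R. \<exists>s\<in>S. \<forall>f\<in>\<Phi>. \<bar>f s - f r\<bar> < d / 3}"
    have TR: "T \<subseteq> R" by (auto simp: T_def)
    have good: "good T (q T)" by (rule q[OF TR])
    have "q T x = 1" if x: "x \<in> S" for x
    proof -
      have xX: "x \<in> X" using x S by blast
      then obtain r where r: "r \<in> R" "\<forall>f\<in>\<Phi>. \<bar>f x - f r\<bar> < d / 3" using R(3) by blast
      then have "r \<in> T" using x by (auto simp: T_def)
      then show ?thesis using good xX r(2) unfolding good_def by blast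
    qed
    moreover have "\<exists>s\<in>S. near \<Phi> d s y" if y: "y \<in> X" "q T y > 0" for y
    proof -
      obtain r where r: "r \<in> T" "\<forall>f\<in>\<Phi>. \<bar>f y - f r\<bar> < 2 * (d / 3)"
        using good y unfolding good_def by blast
      then obtain s where s: "s \<in> S" "\<forall>f\<in>\<Phi>. \<bar>f s - f r\<bar> < d / 3" by (auto simp: T_def)
      have "\<bar>f s - f y\<bar> < d" if "f \<in> \<Phi>" for f
        using bspec[OF r(2) that] bspec[OF s(2) that] by linarith
      then show ?thesis using s(1) by (auto simp: near_def)
    qed
    moreover have "q T \<in> Q" using TR by (simp add: Q_def)
    ultimately show ?thesis by blast
  qed
  moreover have "\<forall>p\<in>Q. \<forall>x\<in>X. 0 \<le> p x \<and> p x \<le> 1" using q by (auto simp: Q_def good_def)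
  moreover have "Q \<subseteq> UC\<^sub>b X \<D>" using q by (auto simp: Q_def good_def)
  moreover have "finite Q" using R(2) by (simp add: Q_def)
  ultimately show ?thesis unfolding separating_def by blast
qed

text \<open>The points common to \<open>F\<close> and \<open>H\<close> contribute equally to both sums, so that Hall's
  theorem can be applied to \<open>F - H\<close> and \<open>H - F\<close> alone, and the common points be matched with
  themselves. That matters later: a neighbourhood of \<open>k x\<close> is put into a set attached to \<open>x\<close>
  that must not contain any other point of \<open>F\<close>.\<close>

lemma ex_matching:
  assumes F: "finite F" "F \<subseteq> X" and H: "finite H" "H \<subseteq> X"
    and refl: "\<And>x. x \<in> X \<Longrightarrow> R x x"
    and Q: "separating R Q"
    and sums: "\<And>q. q \<in> Q \<Longrightarrow> \<bar>sum q F - sum q H\<bar> \<le> c"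
  shows "\<exists>F' k. F' \<subseteq> F \<and> inj_on k F' \<and> k ` F' \<subseteq> H \<and> (\<forall>x\<in>F'. R x (k x)) \<and>
    (\<forall>x\<in>F \<inter> H. x \<in> F' \<and> k x = x) \<and> (\<forall>x\<in>F'. k x \<in> F \<longrightarrow> k x = x) \<and> real (card (F - F')) \<le> c"
proof -
  have Q01: "0 \<le> q x" "q x \<le> 1" if "q \<in> Q" "x \<in> X" for q x
    using Q that by (auto simp: separating_def)
  obtain q0 where "q0 \<in> Q" using Q unfolding separating_def by blast
  then have c: "c \<ge> 0" using sums[of q0] by linarith
  have hall: "card S \<le> card {b\<in>H - F. \<exists>s\<in>S. R s b} + nat \<lfloor>c\<rfloor>" if S: "S \<subseteq> F - H" for S
  proof -
    have "S \<subseteq> X" using S F by blast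
    then obtain q where q: "q \<in> Q" "\<forall>x\<in>S. q x = 1" "\<forall>y\<in>X. q y > 0 \<longrightarrow> (\<exists>s\<in>S. R s y)"
      using Q unfolding separating_def by blast
    define N where "N = {b\<in>H - F. \<exists>s\<in>S. R s b}"
    have "real (card S) = sum q S" using q(2) by simp
    also have "\<dots> \<le> sum q (F - H)"
      using S F Q01[OF q(1)] by (intro sum_mono2) auto
    also have "\<dots> = sum q F - sum q (F \<inter> H)"
      using sum.Int_Diff[OF F(1), of q H] by simp
    also have "\<dots> \<le> sum q H - sum q (F \<inter> H) + c" using sums[OF q(1)] by linarith
    also have "sum q H - sum q (F \<inter> H) = sum q (H - F)"
      using sum.Int_Diff[OF H(1), of q F] by (simp add: Int_commute)
    also have "sum q (H - F) = sum q N"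
    proof (rule sum.mono_neutral_right)
      show "\<forall>y\<in>H - F - N. q y = 0"
      proof
        fix y assume y: "y \<in> H - F - N"
        then have "\<not> q y > 0" using q(3) H(2) by (auto simp: N_def)
        moreover have "0 \<le> q y" using Q01[OF q(1)] y H(2) by blast
        ultimately show "q y = 0" by linarith
      qed
    qed (use H in \<open>auto simp: N_def\<close>)
    also have "sum q N \<le> (\<Sum>y\<in>N. 1)"
      using Q01[OF q(1)] H(2) by (intro sum_mono) (auto simp: N_def)
    finally have "real (card S) \<le> real (card N) + c" by simp
    then have "int (card S) - int (card N) \<le> \<lfloor>c\<rfloor>" by (simp add: le_floor_iff)
    then show ?thesis using c by (simp add: N_def)
  qed
  obtain A k where A: "A \<subseteq> F - H" "inj_on k A" "k ` A \<subseteq> H - F" "\<forall>a\<in>A. R a (k a)"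
      "card (F - H - A) \<le> nat \<lfloor>c\<rfloor>"
    using Hall_marriage_deficiency[of "F - H" "H - F" R "nat \<lfloor>c\<rfloor>"] hall F(1) H(1) by auto
  define F' where "F' = A \<union> (F \<inter> H)"
  define k' where "k' x = (if x \<in> H then x else k x)" for x
  have kA: "k' x = k x \<and> k x \<in> H - F" if "x \<in> A" for x
    using A(1,3) that by (auto simp: k'_def)
  have kH: "k' x = x" if "x \<in> H" for x using that by (simp add: k'_def)
  have "inj_on k' F'"
  proof (rule inj_onI)
    fix x y assume "x \<in> F'" "y \<in> F'" and eq: "k' x = k' y"
    then consider "x \<in> A" "y \<in> A" | "x \<in> A" "y \<in> F \<inter> H" | "x \<in> F \<inter> H" "y \<in> A"
      | "x \<in> F \<inter> H" "y \<in> F \<inter> H"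
      by (auto simp: F'_def)
    then show "x = y"
    proof cases
      case 1
      then show ?thesis using eq kA A(2) by (metis inj_onD)
    next
      case 2
      then show ?thesis using eq kA[of x] kH[of y] by auto
    next
      case 3
      then show ?thesis using eq kA[of y] kH[of x] by auto
    next
      case 4
      then show ?thesis using eq kH by auto
    qed
  qed
  moreover have "F' \<subseteq> F" using A(1) by (auto simp: F'_def)
  moreover have "k' ` F' \<subseteq> H" using kA kH by (auto simp: F'_def)
  moreover have "\<forall>x\<in>F'. R x (k' x)" using kA kH A(4) refl F(2) by (auto simp: F'_def)
  moreover have "\<forall>x\<in>F \<inter> H. x \<in> F' \<and> k' x = x" using kH by (auto simp: F'_def)
  moreover have "\<forall>x\<in>F'. k' x \<in> F \<longrightarrow> k' x = x"
  proof (intro ballI impI)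
    fix x assume "x \<in> F'" "k' x \<in> F"
    then show "k' x = x" using kA[of x] kH[of x] by (auto simp: F'_def)
  qed
  moreover have "real (card (F - F')) \<le> c"
  proof -
    have "F - F' = F - H - A" by (auto simp: F'_def)
    then have "real (card (F - F')) \<le> real (nat \<lfloor>c\<rfloor>)" using A(5) by simp
    then show ?thesis using c by linarith
  qed
  ultimately show ?thesis by blast
qed

section \<open>Almost invariant sets of points\<close>

lemma mean_linear_combination:
  assumes m: "mean X \<D> m" and \<Psi>: "finite \<Psi>" "\<Psi> \<subseteq> UC\<^sub>b X \<D>"
  shows "(\<lambda>x\<in>X. \<Sum>\<psi>\<in>\<Psi>. c \<psi> * \<psi> x) \<in> UC\<^sub>b X \<D> \<and>
    m (\<lambda>x\<in>X. \<Sum>\<psi>\<in>\<Psi>. c \<psi> * \<psi> x) = (\<Sum>\<psi>\<in>\<Psi>. c \<psi> * m \<psi>)"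
  using \<Psi>
proof (induction \<Psi>)
  case empty
  have "m (\<lambda>x\<in>X. 0 * (\<lambda>x\<in>X. 0) x) = 0 * m (\<lambda>x\<in>X. 0)"
    using m UC\<^sub>b_const[of 0] unfolding mean_def by blast
  moreover have "(\<lambda>x\<in>X. 0 * (\<lambda>x\<in>X. 0) x) = (\<lambda>x\<in>X. 0 :: real)" by auto
  ultimately have "m (\<lambda>x\<in>X. 0) = 0" by simp
  then show ?case unfolding sum.empty using UC\<^sub>b_const[of 0] by blast
next
  case (insert \<psi> \<Psi>)
  let ?f = "\<lambda>x\<in>X. \<Sum>\<psi>\<in>\<Psi>. c \<psi> * \<psi> x"
  let ?g = "\<lambda>x\<in>X. c \<psi> * \<psi> x"
  have IH: "?f \<in> UC\<^sub>b X \<D>" "m ?f = (\<Sum>\<psi>\<in>\<Psi>. c \<psi> * m \<psi>)"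
    using insert.IH insert.prems by blast+
  have psi: "\<psi> \<in> UC\<^sub>b X \<D>" using insert.prems by simp
  have g: "?g \<in> UC\<^sub>b X \<D>" "m ?g = c \<psi> * m \<psi>"
    using UC\<^sub>b_cmult[OF psi] m psi unfolding mean_def by blast+
  have eq: "(\<lambda>x\<in>X. \<Sum>\<psi>\<in>insert \<psi> \<Psi>. c \<psi> * \<psi> x) = (\<lambda>x\<in>X. ?g x + ?f x)"
    by (rule restrict_ext) (use insert.hyps in simp)
  have "m (\<lambda>x\<in>X. ?g x + ?f x) = m ?g + m ?f" using m g(1) IH(1) unfolding mean_def by blast
  then have "m (\<lambda>x\<in>X. ?g x + ?f x) = (\<Sum>\<psi>\<in>insert \<psi> \<Psi>. c \<psi> * m \<psi>)"
    by (simp only: g(2) IH(2) sum.insert[OF insert.hyps])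
  then show ?case unfolding eq using UC\<^sub>b_add[OF g(1) IH(1)] by blast
qed

end

text \<open>In such a space all stars of points are infinite, which leaves room to choose new points.\<close>

locale perfect_Hausdorff = uniform_covers +
  assumes perfect: "no_isolated_points (cover_topology X \<D>)"
    and Hausdorff: "Hausdorff_space (cover_topology X \<D>)"
begin

lemma separate_points:
  assumes "x \<in> X" "y \<in> X" "x \<noteq> y"
  shows "\<exists>\<W>\<in>\<D>. y \<notin> St {x} \<W>"
proof -
  have "x \<in> topspace (cover_topology X \<D>) \<and> y \<in> topspace (cover_topology X \<D>) \<and> x \<noteq> y"
    using assms by (simp add: topspace_cover_topology[OF uniformity])
  then have "\<exists>U V. openin (cover_topology X \<D>) U \<and> openin (cover_topology X \<D>) V \<and>
      x \<in> U \<and> y \<in> V \<and> disjnt U V"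
    by (rule Hausdorff[unfolded Hausdorff_space_def, rule_format])
  then obtain U V where U: "openin (cover_topology X \<D>) U" "x \<in> U" and V: "y \<in> V" "disjnt U V"
    by (elim exE conjE)
  then obtain \<W> where "\<W> \<in> \<D>" "St {x} \<W> \<subseteq> U"
    by (auto simp: openin_cover_topology[OF uniformity])
  then show ?thesis using V by (auto simp: disjnt_iff)
qed

lemma separate_finite_set:
  assumes "finite Z" "Z \<subseteq> X"
  shows "\<exists>\<W>\<in>\<D>. \<forall>A\<in>\<W>. \<forall>x\<in>Z. \<forall>y\<in>Z. x \<in> A \<longrightarrow> y \<in> A \<longrightarrow> x = y"
proof -
  define P where "P = {p\<in>Z \<times> Z. fst p \<noteq> snd p}"
  have "\<forall>p\<in>P. \<exists>\<W>. \<W> \<in> \<D> \<and> snd p \<notin> St {fst p} \<W>"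
    using assms(2) separate_points unfolding P_def by fastforce
  then obtain w where w: "\<And>p. p \<in> P \<Longrightarrow> w p \<in> \<D> \<and> snd p \<notin> St {fst p} (w p)" by metis
  have "finite P" using assms(1) by (simp add: P_def)
  then obtain \<W> where W: "\<W> \<in> \<D>" "\<forall>\<U>\<in>w ` P. \<U> \<preceq> \<W>"
    using ex_common_refinement[of "w ` P"] w by blast
  have "x = y" if A: "A \<in> \<W>" "x \<in> Z" "y \<in> Z" "x \<in> A" "y \<in> A" for A x y
  proof (rule ccontr)
    assume "x \<noteq> y"
    then have p: "(x, y) \<in> P" using A by (simp add: P_def)
    then have "w (x, y) \<preceq> \<W>" using W(2) by blast
    then obtain B where "B \<in> w (x, y)" "A \<subseteq> B" using refined_byD A(1) by meson
    then have "y \<in> St {x} (w (x, y))" using A by (auto simp: St_def)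
    then show False using w[OF p] by simp
  qed
  then show ?thesis using W(1) by blast
qed

lemma infinite_St:
  assumes W: "\<W> \<in> \<D>" and x: "x \<in> X"
  shows "infinite (St {x} \<W>)"
proof
  assume fin: "finite (St {x} \<W>)"
  have "St {x} \<W> \<subseteq> X" using member_subset[OF W] by (auto simp: St_def)
  then obtain \<V> where V: "\<V> \<in> \<D>" "\<forall>A\<in>\<V>. \<forall>y\<in>St {x} \<W>. \<forall>z\<in>St {x} \<W>. y \<in> A \<longrightarrow> z \<in> A \<longrightarrow> y = z"
    using separate_finite_set[OF fin] by blast
  obtain \<R> where R: "\<R> \<in> \<D>" "\<W> \<preceq> \<R>" "\<V> \<preceq> \<R>" using ex_refinement2[OF W V(1)] by blast
  have "St {x} \<R> \<subseteq> {x}"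
  proof
    fix y assume "y \<in> St {x} \<R>"
    then obtain A where A: "A \<in> \<R>" "x \<in> A" "y \<in> A" by (auto simp: mem_St_point)
    obtain B where B: "B \<in> \<W>" "A \<subseteq> B" using refined_byD[OF R(2) A(1)] by blast
    obtain C where C: "C \<in> \<V>" "A \<subseteq> C" using refined_byD[OF R(3) A(1)] by blast
    have "x \<in> St {x} \<W>" "y \<in> St {x} \<W>" using A B by (auto simp: mem_St_point)
    moreover have "x \<in> C" "y \<in> C" using A C by auto
    ultimately show "y \<in> {x}" using bspec[OF V(2) C(1)] by blast
  qed
  then have "openin (cover_topology X \<D>) {x}"
    using x R(1) by (auto simp: openin_cover_topology[OF uniformity])
  then show False
    using perfect x topspace_cover_topology[OF uniformity] by (simp add: no_isolated_points_def)
qed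

lemma infinite_below_1:
  assumes m: "mean X \<D> m" and f: "f \<in> UC\<^sub>b X \<D>" "m f = 0"
  shows "infinite {x\<in>X. f x < 1}"
proof -
  have "(INF x\<in>X. f x) \<le> 0" using m f unfolding mean_def by fastforce
  then have "(INF x\<in>X. f x) < 1" by linarith
  then obtain x where x: "x \<in> X" "f x < 1"
    using cINF_less_iff[OF X_nonempty UC\<^sub>b_bdd(1)[OF f(1)]] by blast
  obtain \<W> where W: "\<W> \<in> \<D>" "osc_less f \<W> (1 - f x)"
    using UC\<^sub>b_osc[OF f(1), of "1 - f x"] x(2) by auto
  have "St {x} \<W> \<subseteq> {x\<in>X. f x < 1}"
  proof
    fix y assume "y \<in> St {x} \<W>"
    then obtain A where A: "A \<in> \<W>" "x \<in> A" "y \<in> A" by (auto simp: mem_St_point)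
    then have "\<bar>f x - f y\<bar> < 1 - f x" "y \<in> X"
      using osc_lessD[OF W(2)] member_subset[OF W(1)] by blast+
    then show "y \<in> {x\<in>X. f x < 1}" by auto
  qed
  then show ?thesis using infinite_St[OF W(1) x(1)] finite_subset by blast
qed

text \<open>Regard \<open>x \<mapsto> (\<psi> x)\<^bsub>\<psi> \<in> \<Psi>\<^esub>\<close> as a map into Euclidean space, and let \<open>s\<close> be the sum of its values over
  the points chosen so far. The inner product of \<open>s\<close> with the map is a combination of members of \<open>\<Psi>\<close>
  and has mean \<open>0\<close>, hence takes a value below \<open>1\<close> at infinitely many points. Adding such a point increases the
  squared norm of \<open>s\<close> by a bounded amount only. This replaces the usual separation argument,
  and it produces distinct points with equal weights.\<close>

lemma greedy_points:
  assumes m: "mean X \<D> m" and \<Psi>: "finite \<Psi>" "\<Psi> \<subseteq> UC\<^sub>b X \<D>" "\<And>\<psi>. \<psi> \<in> \<Psi> \<Longrightarrow> m \<psi> = 0"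
  shows "\<exists>C\<ge>0. \<forall>n. \<exists>F\<subseteq>X. finite F \<and> card F = n \<and> (\<Sum>\<psi>\<in>\<Psi>. (sum \<psi> F)\<^sup>2) \<le> C * real n"
proof -
  obtain K where K: "K \<ge> 0" "\<forall>\<psi>\<in>\<Psi>. \<forall>x\<in>X. \<bar>\<psi> x\<bar> \<le> K" using UC\<^sub>b_common_bound[OF \<Psi>(1,2)] by blast
  define C where "C = 2 + real (card \<Psi>) * K\<^sup>2"
  have "\<exists>F\<subseteq>X. finite F \<and> card F = n \<and> (\<Sum>\<psi>\<in>\<Psi>. (sum \<psi> F)\<^sup>2) \<le> C * real n" for n
  proof (induction n)
    case 0
    then show ?case by (intro exI[of _ "{}"]) simp
  next
    case (Suc n)
    then obtain F where F: "F \<subseteq> X" "finite F" "card F = n" "(\<Sum>\<psi>\<in>\<Psi>. (sum \<psi> F)\<^sup>2) \<le> C * real n"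
      by blast
    define f where "f = (\<lambda>x\<in>X. \<Sum>\<psi>\<in>\<Psi>. sum \<psi> F * \<psi> x)"
    have "f \<in> UC\<^sub>b X \<D>" "m f = 0"
      using mean_linear_combination[OF m \<Psi>(1,2), of "\<lambda>\<psi>. sum \<psi> F"] \<Psi>(3) by (simp_all add: f_def)
    then have "infinite ({x\<in>X. f x < 1} - F)" using infinite_below_1[OF m] F(2) by simp
    then obtain x where "x \<in> {x\<in>X. f x < 1} - F" by (metis finite.emptyI all_not_in_conv)
    then have x: "x \<in> X" "f x < 1" "x \<notin> F" by auto
    have "(\<Sum>\<psi>\<in>\<Psi>. (sum \<psi> (insert x F))\<^sup>2) = (\<Sum>\<psi>\<in>\<Psi>. (sum \<psi> F)\<^sup>2 + 2 * (sum \<psi> F * \<psi> x) + (\<psi> x)\<^sup>2)"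
      using F(2) x(3) by (intro sum.cong) (auto simp: power2_eq_square algebra_simps)
    also have "\<dots> = (\<Sum>\<psi>\<in>\<Psi>. (sum \<psi> F)\<^sup>2) + 2 * f x + (\<Sum>\<psi>\<in>\<Psi>. (\<psi> x)\<^sup>2)"
      using x(1) by (simp add: sum.distrib f_def sum_distrib_left)
    also have "(\<Sum>\<psi>\<in>\<Psi>. (\<psi> x)\<^sup>2) \<le> (\<Sum>\<psi>\<in>\<Psi>. K\<^sup>2)"
    proof (rule sum_mono)
      fix \<psi> assume "\<psi> \<in> \<Psi>"
      then have "\<bar>\<psi> x\<bar> \<le> \<bar>K\<bar>" using K x(1) by force
      then show "(\<psi> x)\<^sup>2 \<le> K\<^sup>2" by (simp only: abs_le_square_iff)
    qed
    finally have "(\<Sum>\<psi>\<in>\<Psi>. (sum \<psi> (insert x F))\<^sup>2) \<le> C * real n + 2 + real (card \<Psi>) * K\<^sup>2"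
      using F(4) x(2) by simp
    also have "\<dots> = C * real (Suc n)" by (simp add: C_def algebra_simps)
    finally show ?case using F x by (intro exI[of _ "insert x F"]) auto
  qed
  moreover have "C \<ge> 0" by (simp add: C_def)
  ultimately show ?thesis by blast
qed

lemma ex_small_sums:
  assumes m: "mean X \<D> m" and \<Psi>: "finite \<Psi>" "\<Psi> \<subseteq> UC\<^sub>b X \<D>" "\<And>\<psi>. \<psi> \<in> \<Psi> \<Longrightarrow> m \<psi> = 0" and e: "e > 0"
  shows "\<exists>F\<subseteq>X. finite F \<and> N \<le> card F \<and> (\<forall>\<psi>\<in>\<Psi>. \<bar>sum \<psi> F\<bar> \<le> e * real (card F))"
proof -
  obtain C where C: "C \<ge> 0"
    "\<And>n. \<exists>F\<subseteq>X. finite F \<and> card F = n \<and> (\<Sum>\<psi>\<in>\<Psi>. (sum \<psi> F)\<^sup>2) \<le> C * real n"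
    using greedy_points[OF m \<Psi>] by blast
  define n where "n = max N (nat \<lceil>C / e\<^sup>2\<rceil>)"
  obtain F where F: "F \<subseteq> X" "finite F" "card F = n" "(\<Sum>\<psi>\<in>\<Psi>. (sum \<psi> F)\<^sup>2) \<le> C * real n"
    using C(2) by blast
  have "C / e\<^sup>2 \<le> real n" unfolding n_def by linarith
  then have "C \<le> e\<^sup>2 * real n" using e by (simp add: pos_divide_le_eq mult.commute)
  then have Cn: "C * real n \<le> (e * real n)\<^sup>2"
    using mult_right_mono[of C "e\<^sup>2 * real n" "real n"] by (simp add: power2_eq_square algebra_simps)
  have "\<bar>sum \<psi> F\<bar> \<le> e * real (card F)" if "\<psi> \<in> \<Psi>" for \<psi>
  proof -
    have "(sum \<psi> F)\<^sup>2 \<le> (\<Sum>\<psi>\<in>\<Psi>. (sum \<psi> F)\<^sup>2)" using \<Psi>(1) that by (intro member_le_sum) auto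
    then have "(sum \<psi> F)\<^sup>2 \<le> (e * real n)\<^sup>2" using F(4) Cn by linarith
    then have "\<bar>sum \<psi> F\<bar> \<le> \<bar>e * real n\<bar>" by (simp only: abs_le_square_iff)
    then show ?thesis using e F(3) by simp
  qed
  then show ?thesis using F by (intro exI[of _ F]) (auto simp: n_def)
qed

end

section \<open>Amenability implies complexity one\<close>

context dynamics
begin

lemma ex_inverse_in_G:
  assumes g: "g \<in> G"
  shows "\<exists>h\<in>G. \<forall>x\<in>X. h (g x) = x \<and> g (h x) = x"
proof -
  interpret A: group "Aut X \<D>" by (rule group_Aut[OF cover_uniform_space])
  let ?h = "inv\<^bsub>Aut X \<D>\<^esub> g"
  have h: "?h \<in> G" using subgroup.m_inv_closed[OF subgroup_G g] .
  have gc: "g \<in> carrier (Aut X \<D>)" using G_automorphism[OF g] by (simp add: Aut_def)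
  have B: "g \<in> Bij X" "?h \<in> Bij X"
    using G_automorphism[OF g] G_automorphism[OF h] by (auto simp: uniform_automorphisms_def)
  have "compose X ?h g = (\<lambda>x\<in>X. x)" "compose X g ?h = (\<lambda>x\<in>X. x)"
    using A.l_inv[OF gc] A.r_inv[OF gc] B by (simp_all add: Aut_def BijGroup_def)
  then have "?h (g x) = x \<and> g (?h x) = x" if "x \<in> X" for x
    using that by (metis compose_eq restrict_apply')
  then show ?thesis using h by blast
qed

text \<open>The complexity is monotone, and \<open>\<V> \<or> g \<V>\<close> refines \<open>\<V>\<close>. The identity is used because the supremum over
  the empty set of automorphisms is \<open>-\<infinity>\<close>.\<close>

lemma complexity_ge_1: "asymptotic_uniform_complexity \<D> G \<ge> 1"
proof -
  let ?r = "\<lambda>\<V> g. ereal (real (uniform_complexity \<D> (\<V> \<squnion>\<^sub>c (`) g ` \<V>)) / real (uniform_complexity \<D> \<V>))"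
  let ?id = "\<lambda>x\<in>X. x"
  have "1 \<le> ?r \<V> ?id" if V: "\<V> \<in> \<N> \<D>" for \<V>
  proof -
    let ?J = "\<V> \<squnion>\<^sub>c (`) ?id ` \<V>"
    obtain \<P> where P: "\<P> \<in> \<N> \<D>" "?J \<preceq> \<P>" "card \<P> = uniform_complexity \<D> ?J"
      using ex_minimal_refinement[OF join_finite_uniform[OF V image_finite_uniform[OF identity_in_G V]]]
      by blast
    have "uniform_complexity \<D> \<V> \<le> uniform_complexity \<D> ?J"
      using uniform_complexity_le[OF P(1) refined_by_trans[OF refined_by_join(1) P(2)]] P(3) by simp
    then show ?thesis using uniform_complexity_pos[OF V] by (simp add: one_ereal_def)
  qed
  then have "1 \<le> (INF \<V>\<in>{\<V> \<in> \<N> \<D>. {X} \<preceq> \<V>}. SUP g\<in>{?id}. ?r \<V> g)"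
    by (intro INF_greatest) simp
  also have "\<dots> \<le> (SUP \<U>\<in>\<N> \<D>. INF \<V>\<in>{\<V> \<in> \<N> \<D>. \<U> \<preceq> \<V>}. SUP g\<in>{?id}. ?r \<V> g)"
    by (rule SUP_upper) (simp add: finite_uniform_coverings_def trivial_uniform_covering)
  also have "\<dots> \<le> asymptotic_uniform_complexity \<D> G"
    unfolding asymptotic_uniform_complexity_def
    by (rule SUP_upper) (use identity_in_G in \<open>unfold Fpow_def, blast\<close>)
  finally show ?thesis .
qed

end

locale perfect_dynamics = dynamics + perfect_Hausdorff X \<D>
begin

text \<open>Invariance of the mean says that it vanishes on the functions \<open>q - q \<circ> g\<close>.\<close>

lemma ex_Folner_set:
  assumes m: "mean X \<D> m" and inv: "\<And>f g. f \<in> UC\<^sub>b X \<D> \<Longrightarrow> g \<in> G \<Longrightarrow> m (compose X f g) = m f"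
    and Q: "finite Q" "Q \<subseteq> UC\<^sub>b X \<D>" and E: "finite E" "E \<subseteq> G" and e: "e > 0"
  shows "\<exists>F\<subseteq>X. finite F \<and> N \<le> card F \<and>
    (\<forall>q\<in>Q. \<forall>g\<in>E. \<bar>sum q F - sum q (g ` F)\<bar> \<le> e * real (card F))"
proof -
  define \<psi> where "\<psi> q g = (\<lambda>x\<in>X. q x + (\<lambda>x\<in>X. (- 1) * compose X q g x) x)" for q :: "'a \<Rightarrow> real" and g
  define \<Psi> where "\<Psi> = (\<lambda>(q, g). \<psi> q g) ` (Q \<times> E)"
  have \<psi>: "\<psi> q g \<in> UC\<^sub>b X \<D> \<and> m (\<psi> q g) = 0" if "q \<in> Q" "g \<in> E" for q g
  proof -
    have q: "q \<in> UC\<^sub>b X \<D>" and g: "g \<in> G" using that Q E by auto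
    note c = compose_UC\<^sub>b[OF g q]
    note c' = UC\<^sub>b_cmult[OF c, of "- 1"]
    have "m (\<psi> q g) = m q + m (\<lambda>x\<in>X. (- 1) * compose X q g x)"
      unfolding \<psi>_def using m q c' unfolding mean_def by blast
    moreover have "m (\<lambda>x\<in>X. (- 1) * compose X q g x) = (- 1) * m (compose X q g)"
      using m c unfolding mean_def by blast
    ultimately have "m (\<psi> q g) = 0" using inv[OF q g] by linarith
    moreover have "\<psi> q g \<in> UC\<^sub>b X \<D>" unfolding \<psi>_def by (rule UC\<^sub>b_add[OF q c'])
    ultimately show ?thesis by blast
  qed
  have "finite \<Psi>" using Q(1) E(1) by (simp add: \<Psi>_def)
  moreover have "\<Psi> \<subseteq> UC\<^sub>b X \<D>" "\<And>p. p \<in> \<Psi> \<Longrightarrow> m p = 0" using \<psi> by (auto simp: \<Psi>_def)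
  ultimately obtain F where F: "F \<subseteq> X" "finite F" "N \<le> card F"
      "\<forall>p\<in>\<Psi>. \<bar>sum p F\<bar> \<le> e * real (card F)"
    using ex_small_sums[OF m _ _ _ e, of \<Psi> N] by blast
  have "\<bar>sum q F - sum q (g ` F)\<bar> \<le> e * real (card F)" if "q \<in> Q" "g \<in> E" for q g
  proof -
    have g: "g \<in> G" using that E by auto
    have "sum (\<psi> q g) F = (\<Sum>x\<in>F. q x - q (g x))"
      using F(1) by (intro sum.cong) (auto simp: \<psi>_def compose_def)
    also have "\<dots> = sum q F - sum q (g ` F)"
      using sum.reindex[OF inj_on_subset[OF inj[OF g] F(1)], of q] by (simp add: sum_subtractf)
    finally have "sum (\<psi> q g) F = sum q F - sum q (g ` F)" .
    moreover have "\<psi> q g \<in> \<Psi>" using that by (auto simp: \<Psi>_def)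
    ultimately show ?thesis using F(4) by metis
  qed
  then show ?thesis using F by blast
qed

text \<open>The functions \<open>f A\<close> are subordinate to \<open>\<U>\<close> as in \<open>subordinate_functions\<close>, \<open>\<iota> g\<close> is the inverse of \<open>g\<close>,
  and \<open>k g\<close> matches the part \<open>F' g\<close> of \<open>F\<close> with points of \<open>g F\<close>. Two points that are matched are close both for the
  functions \<open>f A\<close> and for the functions \<open>f A \<circ> g\<^sup>-\<^sup>1\<close>.

  For \<open>x \<in> F\<close> let \<open>Z x\<close> consist of \<open>x\<close>, its partners \<open>k g x\<close>, and the points \<open>g\<^sup>-\<^sup>1 z\<close> for
  which \<open>z\<close> is matched with \<open>g x\<close>. For a pair \<open>k g x = g y\<close> this puts both \<open>x\<close> and \<open>g y\<close> into
  \<open>Z x\<close> as well as into \<open>g (Z y)\<close>. So if \<open>V x\<close> is a small neighbourhood of \<open>Z x\<close>, then the single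
  set \<open>V x \<inter> g (V y)\<close> takes care of the points near \<open>x\<close> and of those near \<open>g y\<close>. An unmatched point
  of \<open>F\<close> or of \<open>g F\<close> costs at most \<open>card \<U>\<close> sets, and the points away from \<open>F\<close> and \<open>g F\<close> need at
  most \<open>(card \<U>)\<^sup>2\<close> sets.\<close>

lemma ex_almost_invariant_covering:
  fixes F' :: "('a \<Rightarrow> 'a) \<Rightarrow> 'a set" and k :: "('a \<Rightarrow> 'a) \<Rightarrow> 'a \<Rightarrow> 'a"
  assumes U: "\<U> \<in> \<N> \<D>"
    and f: "\<And>A. A \<in> \<U> \<Longrightarrow> f A \<in> UC\<^sub>b X \<D>" "\<And>A x. A \<in> \<U> \<Longrightarrow> x \<in> X \<Longrightarrow> f A x < 1 \<Longrightarrow> x \<in> A"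
      "\<And>x. x \<in> X \<Longrightarrow> \<exists>A\<in>\<U>. f A x = 0"
    and E: "finite E" "E \<subseteq> G"
    and \<iota>: "\<And>g x. g \<in> E \<Longrightarrow> x \<in> X \<Longrightarrow> \<iota> g x \<in> X \<and> \<iota> g (g x) = x \<and> g (\<iota> g x) = x"
    and F: "finite F" "F \<subseteq> X"
    and F': "\<And>g. g \<in> E \<Longrightarrow> F' g \<subseteq> F"
    and k: "\<And>g. g \<in> E \<Longrightarrow> inj_on (k g) (F' g)" "\<And>g. g \<in> E \<Longrightarrow> k g ` F' g \<subseteq> g ` F"
    and k_id: "\<And>g x. g \<in> E \<Longrightarrow> x \<in> F \<Longrightarrow> x \<in> g ` F \<Longrightarrow> x \<in> F' g \<and> k g x = x"
      "\<And>g x. g \<in> E \<Longrightarrow> x \<in> F' g \<Longrightarrow> k g x \<in> F \<Longrightarrow> k g x = x"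
    and near1: "\<And>g x A. g \<in> E \<Longrightarrow> x \<in> F' g \<Longrightarrow> A \<in> \<U> \<Longrightarrow> \<bar>f A x - f A (k g x)\<bar> < 1 / 2"
    and near2: "\<And>g x A. g \<in> E \<Longrightarrow> x \<in> F' g \<Longrightarrow> A \<in> \<U> \<Longrightarrow> \<bar>f A (\<iota> g x) - f A (\<iota> g (k g x))\<bar> < 1 / 2"
  shows "\<exists>\<V>\<in>\<N> \<D>. \<U> \<preceq> \<V> \<and> card F \<le> uniform_complexity \<D> \<V> \<and>
    (\<forall>g\<in>E. uniform_complexity \<D> (\<V> \<squnion>\<^sub>c (`) g ` \<V>)
       \<le> card F + card \<U> * card \<U> + 2 * card \<U> * card (F - F' g))"
proof -
  have UD: "\<U> \<in> \<D>" and finU: "finite \<U>" using U by (auto simp: finite_uniform_coverings_def)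
  have mt: "g x \<in> X" if "g \<in> E" "x \<in> X" for g x using maps_to E(2) that by blast
  define Z where "Z x = {x} \<union> (\<lambda>g. k g x) ` {g\<in>E. x \<in> F' g} \<union>
    (\<lambda>(g, z). \<iota> g z) ` {(g, z). g \<in> E \<and> z \<in> F' g \<and> k g z = g x}" for x
  have Z_cases: "p = x \<or> (\<exists>g\<in>E. x \<in> F' g \<and> p = k g x) \<or>
      (\<exists>g\<in>E. \<exists>z\<in>F' g. k g z = g x \<and> p = \<iota> g z)" if "p \<in> Z x" for p x
    using that by (auto simp: Z_def)
  have Z_self: "x \<in> Z x" for x by (simp add: Z_def)
  have Z_k: "k g x \<in> Z x" if "g \<in> E" "x \<in> F' g" for g x using that by (auto simp: Z_def)
  have Z_\<iota>: "\<iota> g z \<in> Z x" if "g \<in> E" "z \<in> F' g" "k g z = g x" for g x z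
    using that by (force simp: Z_def)
  have F'X: "x \<in> X" if "g \<in> E" "x \<in> F' g" for g x using that F' F(2) by blast
  have kX: "k g x \<in> X" if "g \<in> E" "x \<in> F' g" for g x
  proof -
    have "k g x \<in> g ` F" using k(2)[OF that(1)] that(2) by blast
    moreover have "g ` F \<subseteq> X" using mt[OF that(1)] F(2) by auto
    ultimately show ?thesis by (rule subsetD[rotated])
  qed
  have \<iota>X: "\<iota> g x \<in> X" "\<iota> g (g x) = x" "g (\<iota> g x) = x" if "g \<in> E" "x \<in> X" for g x
    using \<iota>[OF that] by simp_all
  have ZX: "Z x \<subseteq> X" if x: "x \<in> F" for x
  proof
    fix p assume "p \<in> Z x"
    from Z_cases[OF this] show "p \<in> X"
    proof (elim disjE bexE conjE)
      show "p \<in> X" if "p = x" using that x F(2) by blast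
      show "p \<in> X" if "g \<in> E" "x \<in> F' g" "p = k g x" for g using that kX by simp
      show "p \<in> X" if "g \<in> E" "z \<in> F' g" "p = \<iota> g z" for g z using that F'X \<iota>X(1) by simp
    qed
  qed
  have Z_F: "p = x" if x: "x \<in> F" and p: "p \<in> Z x" "p \<in> F" for x p
    using Z_cases[OF p(1)]
  proof (elim disjE bexE conjE)
    fix g assume "g \<in> E" "x \<in> F' g" "p = k g x"
    then show ?thesis using k_id(2) p(2) by simp
  next
    fix g z assume g: "g \<in> E" and z: "z \<in> F' g" "k g z = g x" "p = \<iota> g z"
    have "z = g p" using \<iota>X(3)[OF g F'X[OF g z(1)]] z(3) by simp
    then have "z \<in> g ` F" using p(2) by blast
    then have "k g z = z" using k_id(1)[OF g] F'[OF g] z(1) by blast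
    then have "g x = z" using z(2) by simp
    moreover have "\<iota> g (g x) = x" using \<iota>X(2)[OF g] F(2) x by blast
    ultimately show "p = x" using z(3) by simp
  qed
  have Z_near: "\<bar>f A x - f A p\<bar> < 1 / 2" if x: "x \<in> F" and p: "p \<in> Z x" and A: "A \<in> \<U>" for x p A
    using Z_cases[OF p]
  proof (elim disjE bexE conjE)
    fix g assume "g \<in> E" "x \<in> F' g" "p = k g x"
    then show ?thesis using near1 A by simp
  next
    fix g z assume g: "g \<in> E" and z: "z \<in> F' g" "k g z = g x" "p = \<iota> g z"
    have "\<iota> g (g x) = x" using \<iota>X(2)[OF g] F(2) x by blast
    then show ?thesis using near2[OF g z(1) A] z(2,3) by (simp add: abs_minus_commute)
  qed simp
  \<comment> \<open>The neighbourhoods are taken with respect to a covering \<open>\<W>\<close> that refines \<open>\<U>\<close>, each member of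
    which contains at most one of these finitely many points, and on each member of which every \<open>f A\<close>
    varies by less than \<open>1/2\<close>.\<close>
  define ZZ where "ZZ = \<Union> (Z ` F) \<union> (\<Union>g\<in>E. g ` F)"
  have finZ: "finite (Z x)" for x
  proof -
    have "{(g, z). g \<in> E \<and> z \<in> F' g \<and> k g z = g x} \<subseteq> E \<times> F" using F' by auto
    then have "finite {(g, z). g \<in> E \<and> z \<in> F' g \<and> k g z = g x}"
      using E(1) F(1) finite_subset by blast
    then show ?thesis using E(1) by (simp add: Z_def)
  qed
  have finZZ: "finite ZZ" using finZ F(1) E(1) by (simp add: ZZ_def)
  have ZZX: "ZZ \<subseteq> X" using ZX mt F(2) by (auto simp: ZZ_def)
  obtain \<W>1 where W1: "\<W>1 \<in> \<D>"
      "\<forall>A\<in>\<W>1. \<forall>x\<in>ZZ. \<forall>y\<in>ZZ. x \<in> A \<longrightarrow> y \<in> A \<longrightarrow> x = y"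
    using separate_finite_set[OF finZZ ZZX] by (elim bexE)
  have "finite (f ` \<U>)" "f ` \<U> \<subseteq> UC\<^sub>b X \<D>" using finU f(1) by auto
  then obtain \<W>2 where W2: "\<W>2 \<in> \<D>" "\<forall>h\<in>f ` \<U>. osc_less h \<W>2 (1 / 2)"
    using UC\<^sub>b_common_osc[of "f ` \<U>" "1 / 2"] by auto
  obtain \<W> where W: "\<W> \<in> \<D>" "\<forall>\<Y>\<in>{\<U>, \<W>1, \<W>2}. \<Y> \<preceq> \<W>"
    using ex_common_refinement[of "{\<U>, \<W>1, \<W>2}"] UD W1(1) W2(1) by auto
  have WU: "\<exists>A\<in>\<U>. B \<subseteq> A" if "B \<in> \<W>" for B using W(2) that refined_byD by blast
  have sep: "x = y" if B: "B \<in> \<W>" "x \<in> ZZ" "y \<in> ZZ" "x \<in> B" "y \<in> B" for B x y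
  proof -
    obtain A where "A \<in> \<W>1" "B \<subseteq> A" using W(2) B(1) refined_byD[of \<W>1 \<W> B] by auto
    then show ?thesis using W1(2) B(2-) by blast
  qed
  have osc: "\<bar>f A x - f A y\<bar> < 1 / 2" if "A \<in> \<U>" "B \<in> \<W>" "x \<in> B" "y \<in> B" for A B x y
  proof -
    have "osc_less (f A) \<W>2 (1 / 2)" using W2(2) that(1) by blast
    moreover have "\<W>2 \<preceq> \<W>" using W(2) by simp
    ultimately have "osc_less (f A) \<W> (1 / 2)" by (rule osc_less_refined)
    then show ?thesis using that(2-) by (rule osc_lessD)
  qed
  have WX: "B \<subseteq> X" if "B \<in> \<W>" for B using member_subset[OF W(1) that] .
  define V where "V x = (\<Union>p\<in>Z x. St {p} \<W>)" for x
  have V_sup: "B \<subseteq> V x" if "B \<in> \<W>" "p \<in> B" "p \<in> Z x" for B p x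
  proof -
    have "B \<subseteq> St {p} \<W>" using that(1,2) by (auto simp: St_def)
    also have "St {p} \<W> \<subseteq> V x" using that(3) unfolding V_def by (rule UN_upper)
    finally show ?thesis .
  qed
  have VE: "\<exists>p\<in>Z x. \<exists>B\<in>\<W>. p \<in> B \<and> y \<in> B" if "y \<in> V x" for x y
    using that by (auto simp: V_def mem_St_point)
  have VX: "V x \<subseteq> X" for x using VE WX by blast
  have V_F: "y = x" if x: "x \<in> F" and y: "y \<in> V x" "y \<in> F" for x y
  proof -
    obtain p B where p: "p \<in> Z x" "B \<in> \<W>" "p \<in> B" "y \<in> B" using VE[OF y(1)] by blast
    have "p \<in> ZZ" using p(1) x by (auto simp: ZZ_def)
    moreover have "y \<in> ZZ" using Z_self[of y] y(2) by (auto simp: ZZ_def)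
    ultimately have "p = y" using sep[OF p(2)] p(3,4) by blast
    then show ?thesis using Z_F[OF x p(1)] y(2) by blast
  qed
  have V_U: "\<exists>A\<in>\<U>. V x \<subseteq> A" if x: "x \<in> F" for x
  proof -
    \<comment> \<open>From \<open>x\<close> to a point of \<open>Z x\<close> and on to a point near it, \<open>f A\<close> rises by less than \<open>1/2 + 1/2\<close>.\<close>
    obtain A where A: "A \<in> \<U>" "f A x = 0" using f(3) x F(2) by blast
    have "y \<in> A" if y: "y \<in> V x" for y
    proof -
      obtain p B where p: "p \<in> Z x" "B \<in> \<W>" "p \<in> B" "y \<in> B" using VE[OF y] by blast
      have "f A y < 1"
        using Z_near[OF x p(1) A(1)] osc[OF A(1) p(2-4)] A(2) by linarith
      then show ?thesis using f(2)[OF A(1)] VX y by blast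
    qed
    then show ?thesis using A(1) by blast
  qed
  define \<V> where "\<V> = (\<lambda>A. A - F) ` \<U> \<union> V ` F"
  have inV1: "A - F \<in> \<V>" if "A \<in> \<U>" for A using that by (simp add: \<V>_def)
  have inV2: "V x \<in> \<V>" if "x \<in> F" for x using that by (simp add: \<V>_def)
  have "\<V> \<in> \<D>"
  proof (rule coarserI[OF W(1)])
    show "\<V> \<preceq> \<W>"
      unfolding refined_by_def
    proof
      fix B assume B: "B \<in> \<W>"
      show "\<exists>C\<in>\<V>. B \<subseteq> C"
      proof (cases "B \<inter> F = {}")
        case True
        obtain A where A: "A \<in> \<U>" "B \<subseteq> A" using WU[OF B] by blast
        have "B \<subseteq> A - F" using A(2) True by blast
        then show ?thesis using inV1[OF A(1)] by (rule rev_bexI[rotated])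
      next
        case False
        then obtain x where x: "x \<in> B" "x \<in> F" by blast
        have "B \<subseteq> V x" using V_sup[OF B x(1) Z_self] .
        then show ?thesis using inV2[OF x(2)] by (rule rev_bexI[rotated])
      qed
    qed
  qed (use VX member_subset[OF UD] in \<open>auto simp: \<V>_def\<close>)
  then have VN: "\<V> \<in> \<N> \<D>" using finU F(1) by (simp add: \<V>_def finite_uniform_coverings_def)
  have UV: "\<U> \<preceq> \<V>"
    unfolding refined_by_def
  proof
    fix C assume "C \<in> \<V>"
    then show "\<exists>A\<in>\<U>. C \<subseteq> A" using V_U by (auto simp: \<V>_def)
  qed
  have lower: "card F \<le> uniform_complexity \<D> \<V>"
  proof -
    obtain \<R> where R: "\<R> \<in> \<N> \<D>" "\<V> \<preceq> \<R>" "card \<R> = uniform_complexity \<D> \<V>"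
      using ex_minimal_refinement[OF VN] by blast
    have RD: "\<R> \<in> \<D>" "finite \<R>" using R(1) by (auto simp: finite_uniform_coverings_def)
    have "\<forall>x\<in>F. \<exists>C. C \<in> \<R> \<and> x \<in> C" using ex_member[OF RD(1)] F(2) by blast
    then obtain c where c: "\<And>x. x \<in> F \<Longrightarrow> c x \<in> \<R> \<and> x \<in> c x" by metis
    have "inj_on c F"
    proof (rule inj_onI)
      fix x y assume xy: "x \<in> F" "y \<in> F" "c x = c y"
      obtain C where C: "C \<in> \<V>" "c x \<subseteq> C" using refined_byD[OF R(2)] c[OF xy(1)] by blast
      have "x \<in> C" "y \<in> C" using C(2) c[OF xy(1)] c[OF xy(2)] xy(3) by auto
      moreover from this have "C \<notin> (\<lambda>A. A - F) ` \<U>" using xy(1) by auto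
      then obtain z where "z \<in> F" "C = V z" using C(1) by (auto simp: \<V>_def)
      ultimately show "x = y" using V_F xy by blast
    qed
    then have "card F \<le> card \<R>" using c RD(2) by (intro card_inj_on_le[of c]) auto
    then show ?thesis using R(3) by simp
  qed
  have upper: "uniform_complexity \<D> (\<V> \<squnion>\<^sub>c (`) g ` \<V>)
       \<le> card F + card \<U> * card \<U> + 2 * card \<U> * card (F - F' g)" if g: "g \<in> E" for g
  proof -
    have gG: "g \<in> G" using g E(2) by blast
    define y where "y x = \<iota> g (k g x)" for x
    have y: "y x \<in> F \<and> g (y x) = k g x" if x: "x \<in> F' g" for x
    proof -
      obtain z where z: "z \<in> F" "k g x = g z" using k(2)[OF g] x by blast
      then have "\<iota> g (g z) = z" using \<iota>X(2)[OF g] F(2) by blast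
      then show ?thesis using z by (simp add: y_def)
    qed
    define Y where "Y = y ` F' g"
    have finF': "finite (F' g)" using F'[OF g] F(1) finite_subset by blast
    have "inj_on y (F' g)" using k(1)[OF g] y by (metis inj_on_def)
    then have cardY: "card Y = card (F' g)" by (simp add: Y_def card_image)
    have YF: "Y \<subseteq> F" using y by (auto simp: Y_def)
    \<comment> \<open>Matched pairs, points away from \<open>F\<close> and \<open>g F\<close>, unmatched points of \<open>F\<close>, and unmatched points
      of \<open>g F\<close>. In the last two cases all \<open>A \<in> \<U>\<close> are admitted, which avoids a choice.\<close>
    define \<R>1 where "\<R>1 = (\<lambda>x. V x \<inter> g ` V (y x)) ` F' g"
    define \<R>2 where "\<R>2 = (\<lambda>(A, C). (A - F) \<inter> g ` (C - F)) ` (\<U> \<times> \<U>)"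
    define \<R>3 where "\<R>3 = (\<lambda>(A, x). V x \<inter> g ` (A - F)) ` (\<U> \<times> (F - F' g))"
    define \<R>4 where "\<R>4 = (\<lambda>(A, x). (A - F) \<inter> g ` V x) ` (\<U> \<times> (F - Y))"
    define \<R> where "\<R> = \<R>1 \<union> \<R>2 \<union> \<R>3 \<union> \<R>4"
    have fin: "finite \<R>1" "finite \<R>2" "finite \<R>3" "finite \<R>4"
      using finF' finU F(1) by (auto simp: \<R>1_def \<R>2_def \<R>3_def \<R>4_def)
    have inJ: "C \<inter> g ` C' \<in> \<V> \<squnion>\<^sub>c (`) g ` \<V>" if "C \<in> \<V>" "C' \<in> \<V>" for C C'
      using that by (auto simp: cover_join_def)
    have RJ: "\<R> \<subseteq> \<V> \<squnion>\<^sub>c (`) g ` \<V>"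
      using F'[OF g] y inJ inV1 inV2
      by (auto simp: \<R>_def \<R>1_def \<R>2_def \<R>3_def \<R>4_def subset_iff)
    obtain \<W>' where W': "\<W>' \<in> \<D>" "\<W> \<preceq> \<W>'" "(`) g ` \<W> \<preceq> \<W>'"
      using ex_refinement2[OF W(1) image_uniform[OF gG W(1)]] by blast
    have "\<R> \<in> \<D>"
    proof (rule coarserI[OF W'(1)])
      show "C \<subseteq> X" if "C \<in> \<R>" for C
        using that VX member_subset[OF UD] by (auto simp: \<R>_def \<R>1_def \<R>2_def \<R>3_def \<R>4_def)
      show "\<R> \<preceq> \<W>'"
        unfolding refined_by_def
      proof
        fix B assume B: "B \<in> \<W>'"
        obtain B1 where B1: "B1 \<in> \<W>" "B \<subseteq> B1" using refined_byD[OF W'(2) B] by blast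
        obtain B2 where B2: "B2 \<in> \<W>" "B \<subseteq> g ` B2"
          using refined_byD[OF W'(3) B] by (elim bexE imageE) simp
        have a: "B \<subseteq> V x" if "p \<in> B" "p \<in> Z x" for p x
          using V_sup[OF B1(1) _ that(2)] B1(2) that(1) by blast
        have b: "B \<subseteq> g ` V x" if p: "g p \<in> B" "p \<in> Z x" "x \<in> F" for p x
        proof -
          have "g p \<in> g ` B2" using p(1) B2(2) by blast
          then have "p \<in> B2"
            using inj_on_image_mem_iff[OF inj[OF gG] _ WX[OF B2(1)]] ZX[OF p(3)] p(2) by blast
          then show ?thesis using V_sup[OF B2(1) _ p(2)] B2(2) by blast
        qed
        have c: "\<exists>A\<in>\<U>. B \<subseteq> A - F" if "B \<inter> F = {}"
          using WU[OF B1(1)] B1(2) that by blast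
        have d: "\<exists>A\<in>\<U>. B \<subseteq> g ` (A - F)" if "B \<inter> g ` F = {}"
        proof -
          obtain A where A: "A \<in> \<U>" "B2 \<subseteq> A" using WU[OF B2(1)] by blast
          have "b \<in> g ` (A - F)" if b: "b \<in> B" for b
          proof -
            obtain z where z: "z \<in> B2" "b = g z" using b B2(2) by blast
            then have "z \<notin> F" using b \<open>B \<inter> g ` F = {}\<close> by blast
            then show ?thesis using z A(2) by blast
          qed
          then show ?thesis using A(1) by blast
        qed
        consider (1) x where "x \<in> F' g" "x \<in> B" | (2) x where "x \<in> F' g" "k g x \<in> B"
          | (3) x where "x \<in> F - F' g" "x \<in> B" "B \<inter> g ` F = {}"
          | (4) z where "z \<in> F - Y" "g z \<in> B" "B \<inter> F = {}"
          | (5) "B \<inter> F = {}" "B \<inter> g ` F = {}"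
        proof -
          assume *: "\<And>x. x \<in> F' g \<Longrightarrow> x \<in> B \<Longrightarrow> thesis" "\<And>x. x \<in> F' g \<Longrightarrow> k g x \<in> B \<Longrightarrow> thesis"
            "\<And>x. x \<in> F - F' g \<Longrightarrow> x \<in> B \<Longrightarrow> B \<inter> g ` F = {} \<Longrightarrow> thesis"
            "\<And>z. z \<in> F - Y \<Longrightarrow> g z \<in> B \<Longrightarrow> B \<inter> F = {} \<Longrightarrow> thesis"
            "B \<inter> F = {} \<Longrightarrow> B \<inter> g ` F = {} \<Longrightarrow> thesis"
          \<comment> \<open>A member of \<open>\<W>'\<close> that meets both \<open>F\<close> and \<open>g F\<close> does so in a common point, which is matched.\<close>
          have mix: thesis if x: "x \<in> F" "x \<in> B" and z: "z \<in> F" "g z \<in> B" for x z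
          proof -
            have "x \<in> ZZ" "g z \<in> ZZ" using x(1) z(1) Z_self[of x] g by (auto simp: ZZ_def)
            then have "x = g z" using sep[OF B1(1)] x(2) z(2) B1(2) by blast
            then have "x \<in> F' g" using k_id(1)[OF g x(1)] z(1) by blast
            then show thesis using *(1) x(2) by blast
          qed
          have gY: thesis if z: "z \<in> Y" "g z \<in> B" for z
            using z y *(2) by (auto simp: Y_def)
          show thesis
          proof (cases "B \<inter> F = {}"; cases "B \<inter> g ` F = {}")
            assume "B \<inter> F = {}" "B \<inter> g ` F = {}"
            then show thesis by (rule *(5))
          next
            assume BF: "B \<inter> F = {}" and "B \<inter> g ` F \<noteq> {}"
            then obtain z where "z \<in> F" "g z \<in> B" by blast
            then show thesis using gY *(4) BF by blast
          next
            assume "B \<inter> F \<noteq> {}" and Bg: "B \<inter> g ` F = {}"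
            then obtain x where "x \<in> F" "x \<in> B" by blast
            then show thesis using *(1,3) Bg by blast
          next
            assume "B \<inter> F \<noteq> {}" and "B \<inter> g ` F \<noteq> {}"
            then obtain x z where "x \<in> F" "x \<in> B" "z \<in> F" "g z \<in> B" by blast
            then show thesis by (rule mix)
          qed
        qed
        then show "\<exists>C\<in>\<R>. B \<subseteq> C"
        proof cases
          case 1
          have xX: "x \<in> X" by (rule F'X[OF g 1(1)])
          have "\<iota> g x \<in> Z (y x)" using Z_\<iota>[OF g 1(1)] y[OF 1(1)] by simp
          then have "B \<subseteq> g ` V (y x)" using b[of "\<iota> g x" "y x"] \<iota>X(3)[OF g xX] 1 y by simp
          moreover have "B \<subseteq> V x" using a[OF 1(2) Z_self] .
          ultimately have "B \<subseteq> V x \<inter> g ` V (y x)" by blast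
          moreover have "V x \<inter> g ` V (y x) \<in> \<R>" using 1(1) unfolding \<R>_def \<R>1_def by blast
          ultimately show ?thesis by blast
        next
          case 2
          have "B \<subseteq> V x" using a[OF 2(2) Z_k[OF g 2(1)]] .
          moreover have "B \<subseteq> g ` V (y x)" using b[of "y x" "y x"] Z_self 2 y by simp
          ultimately have "B \<subseteq> V x \<inter> g ` V (y x)" by blast
          moreover have "V x \<inter> g ` V (y x) \<in> \<R>" using 2(1) unfolding \<R>_def \<R>1_def by blast
          ultimately show ?thesis by blast
        next
          case 3
          obtain A where A: "A \<in> \<U>" "B \<subseteq> g ` (A - F)" using d[OF 3(3)] by blast
          have "B \<subseteq> V x" using a[OF 3(2) Z_self] .
          then have "B \<subseteq> V x \<inter> g ` (A - F)" using A(2) by blast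
          moreover have "V x \<inter> g ` (A - F) \<in> \<R>"
            using A(1) 3(1) unfolding \<R>_def \<R>3_def by blast
          ultimately show ?thesis by blast
        next
          case 4
          obtain A where A: "A \<in> \<U>" "B \<subseteq> A - F" using c[OF 4(3)] by blast
          have "B \<subseteq> g ` V z" using b[OF 4(2) Z_self] 4(1) by blast
          then have "B \<subseteq> (A - F) \<inter> g ` V z" using A(2) by blast
          moreover have "(A - F) \<inter> g ` V z \<in> \<R>"
            using A(1) 4(1) unfolding \<R>_def \<R>4_def by blast
          ultimately show ?thesis by blast
        next
          case 5
          obtain A where A: "A \<in> \<U>" "B \<subseteq> A - F" using c[OF 5(1)] by blast
          obtain C where C: "C \<in> \<U>" "B \<subseteq> g ` (C - F)" using d[OF 5(2)] by blast
          have "B \<subseteq> (A - F) \<inter> g ` (C - F)" using A(2) C(2) by blast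
          moreover have "(A - F) \<inter> g ` (C - F) \<in> \<R>"
            using A(1) C(1) unfolding \<R>_def \<R>2_def by blast
          ultimately show ?thesis by blast
        qed
      qed
    qed
    then have "\<R> \<in> \<N> \<D>" using fin by (simp add: finite_uniform_coverings_def \<R>_def)
    moreover have "\<V> \<squnion>\<^sub>c (`) g ` \<V> \<preceq> \<R>" using RJ by (auto simp: refined_by_def)
    ultimately have "uniform_complexity \<D> (\<V> \<squnion>\<^sub>c (`) g ` \<V>) \<le> card \<R>"
      by (rule uniform_complexity_le)
    also have "card \<R> \<le> card \<R>1 + card \<R>2 + card \<R>3 + card \<R>4"
      unfolding \<R>_def by (intro order_trans[OF card_Un_le] add_right_mono order_refl)
    also have "\<dots> \<le> card F + card \<U> * card \<U> + card \<U> * card (F - F' g) + card \<U> * card (F - F' g)"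
    proof (intro add_mono)
      show "card \<R>1 \<le> card F"
        unfolding \<R>1_def using card_image_le[OF finF'] card_mono[OF F(1) F'[OF g]] by (rule order_trans)
      show "card \<R>2 \<le> card \<U> * card \<U>"
        unfolding \<R>2_def card_cartesian_product[symmetric] using finU by (intro card_image_le) simp
      show "card \<R>3 \<le> card \<U> * card (F - F' g)"
        unfolding \<R>3_def card_cartesian_product[symmetric] using finU F(1) by (intro card_image_le) simp
      have "card (F - Y) = card (F - F' g)"
        using F(1) F'[OF g] YF cardY by (simp add: card_Diff_subset finite_subset)
      then show "card \<R>4 \<le> card \<U> * card (F - F' g)"
        unfolding \<R>4_def using finU F(1) card_image_le[of "\<U> \<times> (F - Y)"]
        by (simp add: card_cartesian_product)
    qed
    finally show ?thesis by (simp add: algebra_simps)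
  qed
  show ?thesis using VN UV lower upper by blast
qed

text \<open>The test functions have to control closeness for \<open>f A\<close> and for \<open>f A \<circ> g\<^sup>-\<^sup>1\<close>, so both kinds enter
  \<open>\<Phi>\<close>.\<close>

theorem complexity_le_1_if_amenable:
  assumes "amenable X \<D> G"
  shows "asymptotic_uniform_complexity \<D> G \<le> 1"
proof -
  obtain m where m: "mean X \<D> m" and inv: "\<And>f g. f \<in> UC\<^sub>b X \<D> \<Longrightarrow> g \<in> G \<Longrightarrow> m (compose X f g) = m f"
    using assms unfolding amenable_def by blast
  let ?r = "\<lambda>\<V> g. ereal (real (uniform_complexity \<D> (\<V> \<squnion>\<^sub>c (`) g ` \<V>)) / real (uniform_complexity \<D> \<V>))"
  have "\<forall>g\<in>G. \<exists>h. h \<in> G \<and> (\<forall>x\<in>X. h (g x) = x \<and> g (h x) = x)" using ex_inverse_in_G by blast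
  then obtain \<iota> where \<iota>: "\<And>g. g \<in> G \<Longrightarrow> \<iota> g \<in> G \<and> (\<forall>x\<in>X. \<iota> g (g x) = x \<and> g (\<iota> g x) = x)" by metis
  have main: "\<exists>\<V>\<in>\<N> \<D>. \<U> \<preceq> \<V> \<and> (\<forall>g\<in>E. ?r \<V> g \<le> 1 + ereal \<eta>)"
    if E: "finite E" "E \<subseteq> G" and U: "\<U> \<in> \<N> \<D>" and \<eta>: "\<eta> > 0" for E \<U> \<eta>
  proof -
    have UD: "\<U> \<in> \<D>" and finU: "finite \<U>" using U by (auto simp: finite_uniform_coverings_def)
    obtain f where f: "\<And>A. A \<in> \<U> \<Longrightarrow> f A \<in> UC\<^sub>b X \<D>" "\<And>A x. A \<in> \<U> \<Longrightarrow> x \<in> X \<Longrightarrow> f A x < 1 \<Longrightarrow> x \<in> A"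
        "\<And>x. x \<in> X \<Longrightarrow> \<exists>A\<in>\<U>. f A x = 0"
      using subordinate_functions[OF UD] by blast
    define \<Phi> where "\<Phi> = f ` \<U> \<union> (\<lambda>(A, g). compose X (f A) (\<iota> g)) ` (\<U> \<times> E)"
    have \<Phi>: "finite \<Phi>" "\<Phi> \<subseteq> UC\<^sub>b X \<D>"
      using finU E f(1) \<iota> compose_UC\<^sub>b by (auto simp: \<Phi>_def)
    obtain Q where Q: "finite Q" "Q \<subseteq> UC\<^sub>b X \<D>" "separating (near \<Phi> (1 / 2)) Q"
      using ex_finite_separating[OF \<Phi>, of "1 / 2"] by auto
    define K where "K = real (card \<U>)"
    \<comment> \<open>In the bound \<open>card F + K\<^sup>2 + 2 K card (F - F' g)\<close> the last term is at most \<open>2 K \<epsilon> card F\<close>, and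
      \<open>K\<^sup>2\<close> is negligible once \<open>F\<close> is large. Each gets half of \<open>\<eta> card F\<close>.\<close>
    define \<epsilon> where "\<epsilon> = \<eta> / (4 * (K + 1))"
    have K: "K \<ge> 0" by (simp add: K_def)
    have \<epsilon>: "\<epsilon> > 0" using \<eta> K by (simp add: \<epsilon>_def)
    have \<epsilon>K: "2 * K * \<epsilon> \<le> \<eta> / 2" using \<eta> K by (simp add: \<epsilon>_def field_simps)
    obtain F where F: "F \<subseteq> X" "finite F" "max 1 (nat \<lceil>2 * K\<^sup>2 / \<eta>\<rceil>) \<le> card F"
        "\<forall>q\<in>Q. \<forall>g\<in>E. \<bar>sum q F - sum q (g ` F)\<bar> \<le> \<epsilon> * real (card F)"
      using ex_Folner_set[OF m inv Q(1,2) E \<epsilon>, of "max 1 (nat \<lceil>2 * K\<^sup>2 / \<eta>\<rceil>)"] by blast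
    define n where "n = real (card F)"
    have n: "n > 0" using F(3) by (simp add: n_def)
    have "2 * K\<^sup>2 / \<eta> \<le> n" using F(3) unfolding n_def by linarith
    then have K2: "K\<^sup>2 \<le> \<eta> / 2 * n" using \<eta> by (simp add: field_simps)
    \<comment> \<open>The domain and the matching are packed into a pair so that one choice yields both.\<close>
    have "\<forall>g\<in>E. \<exists>p. fst p \<subseteq> F \<and> inj_on (snd p) (fst p) \<and> snd p ` fst p \<subseteq> g ` F \<and>
        (\<forall>x\<in>fst p. near \<Phi> (1 / 2) x (snd p x)) \<and> (\<forall>x\<in>F \<inter> g ` F. x \<in> fst p \<and> snd p x = x) \<and>
        (\<forall>x\<in>fst p. snd p x \<in> F \<longrightarrow> snd p x = x) \<and> real (card (F - fst p)) \<le> \<epsilon> * n"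
    proof
      fix g assume g: "g \<in> E"
      then have "g \<in> G" using E(2) by blast
      then have gF: "g ` F \<subseteq> X" using maps_to F(1) by blast
      have "\<exists>F' k. F' \<subseteq> F \<and> inj_on k F' \<and> k ` F' \<subseteq> g ` F \<and> (\<forall>x\<in>F'. near \<Phi> (1 / 2) x (k x)) \<and>
        (\<forall>x\<in>F \<inter> g ` F. x \<in> F' \<and> k x = x) \<and> (\<forall>x\<in>F'. k x \<in> F \<longrightarrow> k x = x) \<and>
        real (card (F - F')) \<le> \<epsilon> * n"
      proof (rule ex_matching[OF F(2,1) _ gF _ Q(3)])
        show "near \<Phi> (1 / 2) x x" for x by (simp add: near_def)
        show "\<bar>sum q F - sum q (g ` F)\<bar> \<le> \<epsilon> * n" if "q \<in> Q" for q
          using F(4) that g by (simp add: n_def)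
      qed (use F(2) in simp)
      then obtain F' k where *: "F' \<subseteq> F \<and> inj_on k F' \<and> k ` F' \<subseteq> g ` F \<and> (\<forall>x\<in>F'. near \<Phi> (1 / 2) x (k x)) \<and>
        (\<forall>x\<in>F \<inter> g ` F. x \<in> F' \<and> k x = x) \<and> (\<forall>x\<in>F'. k x \<in> F \<longrightarrow> k x = x) \<and>
        real (card (F - F')) \<le> \<epsilon> * n" by (elim exE)
      show "\<exists>p. fst p \<subseteq> F \<and> inj_on (snd p) (fst p) \<and> snd p ` fst p \<subseteq> g ` F \<and>
        (\<forall>x\<in>fst p. near \<Phi> (1 / 2) x (snd p x)) \<and> (\<forall>x\<in>F \<inter> g ` F. x \<in> fst p \<and> snd p x = x) \<and>
        (\<forall>x\<in>fst p. snd p x \<in> F \<longrightarrow> snd p x = x) \<and> real (card (F - fst p)) \<le> \<epsilon> * n"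
        by (rule exI[of _ "(F', k)"]) (unfold fst_conv snd_conv, rule *)
    qed
    from bchoice[OF this] obtain P where P: "\<forall>g\<in>E. fst (P g) \<subseteq> F \<and>
        inj_on (snd (P g)) (fst (P g)) \<and> snd (P g) ` fst (P g) \<subseteq> g ` F \<and>
        (\<forall>x\<in>fst (P g). near \<Phi> (1 / 2) x (snd (P g) x)) \<and>
        (\<forall>x\<in>F \<inter> g ` F. x \<in> fst (P g) \<and> snd (P g) x = x) \<and>
        (\<forall>x\<in>fst (P g). snd (P g) x \<in> F \<longrightarrow> snd (P g) x = x) \<and> real (card (F - fst (P g))) \<le> \<epsilon> * n"
      by (elim exE)
    define F' where "F' g = fst (P g)" for g
    define k where "k g = snd (P g)" for g
    note P = P[folded F'_def k_def]
    have near: "\<bar>h x - h (k g x)\<bar> < 1 / 2" if "g \<in> E" "x \<in> F' g" "h \<in> \<Phi>" for g x h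
      using P that by (simp add: near_def)
    have "\<exists>\<V>\<in>\<N> \<D>. \<U> \<preceq> \<V> \<and> card F \<le> uniform_complexity \<D> \<V> \<and>
      (\<forall>g\<in>E. uniform_complexity \<D> (\<V> \<squnion>\<^sub>c (`) g ` \<V>)
         \<le> card F + card \<U> * card \<U> + 2 * card \<U> * card (F - F' g))"
    proof (rule ex_almost_invariant_covering[where f = f and \<iota> = \<iota> and k = k])
      show "\<iota> g x \<in> X \<and> \<iota> g (g x) = x \<and> g (\<iota> g x) = x" if "g \<in> E" "x \<in> X" for g x
        using \<iota>[of g] maps_to[of "\<iota> g" x] E(2) that by auto
      show "x \<in> F' g \<and> k g x = x" if "g \<in> E" "x \<in> F" "x \<in> g ` F" for g x
        using P that by blast
      show "k g x = x" if "g \<in> E" "x \<in> F' g" "k g x \<in> F" for g x using P that by blast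
      show "\<bar>f A x - f A (k g x)\<bar> < 1 / 2" if "g \<in> E" "x \<in> F' g" "A \<in> \<U>" for g x A
        using that by (intro near) (auto simp: \<Phi>_def)
      show "\<bar>f A (\<iota> g x) - f A (\<iota> g (k g x))\<bar> < 1 / 2" if "g \<in> E" "x \<in> F' g" "A \<in> \<U>" for g x A
      proof -
        have "compose X (f A) (\<iota> g) \<in> \<Phi>" using that(1,3) by (auto simp: \<Phi>_def)
        note n = near[OF that(1,2) this]
        have x: "x \<in> X" using P that(1,2) F(1) by blast
        have "k g x \<in> g ` F" using P that(1,2) by blast
        moreover have "g ` F \<subseteq> X" using image_mono[OF F(1), of g] image_X[OF subsetD[OF E(2) that(1)]] by simp
        ultimately have "k g x \<in> X" by (rule subsetD[rotated])
        then show ?thesis using n x by (simp add: compose_def)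
      qed
      show "F' g \<subseteq> F" "inj_on (k g) (F' g)" "k g ` F' g \<subseteq> g ` F" if "g \<in> E" for g
        using P that by simp_all
    qed (fact U f E F(1,2))+
    then obtain \<V> where V: "\<V> \<in> \<N> \<D>" "\<U> \<preceq> \<V>" "card F \<le> uniform_complexity \<D> \<V>"
      and le: "\<And>g. g \<in> E \<Longrightarrow> uniform_complexity \<D> (\<V> \<squnion>\<^sub>c (`) g ` \<V>)
         \<le> card F + card \<U> * card \<U> + 2 * card \<U> * card (F - F' g)"
      by blast
    have "?r \<V> g \<le> 1 + ereal \<eta>" if g: "g \<in> E" for g
    proof -
      have "real (uniform_complexity \<D> (\<V> \<squnion>\<^sub>c (`) g ` \<V>))
          \<le> real (card F + card \<U> * card \<U> + 2 * card \<U> * card (F - F' g))"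
        using le[OF g] by (simp only: of_nat_le_iff)
      also have "\<dots> = n + K\<^sup>2 + 2 * K * real (card (F - F' g))"
        by (simp add: n_def K_def power2_eq_square)
      also have "\<dots> \<le> n + \<eta> / 2 * n + 2 * K * (\<epsilon> * n)"
        using K2 P g K by (intro add_mono mult_left_mono) auto
      also have "\<dots> = n + \<eta> / 2 * n + 2 * K * \<epsilon> * n" by simp
      also have "\<dots> \<le> n + \<eta> / 2 * n + \<eta> / 2 * n"
        using \<epsilon>K n by (intro add_left_mono mult_right_mono) auto
      also have "\<dots> = (1 + \<eta>) * n" by (simp add: algebra_simps)
      also have "\<dots> \<le> (1 + \<eta>) * real (uniform_complexity \<D> \<V>)"
        using V(3) \<eta> by (intro mult_left_mono) (auto simp: n_def)
      finally have "real (uniform_complexity \<D> (\<V> \<squnion>\<^sub>c (`) g ` \<V>)) / real (uniform_complexity \<D> \<V>) \<le> 1 + \<eta>"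
        using uniform_complexity_pos[OF V(1)] by (simp add: pos_divide_le_eq)
      then show ?thesis by (simp add: one_ereal_def)
    qed
    then show ?thesis using V(1,2) by blast
  qed
  show ?thesis
    unfolding asymptotic_uniform_complexity_def
  proof (intro SUP_least)
    fix E \<U> assume "E \<in> Fpow G" and U: "\<U> \<in> \<N> \<D>"
    then have E: "finite E" "E \<subseteq> G" by (auto simp: Fpow_def)
    show "(INF \<V>\<in>{\<V> \<in> \<N> \<D>. \<U> \<preceq> \<V>}. SUP g\<in>E. ?r \<V> g) \<le> 1"
    proof (rule ereal_le_epsilon2)
      fix \<eta> :: real assume "0 < \<eta>"
      then obtain \<V> where V: "\<V> \<in> \<N> \<D>" "\<U> \<preceq> \<V>" "\<forall>g\<in>E. ?r \<V> g \<le> 1 + ereal \<eta>"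
        using main[OF E U] by blast
      have "(INF \<V>\<in>{\<V> \<in> \<N> \<D>. \<U> \<preceq> \<V>}. SUP g\<in>E. ?r \<V> g) \<le> (SUP g\<in>E. ?r \<V> g)"
        using V(1,2) by (intro INF_lower) simp
      also have "\<dots> \<le> 1 + ereal \<eta>" using V(3) by (intro SUP_least) blast
      finally show "(INF \<V>\<in>{\<V> \<in> \<N> \<D>. \<U> \<preceq> \<V>}. SUP g\<in>E. ?r \<V> g) \<le> 1 + ereal \<eta>" .
    qed
  qed
qed

end

theorem corollary6p8:
  fixes X :: "'a set" and \<D> :: "'a set set set" and G :: "('a \<Rightarrow> 'a) set"
  assumes "dynamical_system X \<D> G"
  shows "(asymptotic_uniform_complexity \<D> G = 1 \<longrightarrow> amenable X \<D> G) \<and>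
         (no_isolated_points (cover_topology X \<D>) \<and> Hausdorff_space (cover_topology X \<D>) \<and>
            amenable X \<D> G \<longrightarrow> asymptotic_uniform_complexity \<D> G = 1)"
proof (intro conjI impI)
  interpret dynamics X \<D> G by unfold_locales (rule assms)
  show "amenable X \<D> G" if "asymptotic_uniform_complexity \<D> G = 1"
    using amenable_if_complexity_le_1 that by simp
  assume *: "no_isolated_points (cover_topology X \<D>) \<and> Hausdorff_space (cover_topology X \<D>) \<and>
    amenable X \<D> G"
  then interpret perfect_dynamics X \<D> G by unfold_locales blast+
  show "asymptotic_uniform_complexity \<D> G = 1"
    using complexity_le_1_if_amenable complexity_ge_1 * by (simp add: antisym)
qed

end
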